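(* There is a multithreaded algorithm that, given a leaf-based binary tree $T$ with $n$ leaves (each holding an item) and height $h$, and a condition $C$ on items, returns a batch containing exactly the items of $T$ satisfying $C$ in the same left-to-right order as in $T$, and that takes $O(n\cdot w+k\cdot h)$ work and $O(h+s)$ span whenever every evaluation of $C$ takes $O(w)$ work and $O(s)$ span, where $k$ is the size of the output batch.
   Context: Computation model: asynchronous dynamic multithreading on a parallel pointer machine with queued read-modify-write (QRMW) contention. Memory consists of nodes each with a fixed number of cells holding an integer or a pointer; pointers can only be stored, followed and tested for equality (no pointer arithmetic). Threads can fork threads, join (wait for termination of) a thread, suspend themselves, resume a suspended thread, terminate, create memory nodes, perform integer arithmetic, and perform read-modify-write operations (read, write, test-and-set, fetch-and-add, compare-and-swap) on memory cells, each in $O(1)$ time, except that RMW operations on the same memory cell are FIFO-queued and serviced one per time step, the issuing thread being blocked until its request is serviced. An execution is described by its execution DAG whose nodes are the executed primitive instructions, weighted by the time taken to execute them, and whose edges are the dependencies (program order within a thread, fork, join, resume). Work is the total weight of the DAG and span is the maximum total weight of a directed path. The bounds are required to hold for every execution schedule, asymptotically as the parameters grow. A leaf-based binary tree stores items only at its leaves. A batch of items is stored as a BBT: a full binary tree with items only at its leaves (the batch order is the left-to-right leaf order) in which at every internal node the heights of the two subtrees differ by at most $1$; each node stores its children, its subtree height and number of leaves, and the first and last item in its subtree. *)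

theory Defs
  imports "HOL-Library.Extended_Nat"
begin

section \<open>Execution DAGs\<close>

text \<open>The nodes of a DAG are \<open>0, ..., length (weights G) - 1\<close>.\<close>

record dag =
  weights :: "nat list"
  edges :: "(nat \<times> nat) set"

definition empty_dag :: dag where
  "empty_dag = \<lparr>weights = [], edges = {}\<rparr>"

definition dag_work :: "dag \<Rightarrow> nat" where
  "dag_work G = sum_list (weights G)"

definition dag_path :: "dag \<Rightarrow> nat list \<Rightarrow> bool" where
  "dag_path G p \<longleftrightarrow>
     set p \<subseteq> {..<length (weights G)} \<and> successively (\<lambda>u v. (u, v) \<in> edges G) p"

definition dag_span :: "dag \<Rightarrow> enat" where
  "dag_span G = (SUP p \<in> {p. dag_path G p}. enat (\<Sum>v\<leftarrow>p. weights G ! v))"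

definition add_node :: "nat \<Rightarrow> nat set \<Rightarrow> dag \<Rightarrow> dag" where
  "add_node k Q G =
     \<lparr>weights = weights G @ [k], edges = edges G \<union> Q \<times> {length (weights G)}\<rparr>"

text \<open>An evaluation of the condition is a sub-computation, given by its own execution DAG
  (entered at node 0) together with the node at which it returns the answer to the calling
  thread. The DAG may contain nodes that do not precede the return, namely those of threads
  that are still running then. Edges lead from smaller to larger node numbers, which for a
  finite DAG is only a choice of numbering.\<close>

type_synonym evaluation = "dag \<times> nat"

definition is_evaluation :: "evaluation \<Rightarrow> bool" where
  "is_evaluation D \<longleftrightarrow>
     (\<forall>k \<in> set (weights (fst D)). k \<ge> 1) \<and>
     (\<forall>(u, v) \<in> edges (fst D). u < v \<and> v < length (weights (fst D))) \<and>
     (\<forall>v < length (weights (fst D)). (0, v) \<in> (edges (fst D))\<^sup>*) \<and>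
     snd D < length (weights (fst D))"

definition graft :: "evaluation \<Rightarrow> nat set \<Rightarrow> dag \<Rightarrow> dag" where
  "graft D Q G = (let m = length (weights G) in
     \<lparr>weights = weights G @ weights (fst D),
      edges = edges G \<union> Q \<times> {m} \<union> (\<lambda>(u, v). (m + u, m + v)) ` edges (fst D)\<rparr>)"


section \<open>Programs of the QRMW parallel pointer machine\<close>

type_synonym addr = nat
type_synonym tid = nat
type_synonym reg = nat

datatype val = IntV int | Null | NodeP addr | ThreadP tid

datatype arith = Plus | Minus | Times | Div | Mod

datatype rmw =
    Read reg
  | Write reg
  | TestAndSet reg
  | FetchAndAdd reg reg
  | CompareAndSwap reg reg reg

text \<open>Registers, node sizes and cell numbers occur in instructions only as constants, so
  that a program, being finite, uses a fixed number of registers per thread and of cells per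
  node. The destination register comes first. \<open>JumpEq\<close> compares arbitrary values,
  \<open>JumpLess\<close> only integers. \<open>Eval d r\<close> evaluates the condition on the
  item in register \<open>r\<close>.\<close>

datatype instr =
    SetInt reg int
  | SetNull reg
  | Move reg reg
  | Self reg
  | Arith arith reg reg reg
  | JumpEq reg reg nat
  | JumpLess reg reg nat
  | New reg nat
  | RMW reg nat rmw
  | Fork reg nat
  | Join reg
  | Suspend
  | Resume reg
  | Terminate
  | Eval reg reg

type_synonym program = "instr list"

fun arith_op :: "arith \<Rightarrow> int \<Rightarrow> int \<Rightarrow> int" where
  "arith_op Plus i j = i + j"
| "arith_op Minus i j = i - j"
| "arith_op Times i j = i * j"
| "arith_op Div i j = i div j"
| "arith_op Mod i j = i mod j"

text \<open>Effect of an instruction that involves only the program counter and the registers of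
  the executing thread \<open>t\<close>; \<open>None\<close> for other instructions and for
  ill-typed operands.\<close>

fun simple_op :: "tid \<Rightarrow> instr \<Rightarrow> nat \<Rightarrow> (reg \<Rightarrow> val) \<Rightarrow> (nat \<times> (reg \<Rightarrow> val)) option" where
  "simple_op t (SetInt d i) l R = Some (Suc l, R(d := IntV i))"
| "simple_op t (SetNull d) l R = Some (Suc l, R(d := Null))"
| "simple_op t (Move d r) l R = Some (Suc l, R(d := R r))"
| "simple_op t (Self d) l R = Some (Suc l, R(d := ThreadP t))"
| "simple_op t (Arith f d r r') l R =
     (case (R r, R r') of
        (IntV i, IntV j) \<Rightarrow> Some (Suc l, R(d := IntV (arith_op f i j)))
      | _ \<Rightarrow> None)"
| "simple_op t (JumpEq r r' l') l R = Some (if R r = R r' then l' else Suc l, R)"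
| "simple_op t (JumpLess r r' l') l R =
     (case (R r, R r') of
        (IntV i, IntV j) \<Rightarrow> Some (if i < j then l' else Suc l, R)
      | _ \<Rightarrow> None)"
| "simple_op t _ l R = None"

text \<open>New cell content and new registers, given the old cell content. Fetch-and-add has no
  effect unless both operands are integers.\<close>

fun rmw_op :: "rmw \<Rightarrow> (reg \<Rightarrow> val) \<Rightarrow> val \<Rightarrow> val \<times> (reg \<Rightarrow> val)" where
  "rmw_op (Read d) R x = (x, R(d := x))"
| "rmw_op (Write r) R x = (R r, R)"
| "rmw_op (TestAndSet d) R x = (IntV 1, R(d := x))"
| "rmw_op (FetchAndAdd d r) R x =
     (case (x, R r) of
        (IntV i, IntV j) \<Rightarrow> (IntV (i + j), R(d := x))
      | _ \<Rightarrow> (x, R))"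
| "rmw_op (CompareAndSwap d r r') R x =
     (if x = R r then (R r', R(d := IntV 1)) else (x, R(d := IntV 0)))"


section \<open>Executions\<close>

datatype status = Running | Blocked | Suspended | Terminated

text \<open>\<open>ready\<close> is the earliest time step in which the thread may act, and
  \<open>deps\<close> are the DAG nodes on which its next instruction directly depends (for a
  terminated thread, its last instruction).\<close>

record thread =
  pc :: nat
  regs :: "reg \<Rightarrow> val"
  status :: status
  ready :: nat
  deps :: "nat set"

text \<open>A queue holds the waiting threads with the time at which they issued their request.
  \<open>served\<close> is the set of cells that have serviced a request in the current time
  step. \<open>exec_dag\<close> is the DAG of the instructions executed so far.\<close>

record state =
  time :: nat
  heap :: "addr \<rightharpoonup> val list"
  queue :: "addr \<times> nat \<Rightarrow> (tid \<times> nat) list"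
  served :: "(addr \<times> nat) set"
  threads :: "tid \<rightharpoonup> thread"
  exec_dag :: dag

definition initial :: "(addr \<rightharpoonup> val list) \<Rightarrow> val \<Rightarrow> state" where
  "initial H x =
     \<lparr>time = 0, heap = H, queue = (\<lambda>_. []), served = {},
      threads = [0 \<mapsto> \<lparr>pc = 0, regs = (\<lambda>_. Null)(0 := x), status = Running, ready = 0, deps = {}\<rparr>],
      exec_dag = empty_dag\<rparr>"

definition can_execute :: "program \<Rightarrow> state \<Rightarrow> tid \<Rightarrow> thread \<Rightarrow> instr \<Rightarrow> bool" where
  "can_execute P \<sigma> t \<theta> i \<longleftrightarrow>
     threads \<sigma> t = Some \<theta> \<and> status \<theta> = Running \<and> ready \<theta> \<le> time \<sigma> \<and>
     pc \<theta> < length P \<and> P ! pc \<theta> = i"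

text \<open>The DAG node of the instruction that is executed next.\<close>

definition next_node :: "state \<Rightarrow> nat" where
  "next_node \<sigma> = length (weights (exec_dag \<sigma>))"

text \<open>Record an instruction of thread \<open>t\<close> with weight \<open>k\<close>,
  depending on the nodes \<open>Q\<close> besides the dependencies of the thread itself, after
  which the thread has program counter \<open>l\<close>, registers \<open>R\<close> and
  status \<open>st\<close>.\<close>

definition execute ::
  "tid \<Rightarrow> thread \<Rightarrow> nat \<Rightarrow> nat set \<Rightarrow> nat \<Rightarrow> (reg \<Rightarrow> val) \<Rightarrow> status \<Rightarrow> state \<Rightarrow> state" where
  "execute t \<theta> k Q l R st \<sigma> =
     \<sigma>\<lparr>exec_dag := add_node k (deps \<theta> \<union> Q) (exec_dag \<sigma>),
       threads := (threads \<sigma>)(t \<mapsto>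
         \<lparr>pc = l, regs = R, status = st, ready = Suc (time \<sigma>), deps = {next_node \<sigma>}\<rparr>)\<rparr>"

text \<open>Which threads act in a time step, and in which order, is up to the schedule; each acts
  at most once. Every nonempty queue services one request per time step, and the weight of a
  read-modify-write operation is the number of time steps from its issue to its service. A
  forked thread starts with a copy of its parent's registers. Resuming a thread that is not
  suspended has no effect. A thread whose instruction is ill-typed is stuck. The time that
  an evaluation takes appears in the DAG only; as the schedule can delay the calling thread
  arbitrarily, this does not restrict the executions.

  Parameters: the program, the condition, and the possible evaluations of the condition on
  an item.\<close>

inductive step ::
  "program \<Rightarrow> (val \<Rightarrow> bool) \<Rightarrow> (val \<Rightarrow> evaluation set) \<Rightarrow> state \<Rightarrow> state \<Rightarrow> bool"
  for P C E where
  simple: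
    "can_execute P \<sigma> t \<theta> i \<Longrightarrow> simple_op t i (pc \<theta>) (regs \<theta>) = Some (l, R) \<Longrightarrow>
     step P C E \<sigma> (execute t \<theta> 1 {} l R Running \<sigma>)"
| new:
    "can_execute P \<sigma> t \<theta> (New d m) \<Longrightarrow> a \<notin> dom (heap \<sigma>) \<Longrightarrow>
     step P C E \<sigma>
       ((execute t \<theta> 1 {} (Suc (pc \<theta>)) ((regs \<theta>)(d := NodeP a)) Running \<sigma>)
          \<lparr>heap := (heap \<sigma>)(a \<mapsto> replicate m Null)\<rparr>)"
| issue:
    "can_execute P \<sigma> t \<theta> (RMW r f op) \<Longrightarrow> regs \<theta> r = NodeP a \<Longrightarrow>
     heap \<sigma> a = Some cs \<Longrightarrow> f < length cs \<Longrightarrow>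
     step P C E \<sigma>
       (\<sigma>\<lparr>threads := (threads \<sigma>)(t \<mapsto> \<theta>\<lparr>status := Blocked\<rparr>),
          queue := (queue \<sigma>)((a, f) := queue \<sigma> (a, f) @ [(t, time \<sigma>)])\<rparr>)"
| service:
    "queue \<sigma> (a, f) = (t, \<tau>) # rest \<Longrightarrow> (a, f) \<notin> served \<sigma> \<Longrightarrow>
     threads \<sigma> t = Some \<theta> \<Longrightarrow> P ! pc \<theta> = RMW r f op \<Longrightarrow>
     heap \<sigma> a = Some cs \<Longrightarrow> rmw_op op (regs \<theta>) (cs ! f) = (x, R) \<Longrightarrow>
     step P C E \<sigma>
       ((execute t \<theta> (Suc (time \<sigma>) - \<tau>) {} (Suc (pc \<theta>)) R Running \<sigma>)
          \<lparr>heap := (heap \<sigma>)(a \<mapsto> cs[f := x]),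
           queue := (queue \<sigma>)((a, f) := rest),
           served := insert (a, f) (served \<sigma>)\<rparr>)"
| tick:
    "(\<And>c. queue \<sigma> c \<noteq> [] \<Longrightarrow> c \<in> served \<sigma>) \<Longrightarrow>
     step P C E \<sigma> (\<sigma>\<lparr>time := Suc (time \<sigma>), served := {}\<rparr>)"
| fork:
    "can_execute P \<sigma> t \<theta> (Fork d l) \<Longrightarrow> u \<notin> dom (threads \<sigma>) \<Longrightarrow>
     \<sigma>' = execute t \<theta> 1 {} (Suc (pc \<theta>)) ((regs \<theta>)(d := ThreadP u)) Running \<sigma> \<Longrightarrow>
     step P C E \<sigma>
       (\<sigma>'\<lparr>threads := (threads \<sigma>')(u \<mapsto>
          \<lparr>pc = l, regs = regs \<theta>, status = Running, ready = Suc (time \<sigma>), deps = {next_node \<sigma>}\<rparr>)\<rparr>)"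
| join:
    "can_execute P \<sigma> t \<theta> (Join r) \<Longrightarrow> regs \<theta> r = ThreadP u \<Longrightarrow>
     threads \<sigma> u = Some \<theta>' \<Longrightarrow> status \<theta>' = Terminated \<Longrightarrow> ready \<theta>' \<le> time \<sigma> \<Longrightarrow>
     step P C E \<sigma> (execute t \<theta> 1 (deps \<theta>') (Suc (pc \<theta>)) (regs \<theta>) Running \<sigma>)"
| suspend:
    "can_execute P \<sigma> t \<theta> Suspend \<Longrightarrow>
     step P C E \<sigma> (execute t \<theta> 1 {} (Suc (pc \<theta>)) (regs \<theta>) Suspended \<sigma>)"
| resume:
    "can_execute P \<sigma> t \<theta> (Resume r) \<Longrightarrow> regs \<theta> r = ThreadP u \<Longrightarrow>
     threads \<sigma> u = Some \<theta>' \<Longrightarrow> status \<theta>' = Suspended \<Longrightarrow>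
     \<sigma>' = execute t \<theta> 1 {} (Suc (pc \<theta>)) (regs \<theta>) Running \<sigma> \<Longrightarrow>
     step P C E \<sigma>
       (\<sigma>'\<lparr>threads := (threads \<sigma>')(u \<mapsto>
          \<theta>'\<lparr>status := Running, ready := Suc (time \<sigma>), deps := insert (next_node \<sigma>) (deps \<theta>')\<rparr>)\<rparr>)"
| resume_no_effect:
    "can_execute P \<sigma> t \<theta> (Resume r) \<Longrightarrow> regs \<theta> r = ThreadP u \<Longrightarrow>
     threads \<sigma> u = Some \<theta>' \<Longrightarrow> status \<theta>' \<noteq> Suspended \<Longrightarrow>
     step P C E \<sigma> (execute t \<theta> 1 {} (Suc (pc \<theta>)) (regs \<theta>) Running \<sigma>)"
| terminate:
    "can_execute P \<sigma> t \<theta> Terminate \<Longrightarrow>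
     step P C E \<sigma> (execute t \<theta> 1 {} (Suc (pc \<theta>)) (regs \<theta>) Terminated \<sigma>)"
| eval:
    "can_execute P \<sigma> t \<theta> (Eval d r) \<Longrightarrow> D \<in> E (regs \<theta> r) \<Longrightarrow>
     step P C E \<sigma>
       (\<sigma>\<lparr>exec_dag := graft D (deps \<theta>) (exec_dag \<sigma>),
          threads := (threads \<sigma>)(t \<mapsto>
            \<lparr>pc = Suc (pc \<theta>), regs = (regs \<theta>)(d := IntV (if C (regs \<theta> r) then 1 else 0)),
             status = Running, ready = Suc (time \<sigma>), deps = {next_node \<sigma> + snd D}\<rparr>)\<rparr>)"

text \<open>\<open>\<sigma>\<close> is the state after some finite, possibly incomplete execution.\<close>

definition reachable ::
  "program \<Rightarrow> (val \<Rightarrow> bool) \<Rightarrow> (val \<Rightarrow> evaluation set) \<Rightarrow> state \<Rightarrow> state \<Rightarrow> bool" where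
  "reachable P C E = (step P C E)\<^sup>*\<^sup>*"

text \<open>No instruction can be executed any more, now or later.\<close>

definition halted ::
  "program \<Rightarrow> (val \<Rightarrow> bool) \<Rightarrow> (val \<Rightarrow> evaluation set) \<Rightarrow> state \<Rightarrow> bool" where
  "halted P C E \<sigma> \<longleftrightarrow> (\<forall>\<sigma>'. reachable P C E \<sigma> \<sigma>' \<longrightarrow> exec_dag \<sigma>' = exec_dag \<sigma>)"

text \<open>The main thread has terminated, with the value \<open>x\<close> in register 0.\<close>

definition returned :: "state \<Rightarrow> val \<Rightarrow> bool" where
  "returned \<sigma> x \<longleftrightarrow> (\<exists>\<theta>. threads \<sigma> 0 = Some \<theta> \<and> status \<theta> = Terminated \<and> regs \<theta> 0 = x)"


section \<open>Leaf-based binary trees and batches\<close>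

datatype 'a ltree = Leaf 'a | Branch "'a ltree" "'a ltree"

fun items :: "'a ltree \<Rightarrow> 'a list" where
  "items (Leaf x) = [x]"
| "items (Branch l r) = items l @ items r"

fun height :: "'a ltree \<Rightarrow> nat" where
  "height (Leaf x) = 0"
| "height (Branch l r) = Suc (max (height l) (height r))"

fun balanced :: "'a ltree \<Rightarrow> bool" where
  "balanced (Leaf x) \<longleftrightarrow> True"
| "balanced (Branch l r) \<longleftrightarrow>
     balanced l \<and> balanced r \<and> height l \<le> height r + 1 \<and> height r \<le> height l + 1"

text \<open>\<open>tree_at H p A T\<close>: in \<open>H\<close> the tree \<open>T\<close> is
  stored with root \<open>p\<close>, its nodes being the distinct memory nodes \<open>A\<close>.
  The first three cells are left child, right child and, for leaves, the item.\<close>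

inductive tree_at :: "(addr \<rightharpoonup> val list) \<Rightarrow> addr \<Rightarrow> addr set \<Rightarrow> val ltree \<Rightarrow> bool" for H where
  "H p = Some (Null # Null # x # cs) \<Longrightarrow> tree_at H p {p} (Leaf x)"
| "H p = Some (NodeP l # NodeP r # x # cs) \<Longrightarrow> tree_at H l A T \<Longrightarrow> tree_at H r B U \<Longrightarrow>
   A \<inter> B = {} \<Longrightarrow> p \<notin> A \<union> B \<Longrightarrow> tree_at H p (insert p (A \<union> B)) (Branch T U)"

definition batch_node :: "val \<Rightarrow> val \<Rightarrow> val ltree \<Rightarrow> val list" where
  "batch_node l r B =
     [l, r, IntV (int (height B)), IntV (int (length (items B))), hd (items B), last (items B)]"

inductive bbt_at :: "(addr \<rightharpoonup> val list) \<Rightarrow> addr \<Rightarrow> addr set \<Rightarrow> val ltree \<Rightarrow> bool" for H where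
  "H p = Some (batch_node Null Null (Leaf x)) \<Longrightarrow> bbt_at H p {p} (Leaf x)"
| "H p = Some (batch_node (NodeP l) (NodeP r) (Branch T U)) \<Longrightarrow>
   bbt_at H l A T \<Longrightarrow> bbt_at H r B U \<Longrightarrow>
   A \<inter> B = {} \<Longrightarrow> p \<notin> A \<union> B \<Longrightarrow> balanced (Branch T U) \<Longrightarrow>
   bbt_at H p (insert p (A \<union> B)) (Branch T U)"

text \<open>The value \<open>x\<close> represents the batch \<open>xs\<close>; the empty batch is
  the null pointer.\<close>

definition is_batch :: "(addr \<rightharpoonup> val list) \<Rightarrow> val \<Rightarrow> val list \<Rightarrow> bool" where
  "is_batch H x xs \<longleftrightarrow>
     (xs = [] \<and> x = Null) \<or> (\<exists>p A B. x = NodeP p \<and> bbt_at H p A B \<and> items B = xs)"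

end

(*
  The algorithm is deterministic and race-free: at any time every memory node has a single owner.

  Counting. A fork-join recursion over T evaluates C at all leaves and builds a pruned copy S of T
  that contains the k surviving items, has no unary nodes and stores the number of leaves at each
  node. It has height at most h, so afterwards everything costs O(h) per surviving item.

  Distribution. At a branching node v of S the running thread continues in the left subtree and
  forks a thread for the right one, so that every leaf of S is reached by a thread of its own. The
  node v becomes the mailbox of the new thread. A thread that reaches the leaf of rank i knows the
  thread of rank i + 1 and its mailbox: they stem from the last node where it went left.

  Merging. With 2^J <= k < 2^(J+1) and r = k - 2^J, the output consists of the pairs (0,1), (2,3),
  ..., (2r-2,2r-1), followed by single items, 2^J blocks in total, which are merged level by level;
  all blocks of a level have one of two adjacent heights, so the result is balanced. The first
  thread of a block owns it. If the block has an even number, this thread joins the owner of the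
  next block, reads its result from the mailbox and turns the mailbox into the parent of both
  blocks; otherwise it publishes its block in its own mailbox and terminates.

  Correctness, the work bound, the span bound and deadlock freedom follow together from a program
  logic in which a thread owns a part of the heap, the right to join certain threads, a number of
  work credits, and a bound on the depth of its last instruction in the DAG.
*)
theory Submission
  imports Defs
begin

section \<open>Depth labellings of DAGs\<close>

text \<open>The threads at the leaves form a linked list in leaf order, each holding the only right
  to join its successor. Merging contracts this list: the mailbox of a joined thread also tells that
  thread's successor, and the right to join it changes hands, so after every level the remaining
  owners are linked again. No array or address computation is needed to find a neighbour by rank,
  and since blocks always absorb their right neighbour, one right per thread suffices. Time is
  controlled by deadlines instead of by analysing which path is critical. All leaves are reached by
  one common depth \<open>base\<close>, and the deadline of a block depends on its level only. A
  thread that waits has its own final block on a higher level than the block it waits for; so the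
  numbers that bound the span also exclude circular waiting. The number of levels is
  \<open>J + 1\<close> with \<open>J <= h\<close>, because a tree of height \<open>h\<close> has at
  most \<open>2 ^ h\<close> leaves. Credits are charged to leaves only: every leaf overpays, and the
  surplus covers the inner nodes, which are fewer.\<close>

type_synonym mem = "addr \<rightharpoonup> val list"

text \<open>The label of its last node bounds the weight of a path, by induction from the right.
  Labels are maintained instead of the span because a new node only needs a label of its own,
  whereas the span refers to all paths.\<close>

lemma dag_span_le_labelling:
  assumes e: "\<And>u v. (u, v) \<in> edges G \<Longrightarrow> dp u + weights G ! v \<le> dp v"
    and n: "\<And>v. v < length (weights G) \<Longrightarrow> weights G ! v \<le> dp v \<and> dp v \<le> B"
  shows "dag_span G \<le> enat B"
proof -
  have last: "p \<noteq> [] \<Longrightarrow> dag_path G p \<Longrightarrow> (\<Sum>v\<leftarrow>p. weights G ! v) \<le> dp (last p)" for p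
  proof (induction p rule: rev_induct)
    case (snoc x xs)
    show ?case
    proof (cases "xs = []")
      case True
      then show ?thesis using snoc.prems n[of x] by (simp add: dag_path_def)
    next
      case False
      have "dag_path G xs" and "(last xs, x) \<in> edges G"
        using snoc.prems False by (auto simp: dag_path_def successively_append_iff)
      then show ?thesis using snoc.IH[OF False] e[of "last xs" x] by simp
    qed
  qed simp
  have "enat (\<Sum>v\<leftarrow>p. weights G ! v) \<le> enat B" if p: "dag_path G p" for p
  proof (cases "p = []")
    case False
    have "last p < length (weights G)" using p last_in_set[OF False] unfolding dag_path_def by blast
    then show ?thesis using last[OF False p] n[of "last p"] by simp
  qed simp
  then show ?thesis unfolding dag_span_def by (intro SUP_least) auto
qed

text \<open>The largest weight of a path ending at a node serves as its label; it exists since the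
  span bounds all these weights. This converse is for evaluations, of which only the span is
  known.\<close>

lemma labelling_of_dag_span:
  assumes B: "dag_span G \<le> enat B"
    and val: "\<And>u v. (u, v) \<in> edges G \<Longrightarrow> u < length (weights G) \<and> v < length (weights G)"
  obtains dp where "\<And>u v. (u, v) \<in> edges G \<Longrightarrow> dp u + weights G ! v \<le> dp v"
    and "\<And>v. v < length (weights G) \<Longrightarrow> weights G ! v \<le> dp v \<and> dp v \<le> B"
proof -
  define S where "S v = {\<Sum>x\<leftarrow>p. weights G ! x | p. dag_path G p \<and> p \<noteq> [] \<and> last p = v}" for v
  have le: "x \<le> B" if x: "x \<in> S v" for x v
  proof -
    obtain p where p: "dag_path G p" and x: "x = (\<Sum>x\<leftarrow>p. weights G ! x)"
      using x by (auto simp: S_def)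
    have "enat x \<le> dag_span G" unfolding dag_span_def x by (intro SUP_upper) (simp add: p)
    then show ?thesis using B order_trans enat_ord_simps(1) by blast
  qed
  have fin: "finite (S v)" for v using le[of _ v] by (meson finite_nat_set_iff_bounded_le)
  have self: "weights G ! v \<in> S v" if "v < length (weights G)" for v
    unfolding S_def by (rule CollectI, rule exI[of _ "[v]"]) (simp add: dag_path_def that)
  show thesis
  proof
    fix u v assume uv: "(u, v) \<in> edges G"
    have "Max (S u) \<in> S u" using self[of u] val[OF uv] fin by (intro Max_in) auto
    then obtain p where p: "dag_path G p" "p \<noteq> []" "last p = u" and m: "Max (S u) = (\<Sum>x\<leftarrow>p. weights G ! x)"
      by (auto simp: S_def)
    have "dag_path G (p @ [v])"
      using p uv val[OF uv] by (auto simp: dag_path_def successively_append_iff)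
    then have "Max (S u) + weights G ! v \<in> S v" unfolding S_def
      by (intro CollectI exI[of _ "p @ [v]"]) (simp add: m[unfolded S_def])
    then show "Max (S u) + weights G ! v \<le> Max (S v)" using fin by (intro Max_ge)
  next
    fix v assume "v < length (weights G)"
    from self[OF this] show "weights G ! v \<le> Max (S v) \<and> Max (S v) \<le> B"
      using fin[of v] le[OF Max_in, of v] by (metis Max_ge empty_iff)
  qed
qed

text \<open>Bookkeeping that exists only in the proof: the invariant asserts that some assignment of
  it to the threads fits the state, and a step of the execution may pick a new one.\<close>

record 'q ghost =
  gspec :: 'q
  gheap :: mem
  gtoks :: "tid \<rightharpoonup> 'q"
  gwork :: nat
  gdepth :: nat
  gclaimed :: bool

section \<open>A program logic for race-free programs\<close>

text \<open>The type \<open>'q\<close> names thread specifications. A thread with specification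
  \<open>q\<close> terminates with a result satisfying \<open>post q\<close> at depth at most
  \<open>fin q\<close> in the DAG; \<open>q0\<close> belongs to the main thread, which starts with
  \<open>W\<close> work credits. The bounds \<open>ew\<close> and \<open>es\<close> are those on
  the work and span of evaluations.\<close>

locale race_free =
  fixes P :: program and C :: "val \<Rightarrow> bool" and E :: "val \<Rightarrow> evaluation set"
    and post :: "'q \<Rightarrow> (reg \<Rightarrow> val) \<Rightarrow> mem \<Rightarrow> (tid \<rightharpoonup> 'q) \<Rightarrow> bool"
    and fin :: "'q \<Rightarrow> nat"
    and ew es bound W :: nat and q0 :: 'q
begin

text \<open>\<open>ok q l R h J w d\<close>: a thread with specification \<open>q\<close> that is at
  program counter \<open>l\<close> with registers \<open>R\<close>, owns the nodes in \<open>h\<close>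
  and the rights \<open>J\<close> to join threads, has \<open>w\<close> work credits and depth at most
  \<open>d\<close>, behaves as specified. As nobody else accesses the nodes of \<open>h\<close>, a
  read-modify-write operation has weight at most 2: it can only be delayed by a service of the same
  cell in the time step of its issue. For uniformity all instructions but \<open>Eval\<close> are
  charged 2. By the rule for joins a thread waits only for threads with a smaller \<open>fin\<close>,
  which excludes deadlocks.\<close>

inductive ok :: "'q \<Rightarrow> nat \<Rightarrow> (reg \<Rightarrow> val) \<Rightarrow> mem \<Rightarrow> (tid \<rightharpoonup> 'q) \<Rightarrow> nat \<Rightarrow> nat \<Rightarrow> bool" where
  simple: "l < length P \<Longrightarrow> (\<And>t. simple_op t (P ! l) l R = Some (l', R')) \<Longrightarrow>
    ok q l' R' h J w' d' \<Longrightarrow> w' + 2 \<le> w \<Longrightarrow> d + 2 \<le> d' \<Longrightarrow> ok q l R h J w d"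
| rmw: "l < length P \<Longrightarrow> P ! l = RMW r f op \<Longrightarrow> R r = NodeP a \<Longrightarrow> h a = Some cs \<Longrightarrow>
    f < length cs \<Longrightarrow> rmw_op op R (cs ! f) = (x, R') \<Longrightarrow>
    ok q (Suc l) R' (h(a \<mapsto> cs[f := x])) J w' d' \<Longrightarrow> w' + 2 \<le> w \<Longrightarrow> d + 2 \<le> d' \<Longrightarrow>
    ok q l R h J w d"
| new: "l < length P \<Longrightarrow> P ! l = New r m \<Longrightarrow>
    (\<And>a. a \<notin> dom h \<Longrightarrow> ok q (Suc l) (R(r := NodeP a)) (h(a \<mapsto> replicate m Null)) J w' d') \<Longrightarrow>
    w' + 2 \<le> w \<Longrightarrow> d + 2 \<le> d' \<Longrightarrow> ok q l R h J w d"
| fork: "l < length P \<Longrightarrow> P ! l = Fork r l' \<Longrightarrow> h1 \<subseteq>\<^sub>m h \<Longrightarrow> h2 \<subseteq>\<^sub>m h \<Longrightarrow>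
    dom h1 \<inter> dom h2 = {} \<Longrightarrow> J1 \<subseteq>\<^sub>m J \<Longrightarrow> J2 \<subseteq>\<^sub>m J \<Longrightarrow> dom J1 \<inter> dom J2 = {} \<Longrightarrow>
    fin q' \<le> bound \<Longrightarrow> ok q' l' R h2 J2 w2 d2 \<Longrightarrow>
    (\<And>u. u \<notin> dom J \<Longrightarrow> ok q (Suc l) (R(r := ThreadP u)) h1 (J1(u \<mapsto> q')) w1 d1) \<Longrightarrow>
    w1 + w2 + 2 \<le> w \<Longrightarrow> d + 2 \<le> d1 \<Longrightarrow> d + 2 \<le> d2 \<Longrightarrow> ok q l R h J w d"
| join: "l < length P \<Longrightarrow> P ! l = Join r \<Longrightarrow> R r = ThreadP u \<Longrightarrow> J u = Some q' \<Longrightarrow>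
    (\<And>R' h' J'. post q' R' h' J' \<Longrightarrow> dom h \<inter> dom h' = {} \<Longrightarrow> dom J \<inter> dom J' = {} \<Longrightarrow>
      ok q (Suc l) R (h ++ h') (J(u := None) ++ J') w' d') \<Longrightarrow>
    w' + 2 \<le> w \<Longrightarrow> d + 2 \<le> d' \<Longrightarrow> fin q' + 2 \<le> d' \<Longrightarrow> d' \<le> fin q \<Longrightarrow> ok q l R h J w d"
| terminate: "l < length P \<Longrightarrow> P ! l = Terminate \<Longrightarrow> post q R h J \<Longrightarrow> 2 \<le> w \<Longrightarrow>
    d + 2 \<le> fin q \<Longrightarrow> ok q l R h J w d"
| eval: "l < length P \<Longrightarrow> P ! l = Eval r r' \<Longrightarrow> E (R r') \<noteq> {} \<Longrightarrow>
    (\<And>D. D \<in> E (R r') \<Longrightarrow> is_evaluation D \<and> dag_work (fst D) \<le> ew \<and> dag_span (fst D) \<le> enat es) \<Longrightarrow>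
    ok q (Suc l) (R(r := IntV (if C (R r') then 1 else 0))) h J w' d' \<Longrightarrow>
    w' + ew \<le> w \<Longrightarrow> d + es \<le> d' \<Longrightarrow> ok q l R h J w d"

text \<open>Depth only grows, and termination and joins cap it by \<open>fin q\<close>. Finiteness
  provides a fresh node or thread where a rule quantifies over all of them. The rule for joins
  states its cap explicitly, since its continuation is void if no resources satisfy the joined
  postcondition.\<close>

lemma ok_depth: "ok q l R h J w d \<Longrightarrow> finite (dom h) \<Longrightarrow> finite (dom J) \<Longrightarrow> d \<le> fin q"
proof (induction rule: ok.induct)
  case (new l r m h q R J w' d' w d)
  obtain a where "a \<notin> dom h" using new.prems(1) ex_new_if_finite infinite_UNIV_nat by blast
  from new.IH[OF this] new.prems new.hyps show ?case by (simp del: fun_upd_apply)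
next
  case (fork l r l' h1 h h2 J1 J J2 q' R w2 d2 q w1 d1 w d)
  obtain u where "u \<notin> dom J" using fork.prems(2) ex_new_if_finite infinite_UNIV_nat by blast
  moreover have "finite (dom h1)" "finite (dom J1)"
    using fork.prems fork.hyps map_le_implies_dom_le finite_subset by metis+
  ultimately show ?case using fork.IH(2) fork.hyps by fastforce
qed auto

lemma ok_mono:
  assumes "ok q l R h J w d" "w \<le> w'" "d' \<le> d"
  shows "ok q l R h J w' d'"
  using assms(1)
proof cases
  case simple
  then show ?thesis using assms(2,3) by (intro ok.simple[OF simple(1-3)]) auto
next
  case rmw
  then show ?thesis using assms(2,3) by (intro ok.rmw[OF rmw(1-7)]) auto
next
  case new
  then show ?thesis using assms(2,3) by (intro ok.new[OF new(1-3)]) auto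
next
  case fork
  then show ?thesis using assms(2,3) by (intro ok.fork[OF fork(1-11)]) auto
next
  case join
  then show ?thesis using assms(2,3) by (intro ok.join[OF join(1-5)]) auto
next
  case terminate
  then show ?thesis using assms(2,3) by (intro ok.terminate) auto
next
  case eval
  then show ?thesis using assms(2,3) by (intro ok.eval[OF eval(1-5)]) auto
qed

section \<open>The invariant of executions\<close>

text \<open>A claimed thread is one that has been joined, so that its resources have been handed over.\<close>

definition dag_ok :: "dag \<Rightarrow> (nat \<Rightarrow> nat) \<Rightarrow> bool" where
  "dag_ok G dp \<longleftrightarrow>
     (\<forall>u v. (u, v) \<in> edges G \<longrightarrow>
        u < length (weights G) \<and> v < length (weights G) \<and> dp u + weights G ! v \<le> dp v) \<and>
     (\<forall>v < length (weights G). weights G ! v \<le> dp v \<and> dp v \<le> bound)"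

text \<open>Owned parts are disjoint but need not exhaust \<open>H\<close>, as a fork may drop
  resources. A right to join is unique, so a thread is joined at most once; nobody can hold one for
  thread 0, whose postcondition is therefore still available at the end.\<close>

definition resources_ok :: "(tid \<Rightarrow> 'q ghost) \<Rightarrow> mem \<Rightarrow> tid set \<Rightarrow> bool" where
  "resources_ok g H D \<longleftrightarrow>
     (\<forall>t. t \<notin> D \<longrightarrow> gheap (g t) = Map.empty \<and> gtoks (g t) = Map.empty) \<and>
     (\<forall>t. gheap (g t) \<subseteq>\<^sub>m H) \<and>
     (\<forall>t t'. t \<noteq> t' \<longrightarrow> dom (gheap (g t)) \<inter> dom (gheap (g t')) = {} \<and>
                     dom (gtoks (g t)) \<inter> dom (gtoks (g t')) = {}) \<and>
     (\<forall>t u q. gtoks (g t) u = Some q \<longrightarrow> u \<noteq> 0 \<and> u \<in> D \<and> gspec (g u) = q \<and> \<not> gclaimed (g u)) \<and>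
     \<not> gclaimed (g 0) \<and> gspec (g 0) = q0 \<and> 0 \<in> D \<and> finite D \<and> finite (dom H) \<and>
     (\<forall>t \<in> D. fin (gspec (g t)) \<le> bound)"

text \<open>As \<open>ready\<close> is at most one step ahead, a single tick makes every running
  thread ready. A blocked thread still satisfies \<open>ok\<close> at its pending request, which
  takes effect only when serviced.\<close>

definition thread_ok :: "nat \<Rightarrow> nat \<Rightarrow> (nat \<Rightarrow> nat) \<Rightarrow> 'q ghost \<Rightarrow> thread \<Rightarrow> bool" where
  "thread_ok n m dp x \<theta> \<longleftrightarrow>
     ready \<theta> \<le> Suc n \<and> (\<forall>v \<in> deps \<theta>. v < m \<and> dp v \<le> gdepth x) \<and> gdepth x \<le> fin (gspec x) \<and>
     status \<theta> \<noteq> Suspended \<and>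
     (status \<theta> \<noteq> Terminated \<longrightarrow>
        ok (gspec x) (pc \<theta>) (regs \<theta>) (gheap x) (gtoks x) (gwork x) (gdepth x)) \<and>
     (status \<theta> = Terminated \<longrightarrow> \<not> gclaimed x \<longrightarrow>
        post (gspec x) (regs \<theta>) (gheap x) (gtoks x))"

text \<open>Queues have at most one entry because only the owner of a node sends requests to it. A
  request survives a tick only if its cell had already served somebody in the step of its issue;
  from then on the cell has not served and blocks the next tick. Hence the weight is at most
  2.\<close>

definition queue_ok ::
  "nat \<Rightarrow> (addr \<times> nat) set \<Rightarrow> (addr \<times> nat \<Rightarrow> (tid \<times> nat) list) \<Rightarrow> (tid \<rightharpoonup> thread) \<Rightarrow> bool" where
  "queue_ok n S Q th \<longleftrightarrow>
     (\<forall>a f. Q (a, f) = [] \<or> (\<exists>t \<tau> \<theta> r op. Q (a, f) = [(t, \<tau>)] \<and> th t = Some \<theta> \<and> status \<theta> = Blocked \<and>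
        P ! pc \<theta> = RMW r f op \<and> regs \<theta> r = NodeP a \<and>
        (\<tau> = n \<or> Suc \<tau> = n \<and> (a, f) \<notin> S))) \<and>
     (\<forall>t \<theta>. th t = Some \<theta> \<longrightarrow> status \<theta> = Blocked \<longrightarrow> (\<exists>c \<tau>. Q c = [(t, \<tau>)]))"

definition state_inv :: "(tid \<Rightarrow> 'q ghost) \<Rightarrow> (nat \<Rightarrow> nat) \<Rightarrow> state \<Rightarrow> bool" where
  "state_inv g dp \<sigma> \<longleftrightarrow>
     resources_ok g (heap \<sigma>) (dom (threads \<sigma>)) \<and>
     (\<forall>t \<theta>. threads \<sigma> t = Some \<theta> \<longrightarrow>
        thread_ok (time \<sigma>) (length (weights (exec_dag \<sigma>))) dp (g t) \<theta>) \<and>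
     queue_ok (time \<sigma>) (served \<sigma>) (queue \<sigma>) (threads \<sigma>) \<and>
     dag_ok (exec_dag \<sigma>) dp \<and>
     dag_work (exec_dag \<sigma>) + (\<Sum>t \<in> dom (threads \<sigma>). gwork (g t)) \<le> W"

lemma dag_ok_add_node:
  assumes "dag_ok G dp" "\<forall>v \<in> Q. v < length (weights G) \<and> dp v \<le> d" "k \<le> 2" "d + 2 \<le> d'" "d' \<le> bound"
  shows "dag_ok (add_node k Q G) (dp(length (weights G) := d'))"
  using assms by (fastforce simp: dag_ok_def add_node_def nth_append less_Suc_eq)

text \<open>The labels of the evaluation are shifted by \<open>d\<close>, which is sound because all
  edges from outside enter at its node 0. Nodes that do not precede the return get labels up to
  \<open>d + s\<close> too, so they also count towards the span.\<close>

lemma dag_ok_graft: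
  assumes G: "dag_ok G dp" and Q: "\<forall>v \<in> Q. v < length (weights G) \<and> dp v \<le> d"
    and D: "is_evaluation D" "dag_span (fst D) \<le> enat s" and b: "d + s \<le> bound"
  obtains dp' where "dag_ok (graft D Q G) dp'" "\<forall>v < length (weights G). dp' v = dp v"
    "dp' (length (weights G) + snd D) \<le> d + s"
proof -
  let ?m = "length (weights G)"
  obtain f where f: "\<And>u v. (u, v) \<in> edges (fst D) \<Longrightarrow> f u + weights (fst D) ! v \<le> f v"
    and f': "\<And>v. v < length (weights (fst D)) \<Longrightarrow> weights (fst D) ! v \<le> f v \<and> f v \<le> s"
    using labelling_of_dag_span[OF D(2)] D(1) unfolding is_evaluation_def
    by (smt (verit) case_prodD order.strict_trans)
  have De: "u < v \<and> v < length (weights (fst D))" if "(u, v) \<in> edges (fst D)" for u v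
    using D(1) that by (auto simp: is_evaluation_def)
  have D0: "0 < length (weights (fst D))" "snd D < length (weights (fst D))"
    using D(1) by (auto simp: is_evaluation_def)
  define dp' where "dp' v = (if v < ?m then dp v else d + f (v - ?m))" for v
  have "dag_ok (graft D Q G) dp'"
    unfolding dag_ok_def
  proof (intro conjI allI impI)
    fix u v assume "(u, v) \<in> edges (graft D Q G)"
    then consider "(u, v) \<in> edges G" | "u \<in> Q" "v = ?m"
      | u' v' where "(u', v') \<in> edges (fst D)" "u = ?m + u'" "v = ?m + v'"
      by (auto simp: graft_def Let_def)
    then have "u < ?m + length (weights (fst D)) \<and> v < ?m + length (weights (fst D)) \<and>
        dp' u + (weights G @ weights (fst D)) ! v \<le> dp' v"
    proof cases
      case 1
      then show ?thesis using G by (fastforce simp: dag_ok_def dp'_def nth_append)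
    next
      case 2
      then show ?thesis using Q D0 f'[of 0] by (auto simp: dp'_def nth_append)
    next
      case 3
      then show ?thesis using De[OF 3(1)] f[OF 3(1)] by (auto simp: dp'_def nth_append)
    qed
    then show "u < length (weights (graft D Q G))" "v < length (weights (graft D Q G))"
      "dp' u + weights (graft D Q G) ! v \<le> dp' v"
      by (simp_all add: graft_def Let_def)
  next
    fix v assume "v < length (weights (graft D Q G))"
    then have "v < ?m \<or> v - ?m < length (weights (fst D))" by (auto simp: graft_def Let_def)
    then show "weights (graft D Q G) ! v \<le> dp' v" "dp' v \<le> bound"
      using G f'[of "v - ?m"] b by (auto simp: dag_ok_def graft_def Let_def dp'_def nth_append)
  qed
  moreover have "dp' (?m + snd D) \<le> d + s" using f'[OF D0(2)] by (simp add: dp'_def)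
  moreover have "\<forall>v < ?m. dp' v = dp v" by (simp add: dp'_def)
  ultimately show thesis using that by blast
qed

lemma thread_ok_mono:
  assumes "thread_ok n m dp x \<theta>" "n \<le> n'" "m \<le> m'" "\<forall>v < m. dp' v = dp v"
  shows "thread_ok n' m' dp' x \<theta>"
  using assms unfolding thread_ok_def by fastforce

lemma queue_ok_cong:
  assumes "\<And>t \<theta>. th t = Some \<theta> \<and> status \<theta> = Blocked \<longleftrightarrow> th' t = Some \<theta> \<and> status \<theta> = Blocked"
  shows "queue_ok n S Q th \<longleftrightarrow> queue_ok n S Q th'"
  unfolding queue_ok_def using assms by (smt (verit))

lemma resources_ok_cong:
  assumes "resources_ok g H D" "gspec x = gspec (g t)" "gheap x = gheap (g t)" "gtoks x = gtoks (g t)"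
    "gclaimed x = gclaimed (g t)"
  shows "resources_ok (g(t := x)) H D"
proof -
  have "gspec ((g(t := x)) u) = gspec (g u)" "gheap ((g(t := x)) u) = gheap (g u)"
    "gtoks ((g(t := x)) u) = gtoks (g u)" "gclaimed ((g(t := x)) u) = gclaimed (g u)" for u
    using assms by auto
  then show ?thesis using assms(1) unfolding resources_ok_def by presburger
qed

text \<open>Serves both writing and allocation: in either case no other thread owns
  \<open>a\<close>.\<close>

lemma resources_ok_upd:
  assumes r: "resources_ok g H D" and t: "t \<in> D" and a: "a \<in> dom (gheap (g t)) \<or> a \<notin> dom H"
    and x: "gspec x = gspec (g t)" "gheap x = (gheap (g t))(a \<mapsto> cs)" "gtoks x = gtoks (g t)"
      "gclaimed x = gclaimed (g t)"
  shows "resources_ok (g(t := x)) (H(a \<mapsto> cs)) D"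
proof -
  have sub: "gheap (g u) \<subseteq>\<^sub>m H" for u using r by (simp add: resources_ok_def)
  have no: "a \<notin> dom (gheap (g u))" if "u \<noteq> t" for u
    using a that r map_le_implies_dom_le[OF sub[of u]] unfolding resources_ok_def by blast
  show ?thesis unfolding resources_ok_def
  proof (intro conjI allI impI ballI)
    fix u u' :: tid assume "u \<noteq> u'"
    then show "dom (gheap ((g(t := x)) u)) \<inter> dom (gheap ((g(t := x)) u')) = {}"
      using r no by (auto simp: resources_ok_def x)
    show "dom (gtoks ((g(t := x)) u)) \<inter> dom (gtoks ((g(t := x)) u')) = {}"
      using r \<open>u \<noteq> u'\<close> by (simp add: resources_ok_def x)
  next
    fix u
    show "gheap ((g(t := x)) u) \<subseteq>\<^sub>m H(a \<mapsto> cs)"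
      using sub[of u] no[of u] sub[of t] by (auto simp: x map_le_def)
  qed (use r t in \<open>auto simp: resources_ok_def x split: if_splits\<close>)
qed

text \<open>The credits given up by the acting thread pay for the growth of the DAG. Others may
  change their ghost state, as a joined thread does, but not their credits.\<close>

lemma inv_update:
  assumes I: "state_inv g dp \<sigma>" and t: "threads \<sigma> t = Some \<theta>"
    and r: "resources_ok g' H (dom (threads \<sigma>))"
    and th: "thread_ok (time \<sigma>) (length (weights G)) dp' (g' t) \<theta>'"
    and oth: "\<And>u \<theta>u. u \<noteq> t \<Longrightarrow> threads \<sigma> u = Some \<theta>u \<Longrightarrow>
      thread_ok (time \<sigma>) (length (weights (exec_dag \<sigma>))) dp (g' u) \<theta>u"
    and q: "queue_ok (time \<sigma>) S Q ((threads \<sigma>)(t \<mapsto> \<theta>'))"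
    and d: "dag_ok G dp'" "length (weights (exec_dag \<sigma>)) \<le> length (weights G)"
      "\<forall>v < length (weights (exec_dag \<sigma>)). dp' v = dp v"
    and w: "dag_work G + gwork (g' t) \<le> dag_work (exec_dag \<sigma>) + gwork (g t)"
    and w': "\<And>u. u \<noteq> t \<Longrightarrow> gwork (g' u) = gwork (g u)"
  shows "state_inv g' dp' (\<sigma>\<lparr>heap := H, queue := Q, served := S,
    threads := (threads \<sigma>)(t \<mapsto> \<theta>'), exec_dag := G\<rparr>)"
proof -
  have dom: "insert t (dom (threads \<sigma>)) = dom (threads \<sigma>)" using t by auto
  have "finite (dom (threads \<sigma>))" using I by (simp add: state_inv_def resources_ok_def)
  moreover have "(\<Sum>u \<in> dom (threads \<sigma>) - {t}. gwork (g' u)) = (\<Sum>u \<in> dom (threads \<sigma>) - {t}. gwork (g u))"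
    using w' by (intro sum.cong) auto
  ultimately have "(\<Sum>u \<in> dom (threads \<sigma>). gwork (g' u)) + gwork (g t)
      = (\<Sum>u \<in> dom (threads \<sigma>). gwork (g u)) + gwork (g' t)"
    using t by (subst (1 2) sum.remove[of _ t]) auto
  then have "dag_work G + (\<Sum>u \<in> dom (threads \<sigma>). gwork (g' u)) \<le> W"
    using w I unfolding state_inv_def by linarith
  moreover have "thread_ok (time \<sigma>) (length (weights G)) dp' (g' u) \<theta>u"
    if "threads \<sigma> u = Some \<theta>u" "u \<noteq> t" for u \<theta>u
    using thread_ok_mono[OF oth[OF that(2,1)] order_refl d(2,3)] .
  ultimately show ?thesis using r th q d(1) unfolding state_inv_def by (auto simp: dom)
qed

lemma inv_depth:
  assumes "state_inv g dp \<sigma>" "resources_ok g' H D" "ok q l R (gheap (g' t)) (gtoks (g' t)) w d"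
  shows "d \<le> fin q"
proof (rule ok_depth[OF assms(3)])
  show "finite (dom (gheap (g' t)))"
    using assms(2) map_le_implies_dom_le finite_subset unfolding resources_ok_def by metis
  have "dom (gtoks (g' t)) \<subseteq> D" using assms(2) by (auto simp: resources_ok_def)
  then show "finite (dom (gtoks (g' t)))" using assms(2) finite_subset unfolding resources_ok_def by metis
qed

lemma inv_execute:
  assumes I: "state_inv g dp \<sigma>" and t: "threads \<sigma> t = Some \<theta>" and k: "k \<le> 2"
    and Q: "\<forall>v \<in> Q. v < next_node \<sigma> \<and> dp v + 2 \<le> gdepth (g' t)"
    and x: "gdepth (g t) + 2 \<le> gdepth (g' t)" "gwork (g' t) + 2 \<le> gwork (g t)"
      "gspec (g' t) = gspec (g t)"
    and r: "resources_ok g' H (dom (threads \<sigma>))"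
    and st: "st = Running \<and> ok (gspec (g t)) l R (gheap (g' t)) (gtoks (g' t)) (gwork (g' t)) (gdepth (g' t))
      \<or> st = Terminated \<and> gdepth (g' t) \<le> fin (gspec (g t)) \<and> post (gspec (g t)) R (gheap (g' t)) (gtoks (g' t))"
    and q: "queue_ok (time \<sigma>) S QQ ((threads \<sigma>)(t \<mapsto>
         \<lparr>pc = l, regs = R, status = st, ready = Suc (time \<sigma>), deps = {next_node \<sigma>}\<rparr>))"
    and oth: "\<And>u \<theta>u. u \<noteq> t \<Longrightarrow> threads \<sigma> u = Some \<theta>u \<Longrightarrow>
      thread_ok (time \<sigma>) (length (weights (exec_dag \<sigma>))) dp (g' u) \<theta>u"
    and w': "\<And>u. u \<noteq> t \<Longrightarrow> gwork (g' u) = gwork (g u)"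
  shows "state_inv g' (dp(next_node \<sigma> := gdepth (g' t)))
    ((execute t \<theta> k Q l R st \<sigma>)\<lparr>heap := H, queue := QQ, served := S\<rparr>)"
proof -
  let ?G = "add_node k (deps \<theta> \<union> Q) (exec_dag \<sigma>)"
  have f: "gdepth (g' t) \<le> fin (gspec (g t))" using st inv_depth[OF I r] by blast
  have b: "gdepth (g' t) \<le> bound"
    using f r t x(3) by (metis domI le_trans resources_ok_def)
  have "state_inv g' (dp(next_node \<sigma> := gdepth (g' t))) (\<sigma>\<lparr>heap := H, queue := QQ, served := S,
    threads := (threads \<sigma>)(t \<mapsto> \<lparr>pc = l, regs = R, status = st, ready = Suc (time \<sigma>), deps = {next_node \<sigma>}\<rparr>),
    exec_dag := ?G\<rparr>)"
  proof (rule inv_update[OF I t r _ oth q])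
    show "dag_ok ?G (dp(next_node \<sigma> := gdepth (g' t)))"
      unfolding next_node_def
    proof (rule dag_ok_add_node[where d = "gdepth (g' t) - 2"])
      have "thread_ok (time \<sigma>) (length (weights (exec_dag \<sigma>))) dp (g t) \<theta>"
        using I t by (simp add: state_inv_def)
      then show "\<forall>v\<in>deps \<theta> \<union> Q. v < length (weights (exec_dag \<sigma>)) \<and> dp v \<le> gdepth (g' t) - 2"
        using Q x(1) unfolding thread_ok_def next_node_def by fastforce
    qed (use I x k b in \<open>auto simp: state_inv_def\<close>)
  qed (use st f x k w' in \<open>auto simp: thread_ok_def next_node_def add_node_def dag_work_def\<close>)
  moreover have "(execute t \<theta> k Q l R st \<sigma>)\<lparr>heap := H, queue := QQ, served := S\<rparr> = \<sigma>\<lparr>heap := H, queue := QQ, served := S,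
    threads := (threads \<sigma>)(t \<mapsto> \<lparr>pc = l, regs = R, status = st, ready = Suc (time \<sigma>), deps = {next_node \<sigma>}\<rparr>),
    exec_dag := ?G\<rparr>" by (simp add: execute_def)
  ultimately show ?thesis by simp
qed

lemma inv_execute_cong:
  assumes I: "state_inv g dp \<sigma>" and t: "threads \<sigma> t = Some \<theta>" "status \<theta> \<noteq> Blocked"
  shows "st \<noteq> Blocked \<Longrightarrow> queue_ok (time \<sigma>) (served \<sigma>) (queue \<sigma>) ((threads \<sigma>)(t \<mapsto>
         \<lparr>pc = l, regs = R, status = st, ready = n, deps = Q\<rparr>))"
    and "u \<noteq> t \<Longrightarrow> threads \<sigma> u = Some \<theta>u \<Longrightarrow>
      thread_ok (time \<sigma>) (length (weights (exec_dag \<sigma>))) dp ((g(t := x)) u) \<theta>u"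
proof -
  assume st: "st \<noteq> Blocked"
  have "queue_ok (time \<sigma>) (served \<sigma>) (queue \<sigma>) (threads \<sigma>)" using I by (simp add: state_inv_def)
  then show "queue_ok (time \<sigma>) (served \<sigma>) (queue \<sigma>) ((threads \<sigma>)(t \<mapsto>
         \<lparr>pc = l, regs = R, status = st, ready = n, deps = Q\<rparr>))"
    by (subst (asm) queue_ok_cong) (use t st in auto)
qed (use I in \<open>simp add: state_inv_def\<close>)

section \<open>Inversion of \<open>ok\<close> at a known instruction\<close>

lemma ok_simpleD:
  assumes "ok q l R h J w d" "simple_op t (P ! l) l R = Some (l', R')"
  shows "\<exists>w' d'. ok q l' R' h J w' d' \<and> w' + 2 \<le> w \<and> d + 2 \<le> d'"
  using assms(1)
proof cases
  case (simple l1 R1 w' d')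
  have "l1 = l'" "R1 = R'" using simple(2)[of t] assms(2) by auto
  then show ?thesis using simple by blast
qed (use assms(2) in auto)

lemma ok_rmwD:
  assumes "ok q l R h J w d" "P ! l = RMW r f op" "R r = NodeP a"
  shows "\<exists>cs x R' w' d'. h a = Some cs \<and> f < length cs \<and> rmw_op op R (cs ! f) = (x, R') \<and>
    ok q (Suc l) R' (h(a \<mapsto> cs[f := x])) J w' d' \<and> w' + 2 \<le> w \<and> d + 2 \<le> d'"
  using assms(1)
proof cases
  case (rmw r1 f1 op1 a1 cs x R' w' d')
  have "r1 = r" "f1 = f" "op1 = op" "a1 = a" using rmw assms(2,3) by auto
  then show ?thesis using rmw by blast
qed (use assms(2,3) in auto)

lemma ok_newD:
  assumes "ok q l R h J w d" "P ! l = New r m" "a \<notin> dom h"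
  shows "\<exists>w' d'. ok q (Suc l) (R(r := NodeP a)) (h(a \<mapsto> replicate m Null)) J w' d' \<and> w' + 2 \<le> w \<and> d + 2 \<le> d'"
  using assms by cases (auto simp del: fun_upd_apply)

lemma ok_terminateD:
  assumes "ok q l R h J w d" "P ! l = Terminate"
  shows "post q R h J \<and> 2 \<le> w \<and> d + 2 \<le> fin q"
  using assms by cases auto

lemma ok_evalD:
  assumes "ok q l R h J w d" "P ! l = Eval r r'"
  shows "E (R r') \<noteq> {} \<and> (\<forall>D \<in> E (R r'). is_evaluation D \<and> dag_work (fst D) \<le> ew \<and> dag_span (fst D) \<le> enat es) \<and>
    (\<exists>w' d'. ok q (Suc l) (R(r := IntV (if C (R r') then 1 else 0))) h J w' d' \<and> w' + ew \<le> w \<and> d + es \<le> d')"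
  using assms(1)
proof cases
  case (eval r1 r1' w' d')
  have "r1 = r" "r1' = r'" using eval assms(2) by auto
  then show ?thesis using eval by blast
qed (use assms(2) in auto)

lemma ok_joinD:
  assumes "ok q l R h J w d" "P ! l = Join r"
  shows "\<exists>u q' w' d'. R r = ThreadP u \<and> J u = Some q' \<and>
    (\<forall>R' h' J'. post q' R' h' J' \<longrightarrow> dom h \<inter> dom h' = {} \<longrightarrow> dom J \<inter> dom J' = {} \<longrightarrow>
      ok q (Suc l) R (h ++ h') (J(u := None) ++ J') w' d') \<and>
    w' + 2 \<le> w \<and> d + 2 \<le> d' \<and> fin q' + 2 \<le> d' \<and> d' \<le> fin q"
  using assms(1)
proof cases
  case (join r1 u q' w' d')
  have "r1 = r" using join assms(2) by auto
  then show ?thesis using join by blast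
qed (use assms(2) in auto)

lemma ok_forkD:
  assumes "ok q l R h J w d" "P ! l = Fork r l'"
  shows "\<exists>h1 h2 J1 J2 q' w1 d1 w2 d2. h1 \<subseteq>\<^sub>m h \<and> h2 \<subseteq>\<^sub>m h \<and>
    dom h1 \<inter> dom h2 = {} \<and> J1 \<subseteq>\<^sub>m J \<and> J2 \<subseteq>\<^sub>m J \<and> dom J1 \<inter> dom J2 = {} \<and>
    fin q' \<le> bound \<and> ok q' l' R h2 J2 w2 d2 \<and>
    (\<forall>u. u \<notin> dom J \<longrightarrow> ok q (Suc l) (R(r := ThreadP u)) h1 (J1(u \<mapsto> q')) w1 d1) \<and>
    w1 + w2 + 2 \<le> w \<and> d + 2 \<le> d1 \<and> d + 2 \<le> d2"
  using assms
proof cases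
  case (fork r1 l1 h1 h2 J1 J2 q' w2 d2 w1 d1)
  then have "r1 = r" "l1 = l'" using assms(2) by auto
  then show ?thesis using fork by blast
qed auto

lemma ok_no_suspend: "ok q l R h J w d \<Longrightarrow> P ! l \<noteq> Suspend \<and> P ! l \<noteq> Resume r"
  by (erule ok.cases) auto


section \<open>Preservation of the invariant by each kind of step\<close>

lemma queue_ok_blocked:
  "queue_ok n S Q th \<Longrightarrow> th t = Some \<theta> \<Longrightarrow> status \<theta> = Blocked \<Longrightarrow> \<exists>c \<tau>. Q c = [(t, \<tau>)]"
  unfolding queue_ok_def by blast

lemma inv_thread: "state_inv g dp \<sigma> \<Longrightarrow> threads \<sigma> t = Some \<theta> \<Longrightarrow>
  thread_ok (time \<sigma>) (length (weights (exec_dag \<sigma>))) dp (g t) \<theta>"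
  by (simp add: state_inv_def)

lemma inv_heap: "state_inv g dp \<sigma> \<Longrightarrow> gheap (g t) a = Some cs \<Longrightarrow> heap \<sigma> a = Some cs"
  unfolding state_inv_def resources_ok_def map_le_def by (metis domI)

lemma inv_queue:
  assumes "state_inv g dp \<sigma>" "queue \<sigma> (a, f) \<noteq> []"
  obtains t \<tau> \<theta> r op where "queue \<sigma> (a, f) = [(t, \<tau>)]" "threads \<sigma> t = Some \<theta>" "status \<theta> = Blocked"
    "P ! pc \<theta> = RMW r f op" "regs \<theta> r = NodeP a" "\<tau> = time \<sigma> \<or> Suc \<tau> = time \<sigma> \<and> (a, f) \<notin> served \<sigma>"
  using assms unfolding state_inv_def queue_ok_def by blast

lemma inv_simple:
  assumes I: "state_inv g dp \<sigma>" and e: "can_execute P \<sigma> t \<theta> i"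
    and s: "simple_op t i (pc \<theta>) (regs \<theta>) = Some (l, R)"
  shows "\<exists>g' dp'. state_inv g' dp' (execute t \<theta> 1 {} l R Running \<sigma>)"
proof -
  have t: "threads \<sigma> t = Some \<theta>" "status \<theta> = Running" "P ! pc \<theta> = i"
    using e by (auto simp: can_execute_def)
  have "ok (gspec (g t)) (pc \<theta>) (regs \<theta>) (gheap (g t)) (gtoks (g t)) (gwork (g t)) (gdepth (g t))"
    using inv_thread[OF I t(1)] t(2) by (simp add: thread_ok_def)
  from ok_simpleD[OF this s[folded t(3)]] obtain w' d' where
    o: "ok (gspec (g t)) l R (gheap (g t)) (gtoks (g t)) w' d'" "w' + 2 \<le> gwork (g t)" "gdepth (g t) + 2 \<le> d'"
    by blast
  let ?g = "g(t := (g t)\<lparr>gwork := w', gdepth := d'\<rparr>)"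
  have r: "resources_ok ?g (heap \<sigma>) (dom (threads \<sigma>))"
    using I by (intro resources_ok_cong) (auto simp: state_inv_def)
  have "state_inv ?g (dp(next_node \<sigma> := gdepth (?g t)))
    ((execute t \<theta> 1 {} l R Running \<sigma>)\<lparr>heap := heap \<sigma>, queue := queue \<sigma>, served := served \<sigma>\<rparr>)"
    by (rule inv_execute[OF I t(1) _ _ _ _ _ r _ inv_execute_cong[OF I t(1)]]) (use o t in auto)
  moreover have "(execute t \<theta> 1 {} l R Running \<sigma>)\<lparr>heap := heap \<sigma>, queue := queue \<sigma>, served := served \<sigma>\<rparr>
    = execute t \<theta> 1 {} l R Running \<sigma>" by (simp add: execute_def)
  ultimately show ?thesis by metis
qed

lemma inv_new:
  assumes I: "state_inv g dp \<sigma>" and e: "can_execute P \<sigma> t \<theta> (New d m)" and a: "a \<notin> dom (heap \<sigma>)"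
  shows "\<exists>g' dp'. state_inv g' dp' ((execute t \<theta> 1 {} (Suc (pc \<theta>)) ((regs \<theta>)(d := NodeP a)) Running \<sigma>)
          \<lparr>heap := (heap \<sigma>)(a \<mapsto> replicate m Null)\<rparr>)"
proof -
  have t: "threads \<sigma> t = Some \<theta>" "status \<theta> = Running" "P ! pc \<theta> = New d m"
    using e by (auto simp: can_execute_def)
  have k: "ok (gspec (g t)) (pc \<theta>) (regs \<theta>) (gheap (g t)) (gtoks (g t)) (gwork (g t)) (gdepth (g t))"
    using inv_thread[OF I t(1)] t(2) by (simp add: thread_ok_def)
  have "a \<notin> dom (gheap (g t))" using a inv_heap[OF I] by blast
  from ok_newD[OF k t(3) this] obtain w' d' where
    o: "ok (gspec (g t)) (Suc (pc \<theta>)) ((regs \<theta>)(d := NodeP a)) ((gheap (g t))(a \<mapsto> replicate m Null)) (gtoks (g t)) w' d'"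
      "w' + 2 \<le> gwork (g t)" "gdepth (g t) + 2 \<le> d'" by blast
  let ?g = "g(t := (g t)\<lparr>gheap := (gheap (g t))(a \<mapsto> replicate m Null), gwork := w', gdepth := d'\<rparr>)"
  have r: "resources_ok ?g ((heap \<sigma>)(a \<mapsto> replicate m Null)) (dom (threads \<sigma>))"
    using I a t by (intro resources_ok_upd) (auto simp: state_inv_def)
  let ?s = "execute t \<theta> 1 {} (Suc (pc \<theta>)) ((regs \<theta>)(d := NodeP a)) Running \<sigma>"
  have "state_inv ?g (dp(next_node \<sigma> := gdepth (?g t)))
    (?s\<lparr>heap := (heap \<sigma>)(a \<mapsto> replicate m Null), queue := queue \<sigma>, served := served \<sigma>\<rparr>)"
    by (rule inv_execute[OF I t(1) _ _ _ _ _ r _ inv_execute_cong[OF I t(1)]]) (use o t in auto)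
  moreover have "?s\<lparr>heap := (heap \<sigma>)(a \<mapsto> replicate m Null), queue := queue \<sigma>, served := served \<sigma>\<rparr>
    = ?s\<lparr>heap := (heap \<sigma>)(a \<mapsto> replicate m Null)\<rparr>" by (simp add: execute_def)
  ultimately show ?thesis by metis
qed

lemma inv_issue:
  assumes I: "state_inv g dp \<sigma>" and e: "can_execute P \<sigma> t \<theta> (RMW r f op)" and a: "regs \<theta> r = NodeP a"
  shows "state_inv g dp (\<sigma>\<lparr>threads := (threads \<sigma>)(t \<mapsto> \<theta>\<lparr>status := Blocked\<rparr>),
          queue := (queue \<sigma>)((a, f) := queue \<sigma> (a, f) @ [(t, time \<sigma>)])\<rparr>)"
proof -
  have t: "threads \<sigma> t = Some \<theta>" "status \<theta> = Running" "P ! pc \<theta> = RMW r f op"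
    using e by (auto simp: can_execute_def)
  have k: "ok (gspec (g t)) (pc \<theta>) (regs \<theta>) (gheap (g t)) (gtoks (g t)) (gwork (g t)) (gdepth (g t))"
    using inv_thread[OF I t(1)] t(2) by (simp add: thread_ok_def)
  have ad: "a \<in> dom (gheap (g t))" using ok_rmwD[OF k t(3) a] by blast
  \<comment> \<open>A thread waiting at this cell would own the node \<open>a\<close> as
    well.\<close>
  have em: "queue \<sigma> (a, f) = []"
  proof (rule ccontr)
    assume "queue \<sigma> (a, f) \<noteq> []"
    then obtain u \<tau> \<theta>u ru opu where u: "threads \<sigma> u = Some \<theta>u" "status \<theta>u = Blocked"
      "P ! pc \<theta>u = RMW ru f opu" "regs \<theta>u ru = NodeP a"
      by (rule inv_queue[OF I])
    have "ok (gspec (g u)) (pc \<theta>u) (regs \<theta>u) (gheap (g u)) (gtoks (g u)) (gwork (g u)) (gdepth (g u))"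
      using inv_thread[OF I u(1)] u(2) by (simp add: thread_ok_def)
    from ok_rmwD[OF this u(3,4)] have "a \<in> dom (gheap (g u))" by blast
    moreover have "u \<noteq> t" using u t by auto
    ultimately show False using ad I unfolding state_inv_def resources_ok_def by blast
  qed
  have q: "queue_ok (time \<sigma>) (served \<sigma>) (queue \<sigma>) (threads \<sigma>)" using I by (simp add: state_inv_def)
  have q': "queue_ok (time \<sigma>) (served \<sigma>) ((queue \<sigma>)((a, f) := queue \<sigma> (a, f) @ [(t, time \<sigma>)]))
      ((threads \<sigma>)(t \<mapsto> \<theta>\<lparr>status := Blocked\<rparr>))"
    unfolding queue_ok_def em
  proof (intro conjI allI impI)
    fix b f'
    show "((queue \<sigma>)((a, f) := [] @ [(t, time \<sigma>)])) (b, f') = [] \<or>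
       (\<exists>t' \<tau> \<theta>' r op. ((queue \<sigma>)((a, f) := [] @ [(t, time \<sigma>)])) (b, f') = [(t', \<tau>)] \<and>
          ((threads \<sigma>)(t \<mapsto> \<theta>\<lparr>status := Blocked\<rparr>)) t' = Some \<theta>' \<and> status \<theta>' = Blocked \<and>
          P ! pc \<theta>' = RMW r f' op \<and> regs \<theta>' r = NodeP b \<and>
          (\<tau> = time \<sigma> \<or> Suc \<tau> = time \<sigma> \<and> (b, f') \<notin> served \<sigma>))"
    proof (cases "(b, f') = (a, f)")
      case True
      then show ?thesis using t(3) a by auto
    next
      case False
      show ?thesis
      proof (cases "queue \<sigma> (b, f') = []")
        case e: False
        obtain u \<tau> \<theta>u ru opu where u: "queue \<sigma> (b, f') = [(u, \<tau>)]" "threads \<sigma> u = Some \<theta>u" "status \<theta>u = Blocked"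
          "P ! pc \<theta>u = RMW ru f' opu" "regs \<theta>u ru = NodeP b" "\<tau> = time \<sigma> \<or> Suc \<tau> = time \<sigma> \<and> (b, f') \<notin> served \<sigma>"
          using e by (rule inv_queue[OF I])
        moreover have "u \<noteq> t" using u t by auto
        ultimately show ?thesis using False by auto
      qed (use False in auto)
    qed
  next
    fix u \<theta>u assume u: "((threads \<sigma>)(t \<mapsto> \<theta>\<lparr>status := Blocked\<rparr>)) u = Some \<theta>u" "status \<theta>u = Blocked"
    show "\<exists>c \<tau>. ((queue \<sigma>)((a, f) := [] @ [(t, time \<sigma>)])) c = [(u, \<tau>)]"
    proof (cases "u = t")
      case True
      then show ?thesis by (metis append_Nil fun_upd_same)
    next
      case False
      then obtain c \<tau> where "queue \<sigma> c = [(u, \<tau>)]" using u queue_ok_blocked[OF q, of u \<theta>u] by (metis fun_upd_other)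
      moreover have "c \<noteq> (a, f)" using em calculation by auto
      ultimately show ?thesis by (metis fun_upd_other)
    qed
  qed
  have "state_inv g dp (\<sigma>\<lparr>heap := heap \<sigma>, queue := (queue \<sigma>)((a, f) := queue \<sigma> (a, f) @ [(t, time \<sigma>)]),
      served := served \<sigma>, threads := (threads \<sigma>)(t \<mapsto> \<theta>\<lparr>status := Blocked\<rparr>), exec_dag := exec_dag \<sigma>\<rparr>)"
    by (rule inv_update[OF I t(1) _ _ _ q'])
      (use I inv_thread[OF I t(1)] t(2) in \<open>auto simp: state_inv_def thread_ok_def\<close>)
  moreover have "\<sigma>\<lparr>heap := heap \<sigma>, queue := (queue \<sigma>)((a, f) := queue \<sigma> (a, f) @ [(t, time \<sigma>)]),
      served := served \<sigma>, threads := (threads \<sigma>)(t \<mapsto> \<theta>\<lparr>status := Blocked\<rparr>), exec_dag := exec_dag \<sigma>\<rparr>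
    = \<sigma>\<lparr>threads := (threads \<sigma>)(t \<mapsto> \<theta>\<lparr>status := Blocked\<rparr>),
          queue := (queue \<sigma>)((a, f) := queue \<sigma> (a, f) @ [(t, time \<sigma>)])\<rparr>"
    by (rule state.equality) simp_all
  ultimately show ?thesis by metis
qed

lemma inv_service:
  assumes I: "state_inv g dp \<sigma>" and q: "queue \<sigma> (a, f) = (t, \<tau>) # rest" "(a, f) \<notin> served \<sigma>"
    and t: "threads \<sigma> t = Some \<theta>" "P ! pc \<theta> = RMW r f op"
    and h: "heap \<sigma> a = Some cs" "rmw_op op (regs \<theta>) (cs ! f) = (x, R)"
  shows "\<exists>g' dp'. state_inv g' dp' ((execute t \<theta> (Suc (time \<sigma>) - \<tau>) {} (Suc (pc \<theta>)) R Running \<sigma>)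
          \<lparr>heap := (heap \<sigma>)(a \<mapsto> cs[f := x]),
           queue := (queue \<sigma>)((a, f) := rest),
           served := insert (a, f) (served \<sigma>)\<rparr>)"
proof -
  have "queue \<sigma> (a, f) \<noteq> []" using q by simp
  then obtain t' \<tau>' \<theta>' r' op' where "queue \<sigma> (a, f) = [(t', \<tau>')]" "threads \<sigma> t' = Some \<theta>'"
    "status \<theta>' = Blocked" "P ! pc \<theta>' = RMW r' f op'" "regs \<theta>' r' = NodeP a"
    "\<tau>' = time \<sigma> \<or> Suc \<tau>' = time \<sigma> \<and> (a, f) \<notin> served \<sigma>" by (rule inv_queue[OF I])
  then have b: "rest = []" "status \<theta> = Blocked" "regs \<theta> r = NodeP a" "Suc (time \<sigma>) - \<tau> \<le> 2"
    using q t by auto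
  have k: "ok (gspec (g t)) (pc \<theta>) (regs \<theta>) (gheap (g t)) (gtoks (g t)) (gwork (g t)) (gdepth (g t))"
    using inv_thread[OF I t(1)] b(2) by (simp add: thread_ok_def)
  obtain cs' where c: "gheap (g t) a = Some cs'" using ok_rmwD[OF k t(2) b(3)] by blast
  then have c: "gheap (g t) a = Some cs" using inv_heap[OF I c] h by simp
  obtain w' d' where
    o: "ok (gspec (g t)) (Suc (pc \<theta>)) R ((gheap (g t))(a \<mapsto> cs[f := x])) (gtoks (g t)) w' d'"
      "w' + 2 \<le> gwork (g t)" "gdepth (g t) + 2 \<le> d'" using ok_rmwD[OF k t(2) b(3)] c h(2) by auto
  let ?g = "g(t := (g t)\<lparr>gheap := (gheap (g t))(a \<mapsto> cs[f := x]), gwork := w', gdepth := d'\<rparr>)"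
  have r: "resources_ok ?g ((heap \<sigma>)(a \<mapsto> cs[f := x])) (dom (threads \<sigma>))"
    using I c t by (intro resources_ok_upd) (auto simp: state_inv_def)
  have Q: "queue_ok (time \<sigma>) (served \<sigma>) (queue \<sigma>) (threads \<sigma>)" using I by (simp add: state_inv_def)
  let ?th = "(threads \<sigma>)(t \<mapsto> \<lparr>pc = Suc (pc \<theta>), regs = R, status = Running, ready = Suc (time \<sigma>), deps = {next_node \<sigma>}\<rparr>)"
  have q': "queue_ok (time \<sigma>) (insert (a, f) (served \<sigma>)) ((queue \<sigma>)((a, f) := rest)) ?th"
    unfolding queue_ok_def b(1)
  proof (intro conjI allI impI)
    fix b' f'
    show "((queue \<sigma>)((a, f) := [])) (b', f') = [] \<or>
       (\<exists>t \<tau> \<theta> r op. ((queue \<sigma>)((a, f) := [])) (b', f') = [(t, \<tau>)] \<and>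
          ?th t = Some \<theta> \<and> status \<theta> = Blocked \<and>
          P ! pc \<theta> = RMW r f' op \<and> regs \<theta> r = NodeP b' \<and>
          (\<tau> = time \<sigma> \<or> Suc \<tau> = time \<sigma> \<and> (b', f') \<notin> insert (a, f) (served \<sigma>)))"
    proof (cases "(b', f') = (a, f) \<or> queue \<sigma> (b', f') = []")
      case False
      then obtain u \<tau> \<theta>u ru opu where u: "queue \<sigma> (b', f') = [(u, \<tau>)]" "threads \<sigma> u = Some \<theta>u" "status \<theta>u = Blocked"
          "P ! pc \<theta>u = RMW ru f' opu" "regs \<theta>u ru = NodeP b'" "\<tau> = time \<sigma> \<or> Suc \<tau> = time \<sigma> \<and> (b', f') \<notin> served \<sigma>"
        using inv_queue[OF I] by metis
      moreover have "u \<noteq> t" using u t b(3) False by auto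
      ultimately show ?thesis using False by auto
    qed auto
  next
    fix u \<theta>u assume u: "?th u = Some \<theta>u" "status \<theta>u = Blocked"
    then have ut: "u \<noteq> t" by auto
    then obtain c \<tau> where "queue \<sigma> c = [(u, \<tau>)]" using u queue_ok_blocked[OF Q, of u \<theta>u] by (metis fun_upd_other)
    moreover have "c \<noteq> (a, f)" using q ut calculation by auto
    ultimately show "\<exists>c \<tau>. ((queue \<sigma>)((a, f) := [])) c = [(u, \<tau>)]" by (metis fun_upd_other)
  qed
  have "state_inv ?g (dp(next_node \<sigma> := gdepth (?g t)))
    ((execute t \<theta> (Suc (time \<sigma>) - \<tau>) {} (Suc (pc \<theta>)) R Running \<sigma>)\<lparr>heap := (heap \<sigma>)(a \<mapsto> cs[f := x]),
           queue := (queue \<sigma>)((a, f) := rest),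
           served := insert (a, f) (served \<sigma>)\<rparr>)"
    by (rule inv_execute[OF I t(1) _ _ _ _ _ r _ q']) (use o t b I in \<open>auto simp: state_inv_def\<close>)
  then show ?thesis by blast
qed

lemma inv_tick:
  assumes I: "state_inv g dp \<sigma>" and q: "\<And>c. queue \<sigma> c \<noteq> [] \<Longrightarrow> c \<in> served \<sigma>"
  shows "state_inv g dp (\<sigma>\<lparr>time := Suc (time \<sigma>), served := {}\<rparr>)"
proof -
  have "queue_ok (Suc (time \<sigma>)) {} (queue \<sigma>) (threads \<sigma>)"
    using I q unfolding state_inv_def queue_ok_def by (smt (verit) empty_iff list.distinct(1))
  moreover have "thread_ok (Suc (time \<sigma>)) (length (weights (exec_dag \<sigma>))) dp (g t) \<theta>"
    if "threads \<sigma> t = Some \<theta>" for t \<theta>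
    using thread_ok_mono[OF inv_thread[OF I that]] by simp
  ultimately show ?thesis using I unfolding state_inv_def by simp
qed

end

lemma map_leD: "f \<subseteq>\<^sub>m g \<Longrightarrow> f x = Some y \<Longrightarrow> g x = Some y"
  by (metis domI map_le_def)

context race_free begin

lemma inv_terminate:
  assumes I: "state_inv g dp \<sigma>" and e: "can_execute P \<sigma> t \<theta> Terminate"
  shows "\<exists>g' dp'. state_inv g' dp' (execute t \<theta> 1 {} (Suc (pc \<theta>)) (regs \<theta>) Terminated \<sigma>)"
proof -
  have t: "threads \<sigma> t = Some \<theta>" "status \<theta> = Running" "P ! pc \<theta> = Terminate"
    using e by (auto simp: can_execute_def)
  have k: "ok (gspec (g t)) (pc \<theta>) (regs \<theta>) (gheap (g t)) (gtoks (g t)) (gwork (g t)) (gdepth (g t))"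
    using inv_thread[OF I t(1)] t(2) by (simp add: thread_ok_def)
  note o = ok_terminateD[OF k t(3)]
  let ?g = "g(t := (g t)\<lparr>gwork := 0, gdepth := gdepth (g t) + 2\<rparr>)"
  have r: "resources_ok ?g (heap \<sigma>) (dom (threads \<sigma>))"
    using I by (intro resources_ok_cong) (auto simp: state_inv_def)
  have "state_inv ?g (dp(next_node \<sigma> := gdepth (?g t)))
    ((execute t \<theta> 1 {} (Suc (pc \<theta>)) (regs \<theta>) Terminated \<sigma>)\<lparr>heap := heap \<sigma>, queue := queue \<sigma>, served := served \<sigma>\<rparr>)"
    by (rule inv_execute[OF I t(1) _ _ _ _ _ r _ inv_execute_cong[OF I t(1)]]) (use o t in auto)
  moreover have "(execute t \<theta> 1 {} (Suc (pc \<theta>)) (regs \<theta>) Terminated \<sigma>)\<lparr>heap := heap \<sigma>, queue := queue \<sigma>, served := served \<sigma>\<rparr>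
    = execute t \<theta> 1 {} (Suc (pc \<theta>)) (regs \<theta>) Terminated \<sigma>" by (simp add: execute_def)
  ultimately show ?thesis by metis
qed

lemma inv_eval:
  assumes I: "state_inv g dp \<sigma>" and e: "can_execute P \<sigma> t \<theta> (Eval d r)" and D: "D \<in> E (regs \<theta> r)"
  shows "\<exists>g' dp'. state_inv g' dp' (\<sigma>\<lparr>exec_dag := graft D (deps \<theta>) (exec_dag \<sigma>),
          threads := (threads \<sigma>)(t \<mapsto>
            \<lparr>pc = Suc (pc \<theta>), regs = (regs \<theta>)(d := IntV (if C (regs \<theta> r) then 1 else 0)),
             status = Running, ready = Suc (time \<sigma>), deps = {next_node \<sigma> + snd D}\<rparr>)\<rparr>)"
proof -
  have t: "threads \<sigma> t = Some \<theta>" "status \<theta> = Running" "P ! pc \<theta> = Eval d r"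
    using e by (auto simp: can_execute_def)
  have k: "ok (gspec (g t)) (pc \<theta>) (regs \<theta>) (gheap (g t)) (gtoks (g t)) (gwork (g t)) (gdepth (g t))"
    using inv_thread[OF I t(1)] t(2) by (simp add: thread_ok_def)
  from ok_evalD[OF k t(3)] D obtain w' d' where
    ev: "is_evaluation D" "dag_work (fst D) \<le> ew" "dag_span (fst D) \<le> enat es" and
    o: "ok (gspec (g t)) (Suc (pc \<theta>)) ((regs \<theta>)(d := IntV (if C (regs \<theta> r) then 1 else 0))) (gheap (g t)) (gtoks (g t)) w' d'"
      "w' + ew \<le> gwork (g t)" "gdepth (g t) + es \<le> d'"
    by blast
  let ?g = "g(t := (g t)\<lparr>gwork := w', gdepth := d'\<rparr>)"
  have r: "resources_ok ?g (heap \<sigma>) (dom (threads \<sigma>))"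
    using I by (intro resources_ok_cong) (auto simp: state_inv_def)
  have f: "d' \<le> fin (gspec (g t))" using inv_depth[OF I r, of _ _ _ t] o(1) by simp
  have b: "gdepth (g t) + es \<le> bound"
    using f o(3) r t(1) unfolding resources_ok_def by (metis (no_types, lifting) domI fun_upd_def ghost.select_convs(1) ghost.surjective ghost.update_convs(4,5) le_trans)
  have de: "\<forall>v \<in> deps \<theta>. v < length (weights (exec_dag \<sigma>)) \<and> dp v \<le> gdepth (g t)"
    using inv_thread[OF I t(1)] by (simp add: thread_ok_def)
  have "dag_ok (exec_dag \<sigma>) dp" using I by (simp add: state_inv_def)
  then obtain dp' where dp': "dag_ok (graft D (deps \<theta>) (exec_dag \<sigma>)) dp'"
    "\<forall>v < length (weights (exec_dag \<sigma>)). dp' v = dp v"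
    "dp' (length (weights (exec_dag \<sigma>)) + snd D) \<le> gdepth (g t) + es"
    using dag_ok_graft[OF _ de ev(1,3) b] by blast
  have sD: "snd D < length (weights (fst D))" using ev(1) by (simp add: is_evaluation_def)
  let ?\<theta> = "\<lparr>pc = Suc (pc \<theta>), regs = (regs \<theta>)(d := IntV (if C (regs \<theta> r) then 1 else 0)),
             status = Running, ready = Suc (time \<sigma>), deps = {next_node \<sigma> + snd D}\<rparr>"
  have "state_inv ?g dp' (\<sigma>\<lparr>heap := heap \<sigma>, queue := queue \<sigma>, served := served \<sigma>,
      threads := (threads \<sigma>)(t \<mapsto> ?\<theta>), exec_dag := graft D (deps \<theta>) (exec_dag \<sigma>)\<rparr>)"
  proof (rule inv_update[OF I t(1) r _ _ inv_execute_cong(1)[OF I t(1)] dp'(1) _ dp'(2)])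
    show "thread_ok (time \<sigma>) (length (weights (graft D (deps \<theta>) (exec_dag \<sigma>)))) dp' (?g t) ?\<theta>"
      using o f dp'(3) sD by (auto simp: thread_ok_def graft_def Let_def next_node_def)
    show "dag_work (graft D (deps \<theta>) (exec_dag \<sigma>)) + gwork (?g t) \<le> dag_work (exec_dag \<sigma>) + gwork (g t)"
      using ev(2) o(2) by (simp add: dag_work_def graft_def Let_def)
  qed (use I t(2) in \<open>auto simp: state_inv_def graft_def Let_def\<close>)
  moreover have "\<sigma>\<lparr>heap := heap \<sigma>, queue := queue \<sigma>, served := served \<sigma>,
      threads := (threads \<sigma>)(t \<mapsto> ?\<theta>), exec_dag := graft D (deps \<theta>) (exec_dag \<sigma>)\<rparr>
    = \<sigma>\<lparr>exec_dag := graft D (deps \<theta>) (exec_dag \<sigma>), threads := (threads \<sigma>)(t \<mapsto> ?\<theta>)\<rparr>"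
    by (rule state.equality) simp_all
  ultimately have "state_inv ?g dp' (\<sigma>\<lparr>exec_dag := graft D (deps \<theta>) (exec_dag \<sigma>), threads := (threads \<sigma>)(t \<mapsto> ?\<theta>)\<rparr>)"
    by metis
  then show ?thesis by blast
qed

text \<open>All that \<open>u\<close> owned passes to \<open>t\<close>, and the right to join
  \<open>u\<close> is used up. The label of the join node is at least \<open>fin q' + 2\<close>,
  hence large enough for the dependency on the last instruction of \<open>u\<close>.\<close>

lemma inv_join:
  assumes I: "state_inv g dp \<sigma>" and e: "can_execute P \<sigma> t \<theta> (Join r)" and u: "regs \<theta> r = ThreadP u"
    "threads \<sigma> u = Some \<theta>'" "status \<theta>' = Terminated"
  shows "\<exists>g' dp'. state_inv g' dp' (execute t \<theta> 1 (deps \<theta>') (Suc (pc \<theta>)) (regs \<theta>) Running \<sigma>)"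
proof -
  have t: "threads \<sigma> t = Some \<theta>" "status \<theta> = Running" "P ! pc \<theta> = Join r"
    using e by (auto simp: can_execute_def)
  have ut: "u \<noteq> t" using t u by auto
  have k: "ok (gspec (g t)) (pc \<theta>) (regs \<theta>) (gheap (g t)) (gtoks (g t)) (gwork (g t)) (gdepth (g t))"
    using inv_thread[OF I t(1)] t(2) by (simp add: thread_ok_def)
  have res: "resources_ok g (heap \<sigma>) (dom (threads \<sigma>))" using I by (simp add: state_inv_def)
  from ok_joinD[OF k t(3)] u(1) obtain q' w' d' where
    q': "gtoks (g t) u = Some q'" and
    o: "\<And>R' h' J'. post q' R' h' J' \<Longrightarrow> dom (gheap (g t)) \<inter> dom h' = {} \<Longrightarrow> dom (gtoks (g t)) \<inter> dom J' = {} \<Longrightarrow>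
      ok (gspec (g t)) (Suc (pc \<theta>)) (regs \<theta>) (gheap (g t) ++ h') ((gtoks (g t))(u := None) ++ J') w' d'"
    and c: "w' + 2 \<le> gwork (g t)" "gdepth (g t) + 2 \<le> d'" "fin q' + 2 \<le> d'"
    by auto
  have qu: "gspec (g u) = q'" "\<not> gclaimed (g u)" "u \<noteq> 0" using res q' unfolding resources_ok_def by blast+
  have thu: "thread_ok (time \<sigma>) (length (weights (exec_dag \<sigma>))) dp (g u) \<theta>'"
    using inv_thread[OF I u(2)] .
  then have pu: "post q' (regs \<theta>') (gheap (g u)) (gtoks (g u))" "gdepth (g u) \<le> fin q'"
    using u(3) qu by (auto simp: thread_ok_def)
  have dis: "dom (gheap (g v)) \<inter> dom (gheap (g v')) = {}" "dom (gtoks (g v)) \<inter> dom (gtoks (g v')) = {}"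
    if "v \<noteq> v'" for v v' using res that unfolding resources_ok_def by blast+
  have dis': "x \<in> dom (gheap (g v)) \<Longrightarrow> x \<in> dom (gheap (g v')) \<Longrightarrow> v = v'"
    "x \<in> dom (gtoks (g v)) \<Longrightarrow> x \<in> dom (gtoks (g v')) \<Longrightarrow> v = v'" for x v v'
    using dis by blast+
  note o = o[OF pu(1) dis(1)[OF ut[symmetric]] dis(2)[OF ut[symmetric]]]
  define g' where "g' = g(t := (g t)\<lparr>gheap := gheap (g t) ++ gheap (g u),
      gtoks := (gtoks (g t))(u := None) ++ gtoks (g u), gwork := w', gdepth := d'\<rparr>,
     u := (g u)\<lparr>gheap := Map.empty, gtoks := Map.empty, gclaimed := True\<rparr>)"
  have g't: "g' t = (g t)\<lparr>gheap := gheap (g t) ++ gheap (g u),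
      gtoks := (gtoks (g t))(u := None) ++ gtoks (g u), gwork := w', gdepth := d'\<rparr>"
    and g'u: "g' u = (g u)\<lparr>gheap := Map.empty, gtoks := Map.empty, gclaimed := True\<rparr>"
    and g'o: "\<And>v. v \<noteq> t \<Longrightarrow> v \<noteq> u \<Longrightarrow> g' v = g v"
    and g'g: "\<And>v. gspec (g' v) = gspec (g v)" "\<And>v. v \<noteq> t \<Longrightarrow> gwork (g' v) = gwork (g v)"
    using ut by (auto simp: g'_def)
  have hp: "gheap (g' v) = (if v = u then Map.empty else if v = t then gheap (g t) ++ gheap (g u) else gheap (g v))"
    and tk: "gtoks (g' v) = (if v = u then Map.empty else
      if v = t then (gtoks (g t))(u := None) ++ gtoks (g u) else gtoks (g v))" for v
    by (simp_all add: g'_def)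
  have own: "v \<noteq> u \<and> (x \<in> dom (gheap (g v)) \<or> v = t \<and> x \<in> dom (gheap (g u)))"
    if "x \<in> dom (gheap (g' v))" for x v
    using that by (cases "v = u"; cases "v = t") (auto simp: hp)
  have own': "v \<noteq> u \<and> (x \<in> dom (gtoks (g v)) \<or> v = t \<and> x \<in> dom (gtoks (g u)))"
    if "x \<in> dom (gtoks (g' v))" for x v
    using that by (cases "v = u"; cases "v = t") (auto simp: tk split: if_splits)
  have r: "resources_ok g' (heap \<sigma>) (dom (threads \<sigma>))"
    unfolding resources_ok_def
  proof (intro conjI allI impI ballI)
    fix v
    have le: "gheap (g v) \<subseteq>\<^sub>m heap \<sigma>" for v using res by (simp add: resources_ok_def)
    then show "gheap (g' v) \<subseteq>\<^sub>m heap \<sigma>"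
      using le[of t] le[of u] le[of v] by (cases "v = t"; cases "v = u") (auto simp: g't g'u g'o map_add_le_mapI)
    fix v' assume "v \<noteq> v'"
    then show "dom (gheap (g' v)) \<inter> dom (gheap (g' v')) = {}"
      using own[of _ v] own[of _ v'] dis'(1) by (metis disjoint_iff)
    show "dom (gtoks (g' v)) \<inter> dom (gtoks (g' v')) = {}"
      using own'[of _ v] own'[of _ v'] dis'(2) \<open>v \<noteq> v'\<close> by (metis disjoint_iff)
  next
    fix v v' q assume v: "gtoks (g' v) v' = Some q"
    then obtain v1 where v1: "gtoks (g v1) v' = Some q"
      by (cases "v = t"; cases "v = u") (auto simp: g't g'u g'o split: if_splits)
    then show "v' \<noteq> 0" "v' \<in> dom (threads \<sigma>)" "gspec (g' v') = q" using res g'g unfolding resources_ok_def by (blast, blast, metis)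
    \<comment> \<open>No right to join \<open>u\<close> survives: \<open>t\<close> held the only one
      and gave it up.\<close>
    have "v' \<noteq> u"
    proof
      assume vu: "v' = u"
      have "v1 = t" using v1 q' vu dis'(2)[of u v1 t] by blast
      have "u \<notin> dom (gtoks (g u))" using q' ut dis'(2)[of u t u] by blast
      then have "gtoks (g' t) u = None" by (simp add: g't domIff)
      then have "v \<noteq> t" using v vu by auto
      then have "gtoks (g v) u = Some q" using v vu g'u g'o by (cases "v = u") auto
      then show False using \<open>v \<noteq> t\<close> q' dis'(2)[of u v t] by blast
    qed
    then show "\<not> gclaimed (g' v')" using v1 res g'o g't unfolding resources_ok_def
      by (cases "v' = t") (fastforce, metis)
  next
    show "\<not> gclaimed (g' 0)" using res qu g'o g't unfolding resources_ok_def
      by (cases "t = 0") (fastforce, metis)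
  next
    fix v assume v: "v \<notin> dom (threads \<sigma>)"
    then have "v \<noteq> t" "v \<noteq> u" using t u by auto
    then show "gheap (g' v) = Map.empty" "gtoks (g' v) = Map.empty"
      using res v by (simp_all add: resources_ok_def g'o)
  qed (use res g'g in \<open>simp_all add: resources_ok_def\<close>)
  have "state_inv g' (dp(next_node \<sigma> := gdepth (g' t)))
    ((execute t \<theta> 1 (deps \<theta>') (Suc (pc \<theta>)) (regs \<theta>) Running \<sigma>)\<lparr>heap := heap \<sigma>, queue := queue \<sigma>, served := served \<sigma>\<rparr>)"
  proof (rule inv_execute[OF I t(1) _ _ _ _ _ r _ inv_execute_cong(1)[OF I t(1)]])
    show "\<forall>v\<in>deps \<theta>'. v < next_node \<sigma> \<and> dp v + 2 \<le> gdepth (g' t)"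
      using thu pu(2) c(3) unfolding thread_ok_def next_node_def g't by fastforce
    fix v \<theta>v assume "v \<noteq> t" "threads \<sigma> v = Some \<theta>v"
    then show "thread_ok (time \<sigma>) (length (weights (exec_dag \<sigma>))) dp (g' v) \<theta>v"
      using inv_thread[OF I] thu u by (cases "v = u") (auto simp: g'o g'u thread_ok_def)
  qed (use o c t(2) g'g in \<open>auto simp: g't\<close>)
  moreover have "(execute t \<theta> 1 (deps \<theta>') (Suc (pc \<theta>)) (regs \<theta>) Running \<sigma>)\<lparr>heap := heap \<sigma>, queue := queue \<sigma>, served := served \<sigma>\<rparr>
    = execute t \<theta> 1 (deps \<theta>') (Suc (pc \<theta>)) (regs \<theta>) Running \<sigma>" by (simp add: execute_def)
  ultimately show ?thesis by metis
qed

text \<open>Since \<open>u\<close> is fresh, it owns nothing and nobody has a right to join it; the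
  parent receives the only one. The set of threads grows here, so the sum of the credits is treated
  directly.\<close>

lemma inv_fork:
  assumes I: "state_inv g dp \<sigma>" and e: "can_execute P \<sigma> t \<theta> (Fork r l)" and u: "u \<notin> dom (threads \<sigma>)"
    and \<sigma>': "\<sigma>' = execute t \<theta> 1 {} (Suc (pc \<theta>)) ((regs \<theta>)(r := ThreadP u)) Running \<sigma>"
  shows "\<exists>g' dp'. state_inv g' dp' (\<sigma>'\<lparr>threads := (threads \<sigma>')(u \<mapsto>
          \<lparr>pc = l, regs = regs \<theta>, status = Running, ready = Suc (time \<sigma>), deps = {next_node \<sigma>}\<rparr>)\<rparr>)"
proof -
  have t: "threads \<sigma> t = Some \<theta>" "status \<theta> = Running" "P ! pc \<theta> = Fork r l"
    using e by (auto simp: can_execute_def)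
  have ut: "u \<noteq> t" using t u by auto
  have k: "ok (gspec (g t)) (pc \<theta>) (regs \<theta>) (gheap (g t)) (gtoks (g t)) (gwork (g t)) (gdepth (g t))"
    using inv_thread[OF I t(1)] t(2) by (simp add: thread_ok_def)
  have res: "resources_ok g (heap \<sigma>) (dom (threads \<sigma>))" using I by (simp add: state_inv_def)
  have nu: "gtoks (g v) u = None" for v using res u unfolding resources_ok_def by (metis not_None_eq)
  have gu: "gheap (g u) = Map.empty" "gtoks (g u) = Map.empty" using res u unfolding resources_ok_def by blast+
  from ok_forkD[OF k t(3)] obtain h1 h2 J1 J2 q' w1 d1 w2 d2 where
    h: "h1 \<subseteq>\<^sub>m gheap (g t)" "h2 \<subseteq>\<^sub>m gheap (g t)" "dom h1 \<inter> dom h2 = {}" and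
    J: "J1 \<subseteq>\<^sub>m gtoks (g t)" "J2 \<subseteq>\<^sub>m gtoks (g t)" "dom J1 \<inter> dom J2 = {}" and
    b: "fin q' \<le> bound" and o2: "ok q' l (regs \<theta>) h2 J2 w2 d2" and
    o1: "u \<notin> dom (gtoks (g t)) \<Longrightarrow> ok (gspec (g t)) (Suc (pc \<theta>)) ((regs \<theta>)(r := ThreadP u)) h1 (J1(u \<mapsto> q')) w1 d1"
    and c: "w1 + w2 + 2 \<le> gwork (g t)" "gdepth (g t) + 2 \<le> d1" "gdepth (g t) + 2 \<le> d2"
    by blast
  have o1: "ok (gspec (g t)) (Suc (pc \<theta>)) ((regs \<theta>)(r := ThreadP u)) h1 (J1(u \<mapsto> q')) w1 d1"
    using o1 nu by (simp add: domIff)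
  have dis: "dom (gheap (g v)) \<inter> dom (gheap (g v')) = {}" "dom (gtoks (g v)) \<inter> dom (gtoks (g v')) = {}"
    if "v \<noteq> v'" for v v' using res that unfolding resources_ok_def by blast+
  define x where "x = (g t)\<lparr>gheap := h1, gtoks := J1(u \<mapsto> q'), gwork := w1, gdepth := d1\<rparr>"
  define y where "y = \<lparr>gspec = q', gheap = h2, gtoks = J2, gwork = w2, gdepth = d2, gclaimed = False\<rparr>"
  define g' where "g' = g(t := x, u := y)"
  have g': "g' t = x" "g' u = y" "\<And>v. v \<noteq> t \<Longrightarrow> v \<noteq> u \<Longrightarrow> g' v = g v"
    using ut by (auto simp: g'_def)
  have sp: "gspec (g' v) = (if v = u then q' else gspec (g v))"
    "gclaimed (g' v) = (if v = u then False else gclaimed (g v))" for v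
    by (simp_all add: g'_def x_def y_def)
  have hx: "gheap (g' v) \<subseteq>\<^sub>m gheap (g v)" if "v \<noteq> u" for v
    using that h by (cases "v = t") (auto simp: g' x_def)
  have u0: "u \<noteq> 0" using res u unfolding resources_ok_def by metis
  have tD: "t \<in> dom (threads \<sigma>)" using t by blast
  \<comment> \<open>Whatever the child receives belonged to \<open>t\<close> before. Every pair of
    threads other than parent and child thus inherits disjointness from \<open>g\<close>; the same
    holds for join rights, up to the new right for \<open>u\<close>.\<close>
  have hd: "dom (gheap (g' v)) \<subseteq> dom (gheap (g (if v = u then t else v)))" for v
    using map_le_implies_dom_le[OF hx[of v]] map_le_implies_dom_le[OF h(2)] by (simp add: g' y_def)
  have Jd: "dom (gtoks (g' v)) \<subseteq> dom (gtoks (g (if v = u then t else v))) \<union> (if v = t then {u} else {})" for v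
    using map_le_implies_dom_le[OF J(1)] map_le_implies_dom_le[OF J(2)]
    by (cases "v = u"; cases "v = t") (auto simp: g' y_def x_def ut)
  have r: "resources_ok g' (heap \<sigma>) (insert u (dom (threads \<sigma>)))"
    unfolding resources_ok_def
  proof (intro conjI allI impI ballI)
    fix v
    have le: "gheap (g v) \<subseteq>\<^sub>m heap \<sigma>" for v using res by (simp add: resources_ok_def)
    show "gheap (g' v) \<subseteq>\<^sub>m heap \<sigma>"
      using map_le_trans[OF hx le] map_le_trans[OF h(2) le] by (cases "v = u") (auto simp: g' y_def)
    fix v' assume vv: "v \<noteq> v'"
    show "dom (gheap (g' v)) \<inter> dom (gheap (g' v')) = {}"
    proof (cases "{v, v'} = {u, t}")
      case True
      then consider "v = u" "v' = t" | "v = t" "v' = u" by (auto simp: doubleton_eq_iff)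
      then show ?thesis using h(3) by cases (simp_all add: g' x_def y_def Int_commute)
    next
      case False
      then have "(if v = u then t else v) \<noteq> (if v' = u then t else v')" using vv by auto
      then show ?thesis using hd[of v] hd[of v'] dis(1) by blast
    qed
    show "dom (gtoks (g' v)) \<inter> dom (gtoks (g' v')) = {}"
    proof (cases "{v, v'} = {u, t}")
      case True
      moreover have "u \<notin> dom J2" using map_leD[OF J(2), of u] nu[of t] by (cases "J2 u") auto
      ultimately consider "v = u" "v' = t" "u \<notin> dom J2" | "v = t" "v' = u" "u \<notin> dom J2"
        by (auto simp: doubleton_eq_iff)
      then show ?thesis using J(3) by cases (simp_all add: g' x_def y_def Int_commute del: domIff)
    next
      case False
      then have "(if v = u then t else v) \<noteq> (if v' = u then t else v')" using vv by auto
      then obtain a b where ab: "a = (if v = u then t else v)" "b = (if v' = u then t else v')" "a \<noteq> b"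
        by blast
      have nu': "u \<notin> dom (gtoks (g v))" for v using nu by (simp add: domIff)
      have "dom (gtoks (g' v)) \<subseteq> dom (gtoks (g a)) \<union> (if v = t then {u} else {})"
        "dom (gtoks (g' v')) \<subseteq> dom (gtoks (g b)) \<union> (if v' = t then {u} else {})"
        using Jd[of v] Jd[of v'] ab by simp_all
      moreover have "(if v = t then {u} else {}) \<inter> (if v' = t then {u} else {}) = {}" using vv by auto
      moreover have "(if w = t then {u} else {}) \<inter> dom (gtoks (g w')) = {}" for w w' using nu' by auto
      ultimately show ?thesis using dis(2)[OF ab(3)] by blast
    qed
  next
    fix v v' q assume v: "gtoks (g' v) v' = Some q"
    have "v' = u \<and> q = q' \<or> (\<exists>v1. gtoks (g v1) v' = Some q \<and> v' \<noteq> u)"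
    proof (cases "v' = u")
      case True
      have "u \<notin> dom J2" using map_leD[OF J(2), of u] nu[of t] by (cases "J2 u") auto
      then show ?thesis using v True nu by (cases "v = u"; cases "v = t") (auto simp: g' x_def y_def)
    next
      case False
      then have "gtoks (g (if v = u then t else v)) v' = Some q"
        using v map_leD[OF J(1)] map_leD[OF J(2)] by (cases "v = u"; cases "v = t") (simp_all add: g' x_def y_def)
      then show ?thesis using False by blast
    qed
    then have "v' \<noteq> 0 \<and> v' \<in> insert u (dom (threads \<sigma>)) \<and> gspec (g' v') = q \<and> \<not> gclaimed (g' v')"
    proof (elim disjE exE conjE)
      fix v1 assume v1: "gtoks (g v1) v' = Some q" "v' \<noteq> u"
      then have "v' \<noteq> 0 \<and> v' \<in> dom (threads \<sigma>) \<and> gspec (g v') = q \<and> \<not> gclaimed (g v')"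
        using res unfolding resources_ok_def by blast
      then show ?thesis using v1(2) by (simp add: sp)
    qed (use u0 in \<open>simp add: sp\<close>)
    then show "v' \<noteq> 0" "v' \<in> insert u (dom (threads \<sigma>))" "gspec (g' v') = q" "\<not> gclaimed (g' v')" by blast+
  next
    show "\<not> gclaimed (g' 0)" "gspec (g' 0) = q0"
      using res u0 by (simp_all add: resources_ok_def sp)
  next
    fix v assume "v \<in> insert u (dom (threads \<sigma>))"
    then show "fin (gspec (g' v)) \<le> bound"
      using res b by (cases "v = u") (simp_all add: resources_ok_def sp)
  next
    fix v assume v: "v \<notin> insert u (dom (threads \<sigma>))"
    then have "v \<noteq> t" "v \<noteq> u" using t by auto
    then show "gheap (g' v) = Map.empty" "gtoks (g' v) = Map.empty"
      using res v by (simp_all add: resources_ok_def g'(3))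
  qed (use res in \<open>simp_all add: resources_ok_def\<close>)
  have f1: "d1 \<le> fin (gspec (g t))" using inv_depth[OF I r, of _ _ _ t] o1 by (simp add: g' x_def)
  have f2: "d2 \<le> fin q'" using inv_depth[OF I r, of _ _ _ u] o2 by (simp add: g' y_def)
  have b1: "d1 \<le> bound" using f1 res t by (metis domI le_trans resources_ok_def)
  \<comment> \<open>Both threads depend on the fork node next, and \<open>d1\<close> and
    \<open>d2\<close> are at least this label.\<close>
  define dp' where "dp' = dp(next_node \<sigma> := gdepth (g t) + 2)"
  let ?G = "add_node 1 (deps \<theta>) (exec_dag \<sigma>)"
  have dg: "dag_ok ?G dp'"
    unfolding dp'_def next_node_def
  proof (rule dag_ok_add_node)
    show "\<forall>v\<in>deps \<theta>. v < length (weights (exec_dag \<sigma>)) \<and> dp v \<le> gdepth (g t)"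
      using inv_thread[OF I t(1)] unfolding thread_ok_def by blast
  qed (use I b1 c in \<open>auto simp: state_inv_def\<close>)
  let ?\<theta> = "\<lparr>pc = Suc (pc \<theta>), regs = (regs \<theta>)(r := ThreadP u), status = Running, ready = Suc (time \<sigma>), deps = {next_node \<sigma>}\<rparr>"
  let ?\<theta>u = "\<lparr>pc = l, regs = regs \<theta>, status = Running, ready = Suc (time \<sigma>), deps = {next_node \<sigma>}\<rparr>"
  let ?th = "(threads \<sigma>)(t \<mapsto> ?\<theta>, u \<mapsto> ?\<theta>u)"
  have dom: "dom ?th = insert u (dom (threads \<sigma>))" using t by auto
  have "thread_ok (time \<sigma>) (length (weights ?G)) dp' (g' v) \<theta>v" if v: "?th v = Some \<theta>v" for v \<theta>v
  proof -
    consider "v = u" "\<theta>v = ?\<theta>u" | "v = t" "\<theta>v = ?\<theta>" "v \<noteq> u" | "v \<noteq> t" "v \<noteq> u" "threads \<sigma> v = Some \<theta>v"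
      using v by (auto split: if_splits)
    then show ?thesis
    proof cases
      case 3
      then show ?thesis using thread_ok_mono[OF inv_thread[OF I 3(3)], of "time \<sigma>" "length (weights ?G)" dp']
        by (simp add: g' add_node_def dp'_def next_node_def)
    qed (use o1 o2 c f1 f2 in \<open>auto simp: thread_ok_def g' x_def y_def dp'_def add_node_def next_node_def\<close>)
  qed
  moreover have "queue_ok (time \<sigma>) (served \<sigma>) (queue \<sigma>) ?th"
  proof -
    have "queue_ok (time \<sigma>) (served \<sigma>) (queue \<sigma>) (threads \<sigma>)" using I by (simp add: state_inv_def)
    then show ?thesis by (subst (asm) queue_ok_cong[where th' = ?th]) (use t u in auto)
  qed
  moreover have "dag_work ?G + (\<Sum>v \<in> insert u (dom (threads \<sigma>)). gwork (g' v)) \<le> W"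
  proof -
    have fin: "finite (dom (threads \<sigma>))" using res by (simp add: resources_ok_def)
    have "(\<Sum>v \<in> dom (threads \<sigma>) - {t}. gwork (g' v)) = (\<Sum>v \<in> dom (threads \<sigma>) - {t}. gwork (g v))"
    proof (intro sum.cong refl)
      fix v assume "v \<in> dom (threads \<sigma>) - {t}"
      then have "v \<noteq> t" "v \<noteq> u" using u by auto
      then show "gwork (g' v) = gwork (g v)" by (simp add: g'(3))
    qed
    then have "(\<Sum>v \<in> dom (threads \<sigma>). gwork (g' v)) + gwork (g t) = (\<Sum>v \<in> dom (threads \<sigma>). gwork (g v)) + w1"
      using tD fin by (subst (1 2) sum.remove[of _ t]) (auto simp: g' x_def)
    moreover have "(\<Sum>v \<in> insert u (dom (threads \<sigma>)). gwork (g' v)) = (\<Sum>v \<in> dom (threads \<sigma>). gwork (g' v)) + w2"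
      using fin u by (simp add: g' y_def)
    ultimately show ?thesis using I c unfolding state_inv_def by (simp add: dag_work_def add_node_def)
  qed
  ultimately have "state_inv g' dp' (\<sigma>'\<lparr>threads := (threads \<sigma>')(u \<mapsto> ?\<theta>u)\<rparr>)"
    using r dg dom unfolding state_inv_def \<sigma>' by (simp add: execute_def)
  then show ?thesis by blast
qed

lemma inv_running:
  assumes "state_inv g dp \<sigma>" "can_execute P \<sigma> t \<theta> i"
  shows "ok (gspec (g t)) (pc \<theta>) (regs \<theta>) (gheap (g t)) (gtoks (g t)) (gwork (g t)) (gdepth (g t)) \<and> P ! pc \<theta> = i"
  using inv_thread[OF assms(1)] assms(2) by (auto simp: thread_ok_def can_execute_def)

theorem inv_step: "step P C E \<sigma> \<sigma>' \<Longrightarrow> state_inv g dp \<sigma> \<Longrightarrow> \<exists>g' dp'. state_inv g' dp' \<sigma>'"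
proof (induction rule: step.induct)
  case (suspend \<sigma> t \<theta>)
  then show ?case using inv_running ok_no_suspend by blast
next
  case (resume \<sigma> t \<theta> r)
  then show ?case using inv_running ok_no_suspend by blast
next
  case (resume_no_effect \<sigma> t \<theta> r)
  then show ?case using inv_running ok_no_suspend by blast
qed (blast intro: inv_simple inv_new inv_issue inv_service inv_tick inv_fork inv_join inv_terminate inv_eval)+

end

section \<open>Progress and soundness\<close>

lemma exec_dag_execute_neq: "exec_dag (execute t \<theta> k Q l R st \<sigma>) \<noteq> exec_dag \<sigma>"
proof -
  have "length (weights (exec_dag (execute t \<theta> k Q l R st \<sigma>))) \<noteq> length (weights (exec_dag \<sigma>))"
    by (simp add: execute_def add_node_def)
  then show ?thesis by metis
qed

context race_free begin

lemma service_progress: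
  assumes I: "state_inv g dp \<sigma>" and q: "queue \<sigma> (a, f) \<noteq> []" "(a, f) \<notin> served \<sigma>"
  shows "\<exists>\<sigma>'. step P C E \<sigma> \<sigma>' \<and> exec_dag \<sigma>' \<noteq> exec_dag \<sigma>"
proof -
  obtain t \<tau> \<theta> r op where t: "queue \<sigma> (a, f) = [(t, \<tau>)]" "threads \<sigma> t = Some \<theta>" "status \<theta> = Blocked"
    "P ! pc \<theta> = RMW r f op" "regs \<theta> r = NodeP a" using q(1) by (rule inv_queue[OF I])
  have "ok (gspec (g t)) (pc \<theta>) (regs \<theta>) (gheap (g t)) (gtoks (g t)) (gwork (g t)) (gdepth (g t))"
    using inv_thread[OF I t(2)] t(3) by (simp add: thread_ok_def)
  from ok_rmwD[OF this t(4,5)] obtain cs x R where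
    "gheap (g t) a = Some cs" "rmw_op op (regs \<theta>) (cs ! f) = (x, R)" by blast
  from step.service[OF t(1) q(2) t(2,4) inv_heap[OF I this(1)] this(2)]
  show ?thesis by (intro exI conjI, assumption) (simp add: exec_dag_execute_neq)
qed

text \<open>While no cell has served in the current time step, only a join can hold up a ready
  thread, and it waits for a thread of smaller \<open>fin\<close>; by \<open>j\<close> all those
  have terminated.\<close>

lemma running_progress:
  assumes I: "state_inv g dp \<sigma>" and s: "served \<sigma> = {}" and t: "threads \<sigma> t = Some \<theta>" "status \<theta> = Running"
    and r: "ready \<theta> \<le> time \<sigma>"
    and j: "\<And>u q. gtoks (g t) u = Some q \<Longrightarrow> fin q < fin (gspec (g t)) \<Longrightarrow>
      \<exists>\<theta>'. threads \<sigma> u = Some \<theta>' \<and> status \<theta>' = Terminated \<and> ready \<theta>' \<le> time \<sigma>"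
  shows "\<exists>\<sigma>'. reachable P C E \<sigma> \<sigma>' \<and> exec_dag \<sigma>' \<noteq> exec_dag \<sigma>"
proof -
  have ex: "\<exists>\<sigma>'. reachable P C E \<sigma> \<sigma>' \<and> exec_dag \<sigma>' \<noteq> exec_dag \<sigma>"
    if "step P C E \<sigma> \<sigma>'" "exec_dag \<sigma>' \<noteq> exec_dag \<sigma>" for \<sigma>'
    using that unfolding reachable_def by blast
  have res: "resources_ok g (heap \<sigma>) (dom (threads \<sigma>))" using I by (simp add: state_inv_def)
  then have fh: "finite (dom (heap \<sigma>))" "finite (dom (threads \<sigma>))" by (simp_all add: resources_ok_def)
  have can: "can_execute P \<sigma> t \<theta> (P ! pc \<theta>)" if "pc \<theta> < length P"
    using t r that by (simp add: can_execute_def)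
  have "ok (gspec (g t)) (pc \<theta>) (regs \<theta>) (gheap (g t)) (gtoks (g t)) (gwork (g t)) (gdepth (g t))"
    using inv_thread[OF I t(1)] t(2) by (simp add: thread_ok_def)
  then show ?thesis
  proof cases
    case simple
    from step.simple[OF can[OF simple(1)] simple(2)] show ?thesis using ex exec_dag_execute_neq by blast
  next
    case (rmw r f op a cs)
    note c = can[OF rmw(1), unfolded rmw(2)]
    note h = inv_heap[OF I rmw(4)]
    let ?s = "\<sigma>\<lparr>threads := (threads \<sigma>)(t \<mapsto> \<theta>\<lparr>status := Blocked\<rparr>),
          queue := (queue \<sigma>)((a, f) := queue \<sigma> (a, f) @ [(t, time \<sigma>)])\<rparr>"
    have st: "step P C E \<sigma> ?s" using step.issue[OF c rmw(3) h rmw(5)] .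
    \<comment> \<open>Issuing a request adds no node to the DAG, so the service has to be
      appended.\<close>
    have "\<exists>\<sigma>'. step P C E ?s \<sigma>' \<and> exec_dag \<sigma>' \<noteq> exec_dag ?s"
      by (rule service_progress[OF inv_issue[OF I c rmw(3)], where a = a and f = f]) (simp_all add: s)
    then obtain \<sigma>' where \<sigma>': "step P C E ?s \<sigma>'" "exec_dag \<sigma>' \<noteq> exec_dag ?s" by blast
    show ?thesis
    proof (intro exI conjI)
      show "reachable P C E \<sigma> \<sigma>'" unfolding reachable_def
        by (rule converse_rtranclp_into_rtranclp[OF st r_into_rtranclp[of "step P C E", OF \<sigma>'(1)]])
      show "exec_dag \<sigma>' \<noteq> exec_dag \<sigma>" using \<sigma>'(2) by simp
    qed
  next
    case new
    obtain a where "a \<notin> dom (heap \<sigma>)"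
      using ex_new_if_finite[OF infinite_UNIV_nat fh(1)] by blast
    from step.new[OF can[OF new(1), unfolded new(2)] this] show ?thesis by (rule ex) (use exec_dag_execute_neq in simp)
  next
    case fork
    obtain u where "u \<notin> dom (threads \<sigma>)"
      using ex_new_if_finite[OF infinite_UNIV_nat fh(2)] by blast
    from step.fork[OF can[OF fork(1), unfolded fork(2)] this refl] show ?thesis by (rule ex) (use exec_dag_execute_neq in simp)
  next
    case (join r u q')
    then have "fin q' < fin (gspec (g t))" by linarith
    from j[OF join(4) this] obtain \<theta>' where u: "threads \<sigma> u = Some \<theta>'" "status \<theta>' = Terminated" "ready \<theta>' \<le> time \<sigma>"
      by blast
    from step.join[OF can[OF join(1), unfolded join(2)] join(3) u] show ?thesis by (rule ex) (use exec_dag_execute_neq in simp)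
  next
    case terminate
    from step.terminate[OF can[OF terminate(1), unfolded terminate(2)]] show ?thesis by (rule ex) (use exec_dag_execute_neq in simp)
  next
    case (eval r r')
    then obtain D where D: "D \<in> E (regs \<theta> r')" "is_evaluation D" by blast
    from step.eval[OF can[OF eval(1), unfolded eval(2)], where E = E, OF D(1)] show ?thesis
    proof (rule ex)
      have "weights (graft D (deps \<theta>) (exec_dag \<sigma>)) \<noteq> weights (exec_dag \<sigma>)"
        using D(2) by (auto simp: graft_def Let_def is_evaluation_def)
      then show "exec_dag (\<sigma>\<lparr>exec_dag := graft D (deps \<theta>) (exec_dag \<sigma>),
          threads := (threads \<sigma>)(t \<mapsto>
            \<lparr>pc = Suc (pc \<theta>), regs = (regs \<theta>)(r := IntV (if C (regs \<theta> r') then 1 else 0)),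
             status = Running, ready = Suc (time \<sigma>), deps = {next_node \<sigma> + snd D}\<rparr>)\<rparr>) \<noteq> exec_dag \<sigma>"
        by auto
    qed
  qed
qed

text \<open>Among the threads that have not terminated, one with least \<open>fin\<close> waits for
  nobody. As \<open>halted\<close> looks at all later states, a tick may come first; it empties
  \<open>served\<close> and makes that thread ready.\<close>

lemma halted_terminated:
  assumes I: "state_inv g dp \<sigma>" and h: "halted P C E \<sigma>" and t: "threads \<sigma> t = Some \<theta>"
  shows "status \<theta> = Terminated"
proof (rule ccontr)
  assume nt: "status \<theta> \<noteq> Terminated"
  have no: False if "\<exists>\<sigma>'. reachable P C E \<sigma> \<sigma>' \<and> exec_dag \<sigma>' \<noteq> exec_dag \<sigma>"
    using that h by (auto simp: halted_def)
  have q: "c \<in> served \<sigma>" if c: "queue \<sigma> c \<noteq> []" for c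
  proof (rule ccontr)
    assume "c \<notin> served \<sigma>"
    then show False using service_progress[OF I, of "fst c" "snd c"] c no unfolding reachable_def by auto
  qed
  let ?s = "\<sigma>\<lparr>time := Suc (time \<sigma>), served := {}\<rparr>"
  have I': "state_inv g dp ?s" using inv_tick[OF I q] .
  have st: "step P C E \<sigma> ?s" using q by (rule step.tick)
  have no': False if "\<exists>\<sigma>'. reachable P C E ?s \<sigma>' \<and> exec_dag \<sigma>' \<noteq> exec_dag ?s"
  proof (rule no)
    from that obtain \<sigma>' where "(step P C E)\<^sup>*\<^sup>* ?s \<sigma>'" "exec_dag \<sigma>' \<noteq> exec_dag \<sigma>"
      by (auto simp: reachable_def)
    then show "\<exists>\<sigma>'. reachable P C E \<sigma> \<sigma>' \<and> exec_dag \<sigma>' \<noteq> exec_dag \<sigma>"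
      using st unfolding reachable_def by (meson converse_rtranclp_into_rtranclp)
  qed
  have qe: "queue \<sigma> c = []" for c
  proof (rule ccontr)
    assume "queue \<sigma> c \<noteq> []"
    then show False using service_progress[OF I', of "fst c" "snd c"] no' unfolding reachable_def by auto
  qed
  have run: "status \<theta>' = Running \<or> status \<theta>' = Terminated" if "threads \<sigma> u = Some \<theta>'" for u \<theta>'
  proof -
    have "queue_ok (time \<sigma>) (served \<sigma>) (queue \<sigma>) (threads \<sigma>)" using I by (simp add: state_inv_def)
    then have "status \<theta>' \<noteq> Blocked" using queue_ok_blocked that qe by fastforce
    moreover have "status \<theta>' \<noteq> Suspended" using inv_thread[OF I that] by (simp add: thread_ok_def)
    ultimately show ?thesis by (cases "status \<theta>'") auto
  qed
  define live where "live u \<longleftrightarrow> (\<exists>\<theta>'. threads \<sigma> u = Some \<theta>' \<and> status \<theta>' \<noteq> Terminated)" for u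
  have "live t" using t nt by (auto simp: live_def)
  then obtain u where u: "live u" "\<And>v. live v \<Longrightarrow> fin (gspec (g u)) \<le> fin (gspec (g v))"
    using ex_has_least_nat[of live t "\<lambda>u. fin (gspec (g u))"] by blast
  then obtain \<theta>' where \<theta>': "threads \<sigma> u = Some \<theta>'" "status \<theta>' = Running" using run by (auto simp: live_def)
  have "\<exists>\<sigma>'. reachable P C E ?s \<sigma>' \<and> exec_dag \<sigma>' \<noteq> exec_dag ?s"
  proof (rule running_progress[OF I', where t = u])
    show "ready \<theta>' \<le> time ?s" using inv_thread[OF I \<theta>'(1)] by (simp add: thread_ok_def)
    fix v q assume v: "gtoks (g u) v = Some q" "fin q < fin (gspec (g u))"
    then have "v \<in> dom (threads \<sigma>)" "gspec (g v) = q" using I unfolding state_inv_def resources_ok_def by blast+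
    then obtain \<theta>v where \<theta>v: "threads \<sigma> v = Some \<theta>v" "\<not> live v" using v u(2)[of v] by fastforce
    then show "\<exists>\<theta>'. threads ?s v = Some \<theta>' \<and> status \<theta>' = Terminated \<and> ready \<theta>' \<le> time ?s"
      using inv_thread[OF I \<theta>v(1)] by (auto simp: live_def thread_ok_def)
  qed (use \<theta>' in auto)
  then show False by (rule no')
qed

lemma inv_initial:
  assumes k: "ok q0 0 ((\<lambda>_. Null)(0 := x)) H Map.empty W 0" and H: "finite (dom H)" and b: "fin q0 \<le> bound"
  shows "\<exists>g dp. state_inv g dp (initial H x)"
proof -
  define g where "g t = \<lparr>gspec = q0, gheap = (if t = 0 then H else Map.empty), gtoks = Map.empty,
    gwork = (if t = 0 then W else 0), gdepth = 0, gclaimed = False\<rparr>" for t :: tid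
  have "resources_ok g H {0}" using H b by (auto simp: resources_ok_def g_def)
  moreover have "thread_ok 0 0 (\<lambda>_. 0) (g 0) \<lparr>pc = 0, regs = (\<lambda>_. Null)(0 := x), status = Running, ready = 0, deps = {}\<rparr>"
    using k by (simp add: thread_ok_def g_def)
  ultimately have "state_inv g (\<lambda>_. 0) (initial H x)"
    by (simp add: state_inv_def initial_def empty_dag_def dag_ok_def dag_work_def queue_ok_def g_def)
  then show ?thesis by blast
qed

theorem race_free_sound:
  assumes k: "ok q0 0 ((\<lambda>_. Null)(0 := x)) H Map.empty W 0" and H: "finite (dom H)" and b: "fin q0 \<le> bound"
    and r: "reachable P C E (initial H x) \<sigma>"
  shows "returned \<sigma> y \<Longrightarrow> \<exists>R h J. R 0 = y \<and> h \<subseteq>\<^sub>m heap \<sigma> \<and> post q0 R h J"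
    and "halted P C E \<sigma> \<Longrightarrow> \<exists>y. returned \<sigma> y"
    and "dag_work (exec_dag \<sigma>) \<le> W"
    and "dag_span (exec_dag \<sigma>) \<le> enat bound"
proof -
  have "\<exists>g dp. state_inv g dp \<sigma>"
    using r unfolding reachable_def
    by (induction rule: rtranclp_induct) (use inv_initial[OF k H b] inv_step in blast)+
  then obtain g dp where I: "state_inv g dp \<sigma>" by blast
  then have res: "resources_ok g (heap \<sigma>) (dom (threads \<sigma>))" by (simp add: state_inv_def)
  then obtain \<theta> where \<theta>: "threads \<sigma> 0 = Some \<theta>" unfolding resources_ok_def by blast
  show "\<exists>R h J. R 0 = y \<and> h \<subseteq>\<^sub>m heap \<sigma> \<and> post q0 R h J" if "returned \<sigma> y"
  proof (intro exI conjI)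
    show "regs \<theta> 0 = y" using that \<theta> by (auto simp: returned_def)
    show "gheap (g 0) \<subseteq>\<^sub>m heap \<sigma>" using res by (simp add: resources_ok_def)
    have "status \<theta> = Terminated" using that \<theta> by (auto simp: returned_def)
    then show "post q0 (regs \<theta>) (gheap (g 0)) (gtoks (g 0))"
      using inv_thread[OF I \<theta>] res by (simp add: thread_ok_def resources_ok_def)
  qed
  show "\<exists>y. returned \<sigma> y" if "halted P C E \<sigma>"
    using halted_terminated[OF I that \<theta>] \<theta> by (auto simp: returned_def)
  show "dag_work (exec_dag \<sigma>) \<le> W" using I by (simp add: state_inv_def)
  show "dag_span (exec_dag \<sigma>) \<le> enat bound"
    by (rule dag_span_le_labelling[where dp = dp]) (use I in \<open>auto simp: state_inv_def dag_ok_def\<close>)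
qed


section \<open>Symbolic execution\<close>

text \<open>An executable semantics of straight-line code, run by the simplifier.
  \<open>Self\<close> is left out because it is the only simple instruction whose effect depends on
  the executing thread; the identity 0 can then stand for any.\<close>

definition seq_step :: "instr \<Rightarrow> nat \<Rightarrow> (reg \<Rightarrow> val) \<Rightarrow> mem \<Rightarrow> (nat \<times> (reg \<Rightarrow> val) \<times> mem) option" where
  "seq_step i l R h = (case i of
     RMW r f op \<Rightarrow> (case R r of NodeP a \<Rightarrow> (case h a of Some cs \<Rightarrow>
         if f < length cs then (case op of
             Read d \<Rightarrow> Some (Suc l, R(d := cs ! f), h)
           | Write s \<Rightarrow> Some (Suc l, R, h(a \<mapsto> cs[f := R s]))
           | _ \<Rightarrow> None)
         else None | None \<Rightarrow> None) | _ \<Rightarrow> None)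
   | Self d \<Rightarrow> None
   | _ \<Rightarrow> map_option (\<lambda>(l', R'). (l', R', h)) (simple_op 0 i l R))"

fun seq :: "nat \<Rightarrow> nat \<Rightarrow> (reg \<Rightarrow> val) \<Rightarrow> mem \<Rightarrow> (nat \<times> (reg \<Rightarrow> val) \<times> mem) option" where
  "seq 0 l R h = Some (l, R, h)"
| "seq (Suc n) l R h = (if l < length P then
     (case seq_step (P ! l) l R h of None \<Rightarrow> None | Some (l', R', h') \<Rightarrow> seq n l' R' h') else None)"

lemma seq_numeral: "seq (numeral k) l R h = (if l < length P then
     (case seq_step (P ! l) l R h of None \<Rightarrow> None
       | Some (l', R', h') \<Rightarrow> seq (pred_numeral k) l' R' h') else None)"
  by (simp add: numeral_eq_Suc)

lemma ok_seq_step: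
  assumes l: "l < length P" and s: "seq_step (P ! l) l R h = Some (l', R', h')"
    and k: "ok q l' R' h' J w' d'" and c: "w' + 2 \<le> w" "d + 2 \<le> d'"
  shows "ok q l R h J w d"
proof (cases "\<exists>r f op. P ! l = RMW r f op")
  case True
  then obtain r f op where i: "P ! l = RMW r f op" by blast
  with s obtain a cs where a: "R r = NodeP a" "h a = Some cs" "f < length cs"
    by (auto simp: seq_step_def split: val.splits option.splits if_splits)
  consider d where "op = Read d" "l' = Suc l" "R' = R(d := cs ! f)" "h' = h"
    | s where "op = Write s" "l' = Suc l" "R' = R" "h' = h(a \<mapsto> cs[f := R s])"
    using s i a by (cases op) (auto simp: seq_step_def)
  then show ?thesis
  proof cases
    case 1
    have "h(a \<mapsto> cs[f := cs ! f]) = h" using a by (simp add: fun_upd_idem)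
    then have "ok q (Suc l) (R(d := cs ! f)) (h(a \<mapsto> cs[f := cs ! f])) J w' d'" using k 1 by (simp only:)
    from ok.rmw[OF l i, where R = R and h = h, OF a _ this c] show ?thesis using 1(1) by simp
  next
    case 2
    then show ?thesis using k c by (intro ok.rmw[OF l i, where R = R and h = h, OF a]) simp_all
  qed
next
  case False
  then have m: "map_option (\<lambda>(l', R'). (l', R', h)) (simple_op 0 (P ! l) l R) = Some (l', R', h')"
    and nS: "\<And>d. P ! l \<noteq> Self d"
    using s by (auto simp: seq_step_def split: instr.splits)
  then have "simple_op 0 (P ! l) l R = Some (l', R')" "h' = h" by auto
  moreover have "simple_op t (P ! l) l R = simple_op 0 (P ! l) l R" for t
    using nS by (cases "P ! l") auto
  ultimately show ?thesis using k c by (intro ok.simple[OF l]) simp_all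
qed

lemma ok_seq:
  "seq n l R h = Some (l', R', h') \<Longrightarrow> ok q l' R' h' J w' d' \<Longrightarrow> w' + 2 * n \<le> w \<Longrightarrow> d + 2 * n \<le> d' \<Longrightarrow>
    ok q l R h J w d"
proof (induction n arbitrary: l R h w d)
  case 0
  then show ?case by (auto intro: ok_mono)
next
  case (Suc n)
  then obtain l1 R1 h1 where s: "l < length P" "seq_step (P ! l) l R h = Some (l1, R1, h1)"
    "seq n l1 R1 h1 = Some (l', R', h')" by (auto split: if_splits option.splits)
  show ?case using Suc.prems
    by (intro ok_seq_step[OF s(1,2) Suc.IH[OF s(3), of "w - 2" "d + 2"]]) auto
qed

end

lemma list_update_Cons_numeral: "(x # xs)[numeral k := y] = x # xs[pred_numeral k := y]"
  by (simp add: numeral_eq_Suc)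

lemma replicate_numeral: "replicate (numeral k) x = x # replicate (pred_numeral k) x"
  by (simp add: numeral_eq_Suc)

lemma restrict_map_le: "m |` A \<subseteq>\<^sub>m m"
  by (auto simp: map_le_def restrict_map_def split: if_splits)

section \<open>Trees in memory\<close>

text \<open>The pruned tree. Its leaves are already batches, and its inner nodes have the size of
  batch nodes because they are reused as such.\<close>

inductive stree :: "mem \<Rightarrow> addr \<Rightarrow> addr set \<Rightarrow> val ltree \<Rightarrow> bool" for H where
  leaf: "H p = Some (batch_node Null Null (Leaf x)) \<Longrightarrow> stree H p {p} (Leaf x)"
| branch: "H p = Some [NodeP l, NodeP r, y, IntV (int (length (items (Branch T U)))), y', y''] \<Longrightarrow>
    stree H l A T \<Longrightarrow> stree H r B U \<Longrightarrow> A \<inter> B = {} \<Longrightarrow> p \<notin> A \<union> B \<Longrightarrow>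
    stree H p (insert p (A \<union> B)) (Branch T U)"

inductive_cases stree_leafE: "stree H p A (Leaf x)"
inductive_cases stree_branchE: "stree H p A (Branch T U)"
inductive_cases tree_at_leafE: "tree_at H p A (Leaf x)"
inductive_cases tree_at_branchE: "tree_at H p A (Branch T U)"

lemma tree_at_cong: "tree_at H p A T \<Longrightarrow> \<forall>a \<in> A. H' a = H a \<Longrightarrow> tree_at H' p A T"
  by (induction rule: tree_at.induct) (simp_all add: tree_at.intros)

lemma stree_cong: "stree H p A T \<Longrightarrow> \<forall>a \<in> A. H' a = H a \<Longrightarrow> stree H' p A T"
  by (induction rule: stree.induct) (auto intro!: stree.intros)

lemma bbt_at_cong: "bbt_at H p A T \<Longrightarrow> \<forall>a \<in> A. H' a = H a \<Longrightarrow> bbt_at H' p A T"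
  by (induction rule: bbt_at.induct) (simp_all add: bbt_at.intros)

lemma stree_dom: "stree H p A T \<Longrightarrow> A \<subseteq> dom H"
  by (induction rule: stree.induct) auto

lemma stree_root:
  "stree H p A T \<Longrightarrow> p \<in> A \<and> (\<exists>x0 x1 x2 x4 x5. H p = Some [x0, x1, x2, IntV (int (length (items T))), x4, x5])"
  by (induction rule: stree.induct) (auto simp: batch_node_def)

lemma tree_at_dom: "tree_at H p A T \<Longrightarrow> A \<subseteq> dom H"
  by (induction rule: tree_at.induct) auto

lemma bbt_at_dom: "bbt_at H p A T \<Longrightarrow> A \<subseteq> dom H"
  by (induction rule: bbt_at.induct) auto

section \<open>The program\<close>

text \<open>Entry points: 0 main thread; 8 computation of the largest power of two up to \<open>k\<close>;
  15 distribution, with registers 0: tree node, 1: own mailbox, 2 and 6: next thread and its mailbox,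
  3: rank of the first leaf, 4: \<open>r\<close>, 5: \<open>2 * r\<close>; 24 forked thread of the
  distribution; 28 leaf; 31 merging, with registers 0: batch of the own block, 7: number of the block;
  60 publication, in cells 0 to 2 of the mailbox; 64 counting, with registers 0: tree node,
  1: one-cell node for the result; 89 and 92 its forked threads; 95 leaf of the counting phase.\<close>

definition prog :: program where
  "prog = [
    New 1 1, Fork 2 64, Join 2, RMW 1 0 (Read 0), SetNull 2, JumpEq 0 2 63, RMW 0 3 (Read 3),
    SetInt 4 1, Arith Plus 5 4 4, JumpLess 3 5 12, Move 4 5, JumpEq 0 0 8,
    Arith Minus 4 3 4, Arith Plus 5 4 4, SetInt 3 0,
    RMW 0 0 (Read 7), SetNull 10, JumpEq 7 10 28, RMW 0 1 (Read 8), RMW 7 3 (Read 9), Fork 2 24,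
    Move 6 0, Move 0 7, JumpEq 0 0 15,
    Move 1 0, Move 0 8, Arith Plus 3 3 9, JumpEq 0 0 15,
    Move 7 3, JumpLess 3 5 31, Arith Minus 7 3 4,
    SetInt 8 2, Arith Mod 9 7 8, SetInt 11 1, JumpEq 9 11 60, JumpEq 2 10 63, Join 2,
    RMW 6 0 (Read 12), RMW 6 1 (Read 13), RMW 6 2 (Read 2), RMW 6 0 (Write 0), RMW 6 1 (Write 12),
    RMW 0 2 (Read 14), RMW 12 2 (Read 15), JumpLess 15 14 46, Move 14 15, Arith Plus 14 14 11, RMW 6 2 (Write 14),
    RMW 0 3 (Read 14), RMW 12 3 (Read 15), Arith Plus 14 14 15, RMW 6 3 (Write 14),
    RMW 0 4 (Read 14), RMW 6 4 (Write 14), RMW 12 5 (Read 14), RMW 6 5 (Write 14),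
    Move 0 6, Move 6 13, Arith Div 7 7 8, JumpEq 0 0 31,
    RMW 1 0 (Write 0), RMW 1 1 (Write 6), RMW 1 2 (Write 2), Terminate,
    RMW 0 0 (Read 2), SetNull 3, JumpEq 2 3 95, RMW 0 1 (Read 4), New 5 1, New 6 1,
    Fork 7 89, Fork 8 92, Join 7, Join 8,
    RMW 5 0 (Read 5), RMW 6 0 (Read 9), JumpEq 5 3 87, Move 10 9, Move 9 5, JumpEq 10 3 87,
    New 9 6, RMW 9 0 (Write 5), RMW 9 1 (Write 10), RMW 5 3 (Read 11), RMW 10 3 (Read 12),
    Arith Plus 11 11 12, RMW 9 3 (Write 11),
    RMW 1 0 (Write 9), Terminate,
    Move 0 2, Move 1 5, JumpEq 0 0 64,
    Move 0 4, Move 1 6, JumpEq 0 0 64,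
    RMW 0 2 (Read 4), Eval 5 4, SetInt 6 0, JumpEq 5 6 88, New 9 6,
    RMW 9 2 (Write 6), RMW 9 3 (Write 5), RMW 9 4 (Write 4), RMW 9 5 (Write 4), JumpEq 0 0 87]"

lemma length_prog: "length prog = 105"
  by (simp add: prog_def)

lemma prog_nth:
  "prog ! 0 = New 1 1"
  "prog ! (Suc 0) = Fork 2 64"
  "prog ! 2 = Join 2"
  "prog ! 3 = RMW 1 0 (Read 0)"
  "prog ! 4 = SetNull 2"
  "prog ! 5 = JumpEq 0 2 63"
  "prog ! 6 = RMW 0 3 (Read 3)"
  "prog ! 7 = SetInt 4 1"
  "prog ! 8 = Arith Plus 5 4 4"
  "prog ! 9 = JumpLess 3 5 12"
  "prog ! 10 = Move 4 5"
  "prog ! 11 = JumpEq 0 0 8"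
  "prog ! 12 = Arith Minus 4 3 4"
  "prog ! 13 = Arith Plus 5 4 4"
  "prog ! 14 = SetInt 3 0"
  "prog ! 15 = RMW 0 0 (Read 7)"
  "prog ! 16 = SetNull 10"
  "prog ! 17 = JumpEq 7 10 28"
  "prog ! 18 = RMW 0 1 (Read 8)"
  "prog ! 19 = RMW 7 3 (Read 9)"
  "prog ! 20 = Fork 2 24"
  "prog ! 21 = Move 6 0"
  "prog ! 22 = Move 0 7"
  "prog ! 23 = JumpEq 0 0 15"
  "prog ! 24 = Move 1 0"
  "prog ! 25 = Move 0 8"
  "prog ! 26 = Arith Plus 3 3 9"
  "prog ! 27 = JumpEq 0 0 15"
  "prog ! 28 = Move 7 3"
  "prog ! 29 = JumpLess 3 5 31"
  "prog ! 30 = Arith Minus 7 3 4"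
  "prog ! 31 = SetInt 8 2"
  "prog ! 32 = Arith Mod 9 7 8"
  "prog ! 33 = SetInt 11 1"
  "prog ! 34 = JumpEq 9 11 60"
  "prog ! 35 = JumpEq 2 10 63"
  "prog ! 36 = Join 2"
  "prog ! 37 = RMW 6 0 (Read 12)"
  "prog ! 38 = RMW 6 1 (Read 13)"
  "prog ! 39 = RMW 6 2 (Read 2)"
  "prog ! 40 = RMW 6 0 (Write 0)"
  "prog ! 41 = RMW 6 1 (Write 12)"
  "prog ! 42 = RMW 0 2 (Read 14)"
  "prog ! 43 = RMW 12 2 (Read 15)"
  "prog ! 44 = JumpLess 15 14 46"
  "prog ! 45 = Move 14 15"
  "prog ! 46 = Arith Plus 14 14 11"
  "prog ! 47 = RMW 6 2 (Write 14)"
  "prog ! 48 = RMW 0 3 (Read 14)"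
  "prog ! 49 = RMW 12 3 (Read 15)"
  "prog ! 50 = Arith Plus 14 14 15"
  "prog ! 51 = RMW 6 3 (Write 14)"
  "prog ! 52 = RMW 0 4 (Read 14)"
  "prog ! 53 = RMW 6 4 (Write 14)"
  "prog ! 54 = RMW 12 5 (Read 14)"
  "prog ! 55 = RMW 6 5 (Write 14)"
  "prog ! 56 = Move 0 6"
  "prog ! 57 = Move 6 13"
  "prog ! 58 = Arith Div 7 7 8"
  "prog ! 59 = JumpEq 0 0 31"
  "prog ! 60 = RMW 1 0 (Write 0)"
  "prog ! 61 = RMW 1 1 (Write 6)"
  "prog ! 62 = RMW 1 2 (Write 2)"
  "prog ! 63 = Terminate"
  "prog ! 64 = RMW 0 0 (Read 2)"
  "prog ! 65 = SetNull 3"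
  "prog ! 66 = JumpEq 2 3 95"
  "prog ! 67 = RMW 0 1 (Read 4)"
  "prog ! 68 = New 5 1"
  "prog ! 69 = New 6 1"
  "prog ! 70 = Fork 7 89"
  "prog ! 71 = Fork 8 92"
  "prog ! 72 = Join 7"
  "prog ! 73 = Join 8"
  "prog ! 74 = RMW 5 0 (Read 5)"
  "prog ! 75 = RMW 6 0 (Read 9)"
  "prog ! 76 = JumpEq 5 3 87"
  "prog ! 77 = Move 10 9"
  "prog ! 78 = Move 9 5"
  "prog ! 79 = JumpEq 10 3 87"
  "prog ! 80 = New 9 6"
  "prog ! 81 = RMW 9 0 (Write 5)"
  "prog ! 82 = RMW 9 1 (Write 10)"
  "prog ! 83 = RMW 5 3 (Read 11)"
  "prog ! 84 = RMW 10 3 (Read 12)"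
  "prog ! 85 = Arith Plus 11 11 12"
  "prog ! 86 = RMW 9 3 (Write 11)"
  "prog ! 87 = RMW 1 0 (Write 9)"
  "prog ! 88 = Terminate"
  "prog ! 89 = Move 0 2"
  "prog ! 90 = Move 1 5"
  "prog ! 91 = JumpEq 0 0 64"
  "prog ! 92 = Move 0 4"
  "prog ! 93 = Move 1 6"
  "prog ! 94 = JumpEq 0 0 64"
  "prog ! 95 = RMW 0 2 (Read 4)"
  "prog ! 96 = Eval 5 4"
  "prog ! 97 = SetInt 6 0"
  "prog ! 98 = JumpEq 5 6 88"
  "prog ! 99 = New 9 6"
  "prog ! 100 = RMW 9 2 (Write 6)"
  "prog ! 101 = RMW 9 3 (Write 5)"
  "prog ! 102 = RMW 9 4 (Write 4)"
  "prog ! 103 = RMW 9 5 (Write 4)"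
  "prog ! 104 = JumpEq 0 0 87"
  by (simp_all add: prog_def)


section \<open>Specifications of the threads\<close>

text \<open>\<open>Count q ys m f\<close> stores the pruned tree of \<open>ys\<close>, of height at most
  \<open>m\<close>, in the node \<open>q\<close> and finishes by depth \<open>f\<close>.
  \<open>Block j b q\<close> publishes block \<open>b\<close> of level \<open>j\<close> in the
  mailbox \<open>q\<close>.\<close>

datatype spec = Main | Count addr "val list" nat nat | Block nat nat addr

definition pruned :: "mem \<Rightarrow> val \<Rightarrow> addr set \<Rightarrow> val list \<Rightarrow> nat \<Rightarrow> bool" where
  "pruned h v A ys m \<longleftrightarrow> (v = Null \<and> ys = [] \<and> A = {}) \<or>
     (\<exists>p S. v = NodeP p \<and> stree h p A S \<and> items S = ys \<and> height S \<le> m)"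

lemma pruned_cong: "pruned h v A ys m \<Longrightarrow> \<forall>a \<in> A. h' a = h a \<Longrightarrow> pruned h' v A ys m"
  unfolding pruned_def by (metis stree_cong)

lemma pruned_mono: "pruned h v A ys m \<Longrightarrow> m \<le> m' \<Longrightarrow> pruned h v A ys m'"
  unfolding pruned_def by (fastforce intro: le_trans)

lemma pruned_dom: "pruned h v A ys m \<Longrightarrow> A \<subseteq> dom h"
  unfolding pruned_def using stree_dom by blast

text \<open>Here \<open>xs\<close> is the expected output, of length \<open>2 ^ J + r\<close> unless
  it is empty, and \<open>base\<close> a depth by which every thread has begun merging. These
  relations appear as premises where they are used.\<close>

locale filtering =
  fixes C :: "val \<Rightarrow> bool" and E :: "val \<Rightarrow> evaluation set" and xs :: "val list"
    and J r base bound ew es W :: nat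
begin

text \<open>Place the items at slots such that block \<open>b\<close> of level \<open>j\<close> covers
  the slots from \<open>b * 2 ^ j\<close> to \<open>(b + 1) * 2 ^ j\<close>: the paired items occupy all
  slots below \<open>2 * r\<close>, the others every second slot from there. \<open>rank s\<close> is
  the number of items before slot \<open>s\<close>. The slot determines the last block that a thread
  owns, as every positive number is uniquely an odd number times a power of two.\<close>

definition rank :: "nat \<Rightarrow> nat" where
  "rank s = (if s \<le> 2 * r then s else r + (s + 1) div 2)"

text \<open>The slot \<open>s\<close> is where the own block ends and the part of the next thread
  begins. Written as an odd number times a power of two, it names the block that the next thread
  will publish; at the end of the output there is no next thread.\<close>

definition next_token :: "(tid \<rightharpoonup> spec) \<Rightarrow> nat \<Rightarrow> val \<Rightarrow> val \<Rightarrow> bool" where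
  "next_token K s nt nm \<longleftrightarrow>
     (if s = 2 * 2 ^ J then nt = Null
      else \<exists>u j b m. nt = ThreadP u \<and> nm = NodeP m \<and> K u = Some (Block j b m) \<and> odd b \<and> s = b * 2 ^ j)"

text \<open>Paired items start on level 0 with height 0, the others on level 1 with height 0. On
  level 1 the heights 0 and 1 thus meet, and each merge raises both by one, which leaves
  \<open>j - 1\<close> and \<open>j\<close>.\<close>

definition block_at :: "mem \<Rightarrow> addr \<Rightarrow> addr set \<Rightarrow> nat \<Rightarrow> nat \<Rightarrow> bool" where
  "block_at h p A j b \<longleftrightarrow> (\<exists>B. bbt_at h p A B \<and>
     items B = take (rank ((b + 1) * 2 ^ j) - rank (b * 2 ^ j)) (drop (rank (b * 2 ^ j)) xs) \<and>
     height B \<le> j \<and> j \<le> height B + 1)"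

fun post :: "spec \<Rightarrow> (reg \<Rightarrow> val) \<Rightarrow> mem \<Rightarrow> (tid \<rightharpoonup> spec) \<Rightarrow> bool" where
  "post Main R h K \<longleftrightarrow> is_batch h (R 0) xs"
| "post (Count q ys m f) R h K \<longleftrightarrow> (\<exists>v A. h q = Some [v] \<and> pruned h v A ys m \<and> q \<notin> A)"
| "post (Block j b q) R h K \<longleftrightarrow> (\<exists>p nm nt y y' y'' A. h q = Some [NodeP p, nm, nt, y, y', y''] \<and>
     q \<notin> A \<and> block_at h p A j b \<and> next_token K ((b + 1) * 2 ^ j) nt nm)"

text \<open>A thread takes up a block of level \<open>j\<close> by depth
  \<open>base + 100 * j\<close>. Publishing takes less than 20. Joining the neighbour, which has the
  same deadline for publishing, and merging end by \<open>base + 100 * j + 68\<close>, in time for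
  the next level.\<close>

fun fin :: "spec \<Rightarrow> nat" where
  "fin Main = base + 100 * (J + 1) + 20"
| "fin (Count q ys m f) = f"
| "fin (Block j b q) = base + 100 * j + 20"

sublocale race_free prog C E post fin ew es bound W Main .

lemmas seq_simps = seq_numeral seq_step_def prog_nth length_prog list_update_Cons_numeral

section \<open>Counting\<close>

lemma count_combine_ok:
  assumes R: "R 1 = NodeP q" "R 3 = Null" "R 5 = NodeP q1" "R 6 = NodeP q2"
    and h: "h q = Some [c]" "h q1 = Some [v1]" "h q2 = Some [v2]"
    and p: "pruned h v1 A1 ys1 m1" "pruned h v2 A2 ys2 m2" and A: "A1 \<inter> A2 = {}" "q \<notin> A1 \<union> A2"
    and c: "d + 30 \<le> f" "30 \<le> w"
  shows "ok (Count q (ys1 @ ys2) (Suc (max m1 m2)) f) 74 R h K w d"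
proof (cases "v1 = Null")
  case True
  have s: "seq 4 74 R h = Some (88, R(5 := Null, 9 := v2), h(q \<mapsto> [v2]))"
    using R h True by (simp add: seq_simps)
  have "post (Count q (ys1 @ ys2) (Suc (max m1 m2)) f) (R(5 := Null, 9 := v2)) (h(q \<mapsto> [v2])) K"
  proof -
      have "pruned (h(q \<mapsto> [v2])) v2 A2 ys2 (Suc (max m1 m2))"
        using pruned_mono[OF pruned_cong[OF p(2)]] A by auto
      moreover have "ys1 @ ys2 = ys2" using p(1) True by (simp add: pruned_def)
      ultimately show ?thesis using A by auto
    qed
  then show ?thesis
    by (intro ok_seq[OF s, of _ _ "w - 8" "d + 8"] ok.terminate) (use c in \<open>simp_all add: prog_nth length_prog\<close>)
next
  case v1: False
  then obtain p1 S1 where p1: "v1 = NodeP p1" "stree h p1 A1 S1" "items S1 = ys1" "height S1 \<le> m1"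
    using p by (auto simp: pruned_def)
  show ?thesis
  proof (cases "v2 = Null")
    case True
    have s: "seq 7 74 R h = Some (88, R(5 := v1, 10 := Null, 9 := v1), h(q \<mapsto> [v1]))"
      using R h True v1 by (simp add: seq_simps)
    have "post (Count q (ys1 @ ys2) (Suc (max m1 m2)) f) (R(5 := v1, 10 := Null, 9 := v1)) (h(q \<mapsto> [v1])) K"
  proof -
      have "pruned (h(q \<mapsto> [v1])) v1 A1 ys1 (Suc (max m1 m2))"
        using pruned_mono[OF pruned_cong[OF p(1)]] A by auto
      moreover have "ys1 @ ys2 = ys1" using p(2) True by (simp add: pruned_def)
      ultimately show ?thesis using A by auto
    qed
    then show ?thesis
      by (intro ok_seq[OF s, of _ _ "w - 14" "d + 14"] ok.terminate) (use c in \<open>simp_all add: prog_nth length_prog\<close>)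
  next
    case v2: False
    then obtain p2 S2 where p2: "v2 = NodeP p2" "stree h p2 A2 S2" "items S2 = ys2" "height S2 \<le> m2"
      using p by (auto simp: pruned_def)
    have s: "seq 6 74 R h = Some (80, R(5 := v1, 10 := v2, 9 := v1), h)"
      using R h v1 v2 by (simp add: seq_simps)
    show ?thesis
    proof (rule ok_seq[OF s, of _ _ "w - 12" "d + 12"], rule ok.new)
      fix a assume a: "a \<notin> dom h"
      let ?R = "(R(5 := v1, 10 := v2, 9 := v1))(9 := NodeP a)"
      let ?h = "h(a \<mapsto> replicate 6 Null)"
      have ne: "a \<noteq> q" "a \<noteq> p1" "a \<noteq> p2" "a \<notin> A1" "a \<notin> A2" "p1 \<noteq> q" "p2 \<noteq> q"
        using a h p1 p2 stree_dom[OF p1(2)] stree_dom[OF p2(2)] stree_root[OF p1(2)] stree_root[OF p2(2)] A by auto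
      define n where "n = [NodeP p1, NodeP p2, Null, IntV (int (length ys1) + int (length ys2)), Null, Null]"
      have s': "\<exists>R'. seq 7 (Suc 80) ?R ?h = Some (88, R', h(a \<mapsto> n, q \<mapsto> [NodeP a]))"
        using R h ne p1 p2 stree_root[OF p1(2)] stree_root[OF p2(2)]
        by (auto simp: seq_simps n_def replicate_numeral)
      then obtain R' where s': "seq 7 (Suc 80) ?R ?h = Some (88, R', h(a \<mapsto> n, q \<mapsto> [NodeP a]))" by blast
      let ?h' = "h(a \<mapsto> n, q \<mapsto> [NodeP a])"
      have "stree ?h' a (insert a (A1 \<union> A2)) (Branch S1 S2)"
      proof (rule stree.branch)
        show "?h' a = Some [NodeP p1, NodeP p2, Null, IntV (int (length (items (Branch S1 S2)))), Null, Null]"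
          using ne p1 p2 by (simp add: n_def)
        show "stree ?h' p1 A1 S1" by (rule stree_cong[OF p1(2)]) (use A ne in auto)
        show "stree ?h' p2 A2 S2" by (rule stree_cong[OF p2(2)]) (use A ne in auto)
      qed (use A ne in auto)
      then have "post (Count q (ys1 @ ys2) (Suc (max m1 m2)) f) R' ?h' K"
        using A ne p1 p2 by (auto simp: pruned_def intro!: exI[of _ "insert a (A1 \<union> A2)"] exI[of _ "Branch S1 S2"])
      then show "ok (Count q (ys1 @ ys2) (Suc (max m1 m2)) f) (Suc 80) ?R ?h K (w - 14) (d + 14)"
        by (intro ok_seq[OF s', of _ _ "w - 28" "d + 28"] ok.terminate) (use c in \<open>simp_all add: prog_nth length_prog\<close>)
    qed (use c in \<open>simp_all add: prog_nth length_prog\<close>)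
  qed
qed

text \<open>Of the 200 credits that a leaf has besides \<open>ew\<close>, 100 are for an inner node.
  There is one inner node fewer than leaves, hence the \<open>w + 100\<close>; each level takes 60
  in depth, for the way down and up together.\<close>

lemma count_ok:
  assumes "tree_at h p A T" "h q = Some [Null]" "q \<notin> A" "R 0 = NodeP p" "R 1 = NodeP q"
    and "\<forall>x \<in> set (items T). E x \<noteq> {} \<and>
      (\<forall>D \<in> E x. is_evaluation D \<and> dag_work (fst D) \<le> ew \<and> dag_span (fst D) \<le> enat es)"
    and "d + 60 * (height T + 1) + es \<le> f" "f \<le> bound" "length (items T) * (ew + 200) \<le> w + 100"
  shows "ok (Count q (filter C (items T)) (height T) f) 64 R h K w d"
  using assms
proof (induction T arbitrary: h p A q R f K w d rule: ltree.induct)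
  case (Leaf x)
  then obtain cs where p: "h p = Some (Null # Null # x # cs)" "A = {p}"
    by (auto elim: tree_at_leafE)
  note q = Leaf.prems(2,3) and R = Leaf.prems(4,5) and c = Leaf.prems(7-9)
  let ?q = "Count q (filter C (items (Leaf x))) (height (Leaf x)) f"
  let ?R = "R(2 := Null, 3 := Null, 4 := x)"
  have s: "seq 4 64 R h = Some (96, ?R, h)" using R p by (simp add: seq_simps)
  have k97: "ok ?q 97 (?R(5 := IntV (if C x then 1 else 0))) h K (w - 8 - ew) (d + 8 + es)"
  proof (cases "C x")
    case False
    have "seq 2 97 (?R(5 := IntV (if C x then 1 else 0))) h
      = Some (88, ?R(5 := IntV (if C x then 1 else 0), 6 := IntV 0), h)"
      using False by (simp add: seq_simps)
    then show ?thesis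
      by (rule ok_seq[where w' = "w - 12 - ew" and d' = "d + 12 + es"], intro ok.terminate)
        (use c q False in \<open>auto simp: prog_nth length_prog pruned_def\<close>)
  next
    case True
    have s: "seq 2 97 (?R(5 := IntV (if C x then 1 else 0))) h
      = Some (99, ?R(5 := IntV 1, 6 := IntV 0), h)"
      using True by (simp add: seq_simps)
    show ?thesis
    proof (rule ok_seq[OF s, where w' = "w - 12 - ew" and d' = "d + 12 + es"], rule ok.new)
      fix a assume a: "a \<notin> dom h"
      then have ne: "a \<noteq> q" "a \<noteq> p" using p q by auto
      let ?h = "h(a \<mapsto> batch_node Null Null (Leaf x), q \<mapsto> [NodeP a])"
      have "\<exists>R'. seq 6 (Suc 99) (?R(5 := IntV 1, 6 := IntV 0, 9 := NodeP a)) (h(a \<mapsto> replicate 6 Null)) = Some (88, R', ?h)"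
        using R q ne by (auto simp: seq_simps batch_node_def replicate_numeral)
      then obtain R' where s': "seq 6 (Suc 99) (?R(5 := IntV 1, 6 := IntV 0, 9 := NodeP a)) (h(a \<mapsto> replicate 6 Null)) = Some (88, R', ?h)"
        by blast
      have "stree ?h a {a} (Leaf x)" by (rule stree.leaf) (use ne in simp)
      then have "post ?q R' ?h K" using True ne
        by (auto simp: pruned_def intro!: exI[of _ "{a}"] exI[of _ "Leaf x"])
      then show "ok ?q (Suc 99) (?R(5 := IntV 1, 6 := IntV 0, 9 := NodeP a)) (h(a \<mapsto> replicate 6 Null)) K (w - 14 - ew) (d + 14 + es)"
        by (intro ok_seq[OF s', where w' = "w - 26 - ew" and d' = "d + 26 + es"] ok.terminate)
          (use c in \<open>simp_all add: prog_nth length_prog\<close>)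
    qed (use c in \<open>simp_all add: prog_nth length_prog\<close>)
  qed
  have "ok ?q 96 ?R h K (w - 8) (d + 8)"
    by (rule ok.eval[where r = 5 and r' = 4 and w' = "w - 8 - ew" and d' = "d + 8 + es"])
      (use k97 c Leaf.prems(6) in \<open>simp_all add: prog_nth length_prog\<close>)
  then show ?case by (rule ok_seq[OF s]) (use c in simp_all)
next
  case (Branch T U)
  from Branch.prems(1) obtain l r x cs A1 A2 where
    p: "h p = Some (NodeP l # NodeP r # x # cs)" "A = insert p (A1 \<union> A2)" and
    T: "tree_at h l A1 T" and U: "tree_at h r A2 U" and dis: "A1 \<inter> A2 = {}" "p \<notin> A1 \<union> A2"
    by (rule tree_at_branchE) blast
  note q = Branch.prems(2,3) and R = Branch.prems(4,5) and c = Branch.prems(7-9) and ev = Branch.prems(6)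
  let ?q = "Count q (filter C (items (Branch T U))) (height (Branch T U)) f"
  let ?R = "R(2 := NodeP l, 3 := Null, 4 := NodeP r)"
  have s: "seq 4 64 R h = Some (68, ?R, h)" using R p by (simp add: seq_simps)
  \<comment> \<open>The shares of the children. Every subtree has a leaf, so the truncated
    subtraction is exact.\<close>
  define w1 where "w1 = length (items T) * (ew + 200) - 100"
  define w2 where "w2 = length (items U) * (ew + 200) - 100"
  have "length (items X) > 0" for X :: "val ltree" by (induction X) auto
  then have "1 * (ew + 200) \<le> length (items X) * (ew + 200)" for X :: "val ltree"
    by (intro mult_le_mono1) (simp add: Suc_leI)
  then have n: "100 \<le> length (items X) * (ew + 200)" for X :: "val ltree"
    by (rule order_trans[rotated]) simp
  have "w1 + 100 = length (items T) * (ew + 200)" unfolding w1_def by (rule le_add_diff_inverse2[OF n])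
  moreover have "w2 + 100 = length (items U) * (ew + 200)" unfolding w2_def by (rule le_add_diff_inverse2[OF n])
  ultimately have w12: "w1 + 100 = length (items T) * (ew + 200)" "w2 + 100 = length (items U) * (ew + 200)"
    by blast+
  have cw: "w1 + w2 + 100 \<le> w" using c(3) w12 by (simp add: algebra_simps)
  have hT: "height T + 1 \<le> height (Branch T U)" "height U + 1 \<le> height (Branch T U)" by simp_all
  have cd: "d + 60 * (height T + 2) + es \<le> f" "d + 60 * (height U + 2) + es \<le> f"
    using c(1) mult_le_mono2[OF hT(1), of 60] mult_le_mono2[OF hT(2), of 60] by simp_all
  show ?case
  proof (rule ok_seq[OF s, where w' = "w - 8" and d' = "d + 8"], rule ok.new[where w' = "w - 10" and d' = "d + 10"])
    fix a1 assume a1: "a1 \<notin> dom h"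
    let ?R1 = "?R(5 := NodeP a1)"
    let ?h1 = "h(a1 \<mapsto> replicate 1 Null)"
    show "ok ?q (Suc 68) ?R1 ?h1 K (w - 10) (d + 10)"
    proof (rule ok.new[where w' = "w - 12" and d' = "d + 12"])
      fix a2 assume a2: "a2 \<notin> dom ?h1"
      let ?R2 = "?R1(6 := NodeP a2)"
      let ?h2 = "?h1(a2 \<mapsto> replicate 1 Null)"
      \<comment> \<open>The 34 leave 2 for each of the two joins and 30 for combining the
        results.\<close>
      let ?q1 = "Count a1 (filter C (items T)) (height T) (f - 34)"
      let ?q2 = "Count a2 (filter C (items U)) (height U) (f - 34)"
      \<comment> \<open>Each child owns its subtree and its result node; the parent keeps the rest,
        in particular \<open>q\<close>.\<close>
      let ?h3 = "?h2 |` (- insert a1 A1)"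
      let ?h4 = "?h3 |` (- insert a2 A2)"
      have Ad: "A1 \<subseteq> dom h" "A2 \<subseteq> dom h" using tree_at_dom T U by blast+
      have ne: "a1 \<noteq> q" "a2 \<noteq> q" "a1 \<noteq> a2" "a1 \<notin> A1" "a1 \<notin> A2" "a2 \<notin> A1" "a2 \<notin> A2" "q \<notin> A1" "q \<notin> A2"
        using a1 a2 q Ad p by auto
      show "ok ?q (Suc (Suc 68)) ?R2 ?h2 K (w - 12) (d + 12)"
      proof (rule ok.fork[where ?h1.0 = ?h3 and ?h2.0 = "?h2 |` insert a1 A1" and ?J1.0 = K and ?J2.0 = Map.empty
            and q' = ?q1 and ?w2.0 = "w1 + 6" and ?d2.0 = "d + 14" and ?w1.0 = "w - w1 - 20" and ?d1.0 = "d + 14"])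
        have s1: "\<exists>R'. seq 3 89 ?R2 (?h2 |` insert a1 A1) = Some (64, R', ?h2 |` insert a1 A1) \<and> R' 0 = NodeP l \<and> R' 1 = NodeP a1"
          by (simp add: seq_simps)
        then obtain R' where s1: "seq 3 89 ?R2 (?h2 |` insert a1 A1) = Some (64, R', ?h2 |` insert a1 A1)" "R' 0 = NodeP l" "R' 1 = NodeP a1"
          by blast
        show "ok ?q1 89 ?R2 (?h2 |` insert a1 A1) Map.empty (w1 + 6) (d + 14)"
        proof (rule ok_seq[OF s1(1), where w' = w1 and d' = "d + 20"], rule Branch.IH(1)[OF _ _ ne(4) s1(2,3)])
          show "tree_at (?h2 |` insert a1 A1) l A1 T" by (rule tree_at_cong[OF T]) (use ne in auto)
        qed (use ne ev cd c w12 in auto)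
        fix u1 assume u1: "u1 \<notin> dom K"
        show "ok ?q (Suc (Suc (Suc 68))) (?R2(7 := ThreadP u1)) ?h3 (K(u1 \<mapsto> ?q1)) (w - w1 - 20) (d + 14)"
        proof (rule ok.fork[where ?h1.0 = ?h4 and ?h2.0 = "?h3 |` insert a2 A2" and ?J1.0 = "K(u1 \<mapsto> ?q1)" and ?J2.0 = Map.empty
            and q' = ?q2 and ?w2.0 = "w2 + 6" and ?d2.0 = "d + 16" and ?w1.0 = "w - w1 - w2 - 28" and ?d1.0 = "d + 16"])
          have s1: "\<exists>R'. seq 3 92 (?R2(7 := ThreadP u1)) (?h3 |` insert a2 A2) = Some (64, R', ?h3 |` insert a2 A2) \<and> R' 0 = NodeP r \<and> R' 1 = NodeP a2"
            by (simp add: seq_simps)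
          then obtain R' where s1: "seq 3 92 (?R2(7 := ThreadP u1)) (?h3 |` insert a2 A2) = Some (64, R', ?h3 |` insert a2 A2)" "R' 0 = NodeP r" "R' 1 = NodeP a2"
            by blast
          show "ok ?q2 92 (?R2(7 := ThreadP u1)) (?h3 |` insert a2 A2) Map.empty (w2 + 6) (d + 16)"
          proof (rule ok_seq[OF s1(1), where w' = w2 and d' = "d + 22"], rule Branch.IH(2)[OF _ _ ne(7) s1(2,3)])
            show "tree_at (?h3 |` insert a2 A2) r A2 U" by (rule tree_at_cong[OF U]) (use ne dis in \<open>auto simp: restrict_map_def\<close>)
          qed (use ne ev cd c w12 in auto)
          fix u2 assume u2: "u2 \<notin> dom (K(u1 \<mapsto> ?q1))"
          let ?R4 = "?R2(7 := ThreadP u1, 8 := ThreadP u2)"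
          let ?K2 = "K(u1 \<mapsto> ?q1, u2 \<mapsto> ?q2)"
          define h4 where "h4 = ?h4"
          have h4q: "h4 q = Some [Null]" using q ne by (simp add: h4_def)
          then have qd: "q \<in> dom h4" by blast
          have "ok ?q (Suc (Suc (Suc (Suc 68)))) ?R4 h4 ?K2 (w - w1 - w2 - 28) (d + 16)"
          proof (rule ok.join[where r = 7 and u = u1 and q' = ?q1 and w' = "w - w1 - w2 - 30" and d' = "f - 32"])
            fix R1 g1 K1 assume g1: "post ?q1 R1 g1 K1" "dom h4 \<inter> dom g1 = {}" "dom ?K2 \<inter> dom K1 = {}"
            then obtain v1 A1' where v1: "g1 a1 = Some [v1]" "pruned g1 v1 A1' (filter C (items T)) (height T)" "a1 \<notin> A1'"
              by auto
            show "ok ?q (Suc (Suc (Suc (Suc (Suc 68))))) ?R4 (h4 ++ g1) (?K2(u1 := None) ++ K1) (w - w1 - w2 - 30) (f - 32)"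
            proof (rule ok.join[where r = 8 and u = u2 and q' = ?q2 and w' = "w - w1 - w2 - 32" and d' = "f - 30"])
              show "(?K2(u1 := None) ++ K1) u2 = Some ?q2"
                using u2 g1(3) by (auto simp: map_add_Some_iff domIff)
              fix R2 g2 K2 assume g2: "post ?q2 R2 g2 K2" "dom (h4 ++ g1) \<inter> dom g2 = {}"
              then obtain v2 A2' where v2: "g2 a2 = Some [v2]" "pruned g2 v2 A2' (filter C (items U)) (height U)" "a2 \<notin> A2'"
                by auto
              let ?g = "(h4 ++ g1) ++ g2"
              let ?K3 = "(?K2(u1 := None) ++ K1)(u2 := None) ++ K2"
              have d2: "b \<notin> dom g2 \<and> b \<notin> dom h4" if "b \<in> dom g1" for b
                using g1(2) g2(2) that unfolding dom_map_add by blast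
              have app: "b \<in> dom g2 \<Longrightarrow> ?g b = g2 b" "b \<notin> dom g2 \<Longrightarrow> b \<in> dom g1 \<Longrightarrow> ?g b = g1 b" for b
                by (simp_all add: map_add_dom_app_simps)
              have "q \<notin> dom g1" "q \<notin> dom g2" using qd g1(2) g2(2) unfolding dom_map_add by blast+
              then have "?g q = Some [Null]" using h4q by (simp add: map_add_dom_app_simps)
              moreover have "?g a1 = Some [v1]" using v1(1) d2[of a1] app(2)[of a1] by (metis domI)
              moreover have "?g a2 = Some [v2]" using v2(1) by simp
              moreover have "pruned ?g v1 A1' (filter C (items T)) (height T)"
                by (rule pruned_cong[OF v1(2)])
                  (use pruned_dom[OF v1(2)] d2 app(2) in blast)
              moreover have "pruned ?g v2 A2' (filter C (items U)) (height U)"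
                by (rule pruned_cong[OF v2(2)])
                  (use pruned_dom[OF v2(2)] app(1) in blast)
              moreover have "A1' \<inter> A2' = {}" "q \<notin> A1' \<union> A2'"
                using pruned_dom[OF v1(2)] pruned_dom[OF v2(2)] d2 \<open>q \<notin> dom g1\<close> \<open>q \<notin> dom g2\<close> by blast+
              ultimately have "ok (Count q (filter C (items T) @ filter C (items U)) (Suc (max (height T) (height U))) f) 74
                ?R4 ?g ?K3 (w - w1 - w2 - 32) (f - 30)"
                by (intro count_combine_ok) (use R cd cw in simp_all)
              then show "ok ?q (Suc (Suc (Suc (Suc (Suc (Suc 68)))))) ?R4 ?g ?K3 (w - w1 - w2 - 32) (f - 30)"
                by simp
            qed (use cd cw in \<open>simp_all add: prog_nth length_prog\<close>)
          qed (use cd cw u2 in \<open>auto simp add: prog_nth length_prog\<close>)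
          then show "ok ?q (Suc (Suc (Suc (Suc 68)))) ?R4 ?h4 ?K2 (w - w1 - w2 - 28) (d + 16)"
            by (simp only: h4_def)
        next
          show "?h4 \<subseteq>\<^sub>m ?h3" "?h3 |` insert a2 A2 \<subseteq>\<^sub>m ?h3" by (rule restrict_map_le)+
        qed (use cd cw c in \<open>auto simp add: prog_nth length_prog map_le_def\<close>)
      next
        show "?h3 \<subseteq>\<^sub>m ?h2" "?h2 |` insert a1 A1 \<subseteq>\<^sub>m ?h2" by (rule restrict_map_le)+
      qed (use cd cw c in \<open>auto simp add: prog_nth length_prog map_le_def\<close>)
    qed (use cw in \<open>simp_all add: prog_nth length_prog\<close>)
  qed (use cw in \<open>simp_all add: prog_nth length_prog\<close>)
qed

end

section \<open>Merging\<close>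

text \<open>Recovers level and number of a block from a slot, provided that the number is
  odd.\<close>

lemma odd_times_power2_unique:
  assumes "odd (b :: nat)" "odd b'" "b * 2 ^ j = b' * 2 ^ j'"
  shows "b = b' \<and> j = j'"
proof -
  have le: "j' \<le> j" if "odd b" "b * 2 ^ j = b' * 2 ^ j'" for b b' j j' :: nat
  proof (rule ccontr)
    assume "\<not> j' \<le> j"
    then obtain i where "j' = j + Suc i" by (metis add_Suc_right less_imp_Suc_add linorder_not_le)
    then have "b = b' * 2 ^ Suc i" using that(2) by (simp add: power_add)
    then show False using that(1) by simp
  qed
  have "j = j'" using le[OF assms(1,3)] le[OF assms(2) assms(3)[symmetric]] by simp
  then show ?thesis using assms(3) by simp
qed

text \<open>A thread holding an even block ends on a strictly higher level, and so has a later
  deadline than the neighbour it joins.\<close>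

lemma even_times_power2_less:
  assumes "even (b :: nat)" "odd b'" "b * 2 ^ j = b' * 2 ^ j'"
  shows "j < j'"
proof (rule ccontr)
  assume "\<not> j < j'"
  then obtain i where "j = j' + i" using le_Suc_ex by (metis linorder_not_le)
  then have "b * 2 ^ i = b'" using assms(3) by (simp add: power_add)
  then show False using assms(1,2) by auto
qed

lemma odd_times_power2_exists:
  assumes "0 < s"
  shows "\<exists>j b :: nat. odd b \<and> s = b * 2 ^ j"
  using assms
proof (induction s rule: less_induct)
  case (less s)
  show ?case
  proof (cases "odd s")
    case True
    then show ?thesis by (intro exI[of _ 0] exI[of _ s]) simp
  next
    case False
    then obtain s' where s': "s = 2 * s'" by blast
    then have "s' < s" "0 < s'" using less.prems by simp_all
    then obtain j b where "odd b" "s' = b * 2 ^ j" using less.IH by blast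
    then show ?thesis using s' by (intro exI[of _ "Suc j"] exI[of _ b]) simp
  qed
qed

lemma take_drop_append:
  assumes "a \<le> b" "b \<le> c"
  shows "take (b - a) (drop a xs) @ take (c - b) (drop b xs) = take (c - a) (drop a xs)"
proof -
  obtain m n where "b = a + m" "c = b + n" using assms le_Suc_ex by metis
  then show ?thesis by (simp add: take_add add.commute)
qed

lemma items_not_Nil: "items T \<noteq> []"
  by (induction T) auto

lemma bbt_at_root: "bbt_at H p A B \<Longrightarrow> p \<in> A \<and> balanced B \<and> (\<exists>l r. H p = Some (batch_node l r B))"
  by (induction rule: bbt_at.induct) auto

context filtering begin

lemma rank_mono: "s \<le> s' \<Longrightarrow> rank s \<le> rank s'"
  unfolding rank_def by (auto intro: div_le_mono)

lemma next_token_add: "next_token K' s nt nm \<Longrightarrow> next_token (K ++ K') s nt nm"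
  unfolding next_token_def by (metis map_add_find_right)

text \<open>Two blocks of one level differ in height by at most 1, hence the balance. Halving the
  even number while raising the level keeps the first slot. The new node is spelled out as the
  program computes it.\<close>

lemma merge_block:
  assumes h: "block_at h p A j b" "block_at h p' A' j (b + 1)" and A: "A \<inter> A' = {}" "m \<notin> A" "m \<notin> A'"
    and b: "even b"
  obtains x y x' y' k k' z z' u v where
    "h p = Some [x, y, IntV (int k), IntV (int z), u, v]" "p \<in> A" "p' \<in> A'"
    "\<exists>u' v'. h p' = Some [x', y', IntV (int k'), IntV (int z'), u', v'] \<and>
     block_at (h(m \<mapsto> [NodeP p, NodeP p', IntV (max (int k) (int k') + 1), IntV (int z + int z'), u, v'])) m
       (insert m (A \<union> A')) (Suc j) (b div 2)"
proof -
  obtain B where B: "bbt_at h p A B"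
    "items B = take (rank ((b + 1) * 2 ^ j) - rank (b * 2 ^ j)) (drop (rank (b * 2 ^ j)) xs)"
    "height B \<le> j" "j \<le> height B + 1" using h(1) by (auto simp: block_at_def)
  obtain B' where B': "bbt_at h p' A' B'"
    "items B' = take (rank ((b + 1 + 1) * 2 ^ j) - rank ((b + 1) * 2 ^ j)) (drop (rank ((b + 1) * 2 ^ j)) xs)"
    "height B' \<le> j" "j \<le> height B' + 1" using h(2) unfolding block_at_def by blast
  obtain x y where xy: "h p = Some (batch_node x y B)" using bbt_at_root[OF B(1)] by blast
  obtain x' y' where xy': "h p' = Some (batch_node x' y' B')" using bbt_at_root[OF B'(1)] by blast
  have ne: "items B \<noteq> []" "items B' \<noteq> []" by (rule items_not_Nil)+
  let ?n = "[NodeP p, NodeP p', IntV (max (int (height B)) (int (height B')) + 1),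
    IntV (int (length (items B)) + int (length (items B'))), hd (items B), last (items B')]"
  let ?h = "h(m \<mapsto> ?n)"
  have n: "?n = batch_node (NodeP p) (NodeP p') (Branch B B')" using ne by (simp add: batch_node_def of_nat_max)
  have e: "b div 2 * 2 ^ Suc j = b * 2 ^ j" "(b div 2 + 1) * 2 ^ Suc j = (b + 1 + 1) * 2 ^ j"
    using b by (auto elim!: evenE)
  have "bbt_at ?h m (insert m (A \<union> A')) (Branch B B')"
  proof (rule bbt_at.intros(2))
    show "bbt_at ?h p A B" by (rule bbt_at_cong[OF B(1)]) (use A in auto)
    show "bbt_at ?h p' A' B'" by (rule bbt_at_cong[OF B'(1)]) (use A in auto)
    show "balanced (Branch B B')"
      using bbt_at_root[OF B(1)] bbt_at_root[OF B'(1)] B(3,4) B'(3,4) by auto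
  qed (use A n in auto)
  moreover have "items (Branch B B') = take (rank ((b + 1 + 1) * 2 ^ j) - rank (b * 2 ^ j)) (drop (rank (b * 2 ^ j)) xs)"
    using B(2) B'(2) take_drop_append[of "rank (b * 2 ^ j)" "rank ((b + 1) * 2 ^ j)" "rank ((b + 1 + 1) * 2 ^ j)" xs]
    by (simp add: rank_mono)
  moreover have "height (Branch B B') \<le> Suc j" "Suc j \<le> height (Branch B B') + 1"
    using B(3,4) B'(3,4) by auto
  ultimately have "block_at ?h m (insert m (A \<union> A')) (Suc j) (b div 2)"
    unfolding block_at_def e by blast
  then show thesis
    using that[of x y "height B" "length (items B)" "hd (items B)" "last (items B)" x' y' "height B'" "length (items B')"]
      xy xy' bbt_at_root[OF B(1)] bbt_at_root[OF B'(1)] by (simp add: batch_node_def)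
qed

text \<open>The step counts 22 and 23 differ because the computation of the maximal height skips one
  move. Besides building the node, the code takes over the successor \<open>nt\<close> and its
  mailbox \<open>nm\<close> from the absorbed block.\<close>

lemma merge_step_seq:
  assumes R: "R 0 = NodeP p" "R 6 = NodeP m" "R 7 = IntV (int b)" "R 8 = IntV 2" "R 11 = IntV 1"
    and h: "h p = Some [x, y, IntV (int k), IntV (int z), u, v]"
      "h p' = Some [x', y', IntV (int k'), IntV (int z'), u', v']"
      "h m = Some [NodeP p', nm, nt, c, c', c'']" and ne: "p \<noteq> m" "p' \<noteq> m"
  shows "\<exists>n R'. n \<le> 23 \<and> seq n 37 R h = Some (31, R',
      h(m \<mapsto> [NodeP p, NodeP p', IntV (max (int k) (int k') + 1), IntV (int z + int z'), u, v'])) \<and>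
    R' 0 = NodeP m \<and> R' 1 = R 1 \<and> R' 2 = nt \<and> R' 6 = nm \<and> R' 7 = IntV (int (b div 2)) \<and> R' 10 = R 10"
proof (cases "k' < k")
  case True
  show ?thesis
    by (rule exI[of _ 22]) (use R h ne True in \<open>simp add: seq_simps zdiv_int\<close>)
next
  case False
  show ?thesis
    by (rule exI[of _ 23]) (use R h ne False in \<open>simp add: seq_simps zdiv_int\<close>)
qed

text \<open>Induction on the number of levels above \<open>j\<close>. The first slot
  \<open>b * 2 ^ j\<close> stays fixed while a thread climbs, so its final block is known in
  advance; the main thread starts at slot 0 and never gets an odd number. A level uses at most 58 of
  its 60 credits.\<close>

lemma merge_ok:
  assumes len: "length xs = 2 ^ J + r" "r < 2 ^ J"
    and R: "R 0 = NodeP p" "R 7 = IntV (int b)" "R 10 = Null"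
    and who: "q = Main \<and> b = 0 \<or> (\<exists>j0 b0 m cs. q = Block j0 b0 m \<and> odd b0 \<and> b * 2 ^ j = b0 * 2 ^ j0 \<and>
      R 1 = NodeP m \<and> h m = Some cs \<and> length cs = 6 \<and> m \<notin> A)"
    and blk: "block_at h p A j b" and tok: "next_token K ((b + 1) * 2 ^ j) (R 2) (R 6)"
    and s: "(b + 1) * 2 ^ j \<le> 2 * 2 ^ J" and c: "d \<le> base + 100 * j" "60 * (J + 1 - j) + 20 \<le> w"
  shows "ok q 31 R h K w d"
  using R who blk tok s c
proof (induction "J + 1 - j" arbitrary: j b p A R h K w d rule: less_induct)
  case less
  note R = less.prems(1-3) and who = less.prems(4) and blk = less.prems(5) and tok = less.prems(6)
    and s = less.prems(7) and c = less.prems(8,9)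
  show ?case
  proof (cases "odd b")
    case True
    then obtain j0 b0 m cs where w: "q = Block j0 b0 m" "odd b0" "b * 2 ^ j = b0 * 2 ^ j0"
      "R 1 = NodeP m" "h m = Some cs" "length cs = 6" "m \<notin> A" using who by auto
    \<comment> \<open>An odd number is reached only at the block promised by the
      specification.\<close>
    have q: "q = Block j b m" using odd_times_power2_unique[OF True w(2,3)] w(1) by simp
    obtain c0 c1 c2 c3 c4 c5 where cs: "cs = [c0, c1, c2, c3, c4, c5]"
      using w(6) by (auto simp: length_Suc_conv numeral_eq_Suc)
    have "int b mod 2 = 1" using True by presburger
    then have s: "\<exists>R'. seq 7 31 R h = Some (63, R', h(m \<mapsto> [NodeP p, R 6, R 2, c3, c4, c5]))"
      using R w(4,5) cs by (simp add: seq_simps)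
    then obtain R' where s: "seq 7 31 R h = Some (63, R', h(m \<mapsto> [NodeP p, R 6, R 2, c3, c4, c5]))" by blast
    have "block_at (h(m \<mapsto> [NodeP p, R 6, R 2, c3, c4, c5])) p A j b"
      using blk bbt_at_cong w(7) unfolding block_at_def by (smt (verit) fun_upd_other)
    then have "post q R' (h(m \<mapsto> [NodeP p, R 6, R 2, c3, c4, c5])) K"
      using w(7) tok unfolding q by auto
    then show ?thesis
      by (intro ok_seq[OF s, where w' = "w - 14" and d' = "d + 14"] ok.terminate)
        (use c q in \<open>simp_all add: prog_nth length_prog\<close>)
  next
    case ev: False
    have m0: "int b mod 2 = 0" using ev by presburger
    show ?thesis
    proof (cases "(b + 1) * 2 ^ j = 2 * 2 ^ J")
      case True
      then have "(b + 1) * 2 ^ j = 1 * 2 ^ Suc J" by simp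
      \<comment> \<open>The block ends at the last slot, and \<open>b + 1\<close> is odd, so it is
        the whole output.\<close>
      then have bj: "b = 0" "j = Suc J" using odd_times_power2_unique[of "b + 1" 1 j "Suc J"] ev by auto
      then have q: "q = Main" using who by auto
      have "R 2 = Null" using tok True by (simp add: next_token_def)
      then have s: "\<exists>R'. seq 5 31 R h = Some (63, R', h) \<and> R' 0 = NodeP p"
        using R m0 by (simp add: seq_simps)
      then obtain R' where s: "seq 5 31 R h = Some (63, R', h)" "R' 0 = NodeP p" by blast
      have "rank (2 * 2 ^ J) = length xs" "rank 0 = 0" using len by (simp_all add: rank_def)
      then have "post q R' h K" using blk s(2) bj unfolding q by (auto simp: block_at_def is_batch_def)
      then show ?thesis
        by (intro ok_seq[OF s(1), where w' = "w - 10" and d' = "d + 10"] ok.terminate)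
          (use c q bj in \<open>simp_all add: prog_nth length_prog\<close>)
    next
      case False
      then obtain u j' b' m where t: "R 2 = ThreadP u" "R 6 = NodeP m" "K u = Some (Block j' b' m)" "odd b'"
        "(b + 1) * 2 ^ j = b' * 2 ^ j'" using tok by (auto simp: next_token_def)
      \<comment> \<open>As \<open>b + 1\<close> is odd, the next thread publishes precisely the
        right neighbour on this level.\<close>
      have jb: "j' = j" "b' = b + 1" using odd_times_power2_unique[OF _ t(4,5)] ev by auto
      have jJ: "j \<le> J"
      proof (rule ccontr)
        assume "\<not> j \<le> J"
        then have "2 ^ Suc J \<le> (2 :: nat) ^ j" by (intro power_increasing) auto
        also have "\<dots> \<le> (b + 1) * 2 ^ j" by simp
        finally show False using s False by simp
      qed
      then have pw: "2 * 2 ^ J = 2 * 2 ^ (J - j) * (2 :: nat) ^ j" by (simp add: power_add[symmetric])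
      then have "b + 1 < 2 * 2 ^ (J - j)" using s False by (metis le_neq_implies_less mult_less_cancel2)
      then have b2: "b + 2 \<le> 2 * 2 ^ (J - j)" using ev by presburger
      then have s2: "(b + 2) * 2 ^ j \<le> 2 * 2 ^ J" unfolding pw by (rule mult_le_mono1)
      \<comment> \<open>The rule for joins demands this. For \<open>Block\<close> the final level is
        at least \<open>j + 1\<close>, for \<open>Main\<close> it is \<open>J + 1\<close>.\<close>
      have fq: "base + 100 * j + 120 \<le> fin q"
        using who
      proof (elim disjE exE conjE)
        fix j0 b0 m cs assume "q = Block j0 b0 m" "odd b0" "b * 2 ^ j = b0 * 2 ^ j0"
        then show ?thesis using even_times_power2_less[of b b0 j j0] ev by simp
      qed (use jJ in simp)
      define R1 where "R1 = R(8 := IntV 2, 9 := IntV 0, 11 := IntV 1)"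
      have s1: "seq 5 31 R h = Some (36, R1, h)"
        using R m0 t(1) by (simp add: seq_simps R1_def)
      show ?thesis
      proof (rule ok_seq[OF s1, where w' = "w - 10" and d' = "d + 10"],
          rule ok.join[where r = 2 and u = u and q' = "Block j (b + 1) m" and w' = "w - 12" and d' = "base + 100 * j + 22"])
        fix R' h' K' assume p': "post (Block j (b + 1) m) R' h' K'" "dom h \<inter> dom h' = {}" "dom K \<inter> dom K' = {}"
        then obtain p' nm nt y y' y'' A' where hm: "h' m = Some [NodeP p', nm, nt, y, y', y'']" "m \<notin> A'"
          "block_at h' p' A' j (b + 1)" "next_token K' ((b + 1 + 1) * 2 ^ j) nt nm" by auto
        let ?g = "h ++ h'"
        have gh: "?g a = h a" if "a \<in> dom h" for a using p'(2) that by (metis disjoint_iff map_add_dom_app_simps(3))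
        have gh': "?g a = h' a" if "a \<in> dom h'" for a using that by (simp add: map_add_dom_app_simps(1))
        have Ad: "A \<subseteq> dom h" "A' \<subseteq> dom h'" using blk hm(3) bbt_at_dom unfolding block_at_def by blast+
        have "m \<in> dom h'" using hm(1) by blast
        have mA: "m \<notin> A" "A \<inter> A' = {}" using Ad p'(2) \<open>m \<in> dom h'\<close> by blast+
        have b1: "block_at ?g p A j b"
          using blk bbt_at_cong gh Ad unfolding block_at_def by (metis subsetD)
        have b2: "block_at ?g p' A' j (b + 1)"
          using hm(3) bbt_at_cong gh' Ad unfolding block_at_def by (metis subsetD)
        have "even b" using ev by simp
        from merge_block[OF b1 b2 mA(2,1) hm(2) this] obtain x0 y0 x0' y0' k k' z z' u0 v0 u0' v0' where
          g: "?g p = Some [x0, y0, IntV (int k), IntV (int z), u0, v0]" "p \<in> A" "p' \<in> A'"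
          "?g p' = Some [x0', y0', IntV (int k'), IntV (int z'), u0', v0']"
          "block_at (?g(m \<mapsto> [NodeP p, NodeP p', IntV (max (int k) (int k') + 1), IntV (int z + int z'), u0, v0'])) m
             (insert m (A \<union> A')) (Suc j) (b div 2)" by metis
        let ?g' = "?g(m \<mapsto> [NodeP p, NodeP p', IntV (max (int k) (int k') + 1), IntV (int z + int z'), u0, v0'])"
        have gm: "?g m = Some [NodeP p', nm, nt, y, y', y'']" using hm(1) gh'[OF \<open>m \<in> dom h'\<close>] by simp
        have ne: "p \<noteq> m" "p' \<noteq> m" using mA hm(2) g by blast+
        have R1: "R1 0 = NodeP p" "R1 6 = NodeP m" "R1 7 = IntV (int b)" "R1 8 = IntV 2" "R1 11 = IntV 1"
          "R1 1 = R 1" "R1 10 = Null"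
          using R t by (simp_all add: R1_def)
        obtain n R2 where n: "n \<le> 23" "seq n 37 R1 ?g = Some (31, R2, ?g')"
          "R2 0 = NodeP m" "R2 1 = R1 1" "R2 2 = nt" "R2 6 = nm" "R2 7 = IntV (int (b div 2))" "R2 10 = R1 10"
          using merge_step_seq[OF R1(1-5) g(1,4) gm ne] by blast
        have e: "b div 2 * 2 ^ Suc j = b * 2 ^ j" "(b div 2 + 1) * 2 ^ Suc j = (b + 2) * 2 ^ j"
          using \<open>even b\<close> by (auto elim!: evenE)
        have k: "ok q 31 R2 ?g' (K(u := None) ++ K') (w - 58) (base + 100 * j + 68)"
        proof (rule less.hyps[where j = "Suc j" and b = "b div 2", OF _ n(3,7) _ _ g(5)])
          show "q = Main \<and> b div 2 = 0 \<or> (\<exists>j0 b0 m' cs. q = Block j0 b0 m' \<and> odd b0 \<and>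
              b div 2 * 2 ^ Suc j = b0 * 2 ^ j0 \<and> R2 1 = NodeP m' \<and> ?g' m' = Some cs \<and> length cs = 6 \<and>
              m' \<notin> insert m (A \<union> A'))"
            using who
          proof (elim disjE exE conjE)
            fix j0 b0 m' cs assume w: "q = Block j0 b0 m'" "odd b0" "b * 2 ^ j = b0 * 2 ^ j0"
              "R 1 = NodeP m'" "h m' = Some cs" "length cs = 6" "m' \<notin> A"
            then have "m' \<in> dom h" by blast
            then have "m' \<notin> dom h'" using p'(2) by blast
            then have "m' \<noteq> m" "m' \<notin> A'" using \<open>m \<in> dom h'\<close> Ad by blast+
            moreover have "?g' m' = Some cs" using gh[OF \<open>m' \<in> dom h\<close>] w(5) \<open>m' \<noteq> m\<close> by simp
            ultimately show ?thesis using w n(4) R1(6) e(1) by (metis UnE insertE)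
          qed simp
          show "next_token (K(u := None) ++ K') ((b div 2 + 1) * 2 ^ Suc j) (R2 2) (R2 6)"
            unfolding e(2) n(5,6) by (rule next_token_add) (use hm(4) in simp)
          show "(b div 2 + 1) * 2 ^ Suc j \<le> 2 * 2 ^ J" unfolding e(2) by (rule s2)
        qed (use R1 n jJ c in simp_all)
        have "seq n (Suc 36) R1 ?g = Some (31, R2, ?g')" using n(2) by simp
        then show "ok q (Suc 36) R1 ?g (K(u := None) ++ K') (w - 12) (base + 100 * j + 22)"
          by (rule ok_seq[OF _ k]) (use n(1) jJ c in simp_all)
      qed (use t(1,3) jb c jJ fq in \<open>simp_all add: prog_nth length_prog R1_def\<close>)
    qed
  qed
qed

section \<open>Distribution\<close>

text \<open>Also used at \<open>i = length xs\<close>, where it gives the end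
  \<open>2 * 2 ^ J\<close> of the slots.\<close>

definition slot :: "nat \<Rightarrow> nat" where
  "slot i = (if i < 2 * r then i else 2 * (i - r))"

lemma rank_slot: "rank (slot i) = i"
  by (auto simp: rank_def slot_def)

text \<open>An item of a pair starts as block \<open>lo\<close> of level 0. Any other has slot
  \<open>2 * (lo - r)\<close>, so it starts as block \<open>lo - r\<close> of level 1.\<close>

lemma leaf_ok:
  assumes len: "length xs = 2 ^ J + r" "r < 2 ^ J"
    and v: "h v = Some (batch_node Null Null (Leaf x))" and x: "lo < length xs" "x = xs ! lo"
    and R: "R 0 = NodeP v" "R 3 = IntV (int lo)" "R 4 = IntV (int r)" "R 5 = IntV (int (2 * r))"
    and who: "q = Main \<and> lo = 0 \<or> (\<exists>j0 b0 m cs. q = Block j0 b0 m \<and> odd b0 \<and> slot lo = b0 * 2 ^ j0 \<and>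
      R 1 = NodeP m \<and> h m = Some cs \<and> length cs = 6 \<and> m \<noteq> v)"
    and tok: "next_token K (slot (lo + 1)) (R 2) (R 6)"
    and c: "d + 20 \<le> base" "60 * (J + 1) + 40 \<le> w"
  shows "ok q 15 R h K w d"
proof -
  define j where "j = (if lo < 2 * r then 0 else 1 :: nat)"
  define b where "b = (if lo < 2 * r then lo else lo - r)"
  have sl: "slot lo = b * 2 ^ j" "slot (lo + 1) = (b + 1) * 2 ^ j"
    by (auto simp: slot_def j_def b_def)
  have rk: "rank (b * 2 ^ j) = lo" "rank ((b + 1) * 2 ^ j) = lo + 1"
    using rank_slot sl by metis+
  have s: "\<exists>n R'. n \<le> 6 \<and> seq n 15 R h = Some (31, R', h) \<and> R' 0 = NodeP v \<and> R' 1 = R 1 \<and> R' 2 = R 2 \<and>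
      R' 6 = R 6 \<and> R' 7 = IntV (int b) \<and> R' 10 = Null"
  proof (cases "lo < 2 * r")
    case True
    then have "int lo < 2 * int r" by linarith
    then show ?thesis using R v True
      by (intro exI[of _ 5]) (simp add: seq_simps batch_node_def b_def)
  next
    case False
    then have "\<not> int lo < 2 * int r" "int lo - int r = int (lo - r)" by linarith+
    then show ?thesis using R v False
      by (intro exI[of _ 6]) (simp add: seq_simps batch_node_def b_def)
  qed
  then obtain n R' where n: "n \<le> 6" "seq n 15 R h = Some (31, R', h)" and R': "R' 0 = NodeP v" "R' 1 = R 1" "R' 2 = R 2"
      "R' 6 = R 6" "R' 7 = IntV (int b)" "R' 10 = Null" by blast
  have "bbt_at h v {v} (Leaf x)" using v by (rule bbt_at.intros)
  moreover have "items (Leaf x) = take 1 (drop lo xs)" using x by (simp add: take_Suc_conv_app_nth hd_drop_conv_nth take_Suc)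
  ultimately have blk: "block_at h v {v} j b"
    unfolding block_at_def rk by (intro exI[of _ "Leaf x"]) (simp add: j_def)
  have k: "ok q 31 R' h K (w - 12) (d + 12)"
  proof (rule merge_ok[OF len R'(1,5,6) _ blk])
    show "q = Main \<and> b = 0 \<or> (\<exists>j0 b0 m cs. q = Block j0 b0 m \<and> odd b0 \<and> b * 2 ^ j = b0 * 2 ^ j0 \<and>
      R' 1 = NodeP m \<and> h m = Some cs \<and> length cs = 6 \<and> m \<notin> {v})"
      using who unfolding R'(2) sl(1) by (auto simp: b_def)
    show "next_token K ((b + 1) * 2 ^ j) (R' 2) (R' 6)" using tok sl(2) R' by simp
    show "(b + 1) * 2 ^ j \<le> 2 * 2 ^ J" using x len by (auto simp: b_def j_def)
  qed (use c in auto)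
  show ?thesis by (rule ok_seq[OF n(2) k]) (use n(1) c in simp_all)
qed

lemma slot_less: "length xs = 2 ^ J + r \<Longrightarrow> r < 2 ^ J \<Longrightarrow> i < length xs \<Longrightarrow> slot i < 2 * 2 ^ J"
  by (auto simp: slot_def)

text \<open>The inherited rights \<open>K\<close> concern the thread after the whole subtree, so
  they go with the right part to the forked thread; the running thread keeps the left part and gets
  the right to join the forked one. As in counting, 30 credits per leaf are for an inner
  node.\<close>

lemma walk_ok:
  assumes len: "length xs = 2 ^ J + r" "r < 2 ^ J" and bnd: "base + 100 * (J + 1) + 20 \<le> bound"
    and S: "stree h v A S" "items S = take (length (items S)) (drop lo xs)" "lo + length (items S) \<le> length xs"
    and R: "R 0 = NodeP v" "R 3 = IntV (int lo)" "R 4 = IntV (int r)" "R 5 = IntV (int (2 * r))"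
    and who: "q = Main \<and> lo = 0 \<or> (\<exists>j0 b0 m cs. q = Block j0 b0 m \<and> odd b0 \<and> slot lo = b0 * 2 ^ j0 \<and>
      R 1 = NodeP m \<and> h m = Some cs \<and> length cs = 6 \<and> m \<notin> A)"
    and tok: "next_token K (slot (lo + length (items S))) (R 2) (R 6)"
    and c: "d + 30 * height S + 20 \<le> base" "length (items S) * (60 * (J + 1) + 70) \<le> w + 30"
  shows "ok q 15 R h K w d"
  using S R who tok c
proof (induction S arbitrary: h v A lo R q K w d rule: ltree.induct)
  case (Leaf x)
  from Leaf.prems(1) have v: "h v = Some (batch_node Null Null (Leaf x))" "A = {v}"
    by (auto elim: stree_leafE)
  have lo: "lo < length xs" using Leaf.prems(3) by simp
  then have "x = xs ! lo" using Leaf.prems(2) by (simp add: take_Suc hd_drop_conv_nth)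
  then show ?case using Leaf.prems(4-) v(2)
    by (intro leaf_ok[OF len, where h = h and v = v and x = x and lo = lo, OF v(1) lo]) simp_all
next
  case (Branch T U)
  note R = Branch.prems(4-7) and who = Branch.prems(8) and tok = Branch.prems(9) and c = Branch.prems(10,11)
  from Branch.prems(1) obtain l r' y y' y'' A1 A2 where
    v: "h v = Some [NodeP l, NodeP r', y, IntV (int (length (items T)) + int (length (items U))), y', y'']" "A = insert v (A1 \<union> A2)"
    and T: "stree h l A1 T" and U: "stree h r' A2 U" and dis: "A1 \<inter> A2 = {}" "v \<notin> A1 \<union> A2"
    by (rule stree_branchE) blast
  obtain x0 x1 x2 x4 x5 where l: "h l = Some [x0, x1, x2, IntV (int (length (items T))), x4, x5]"
    using stree_root[OF T] by blast
  define s where "s = lo + length (items T)"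
  have Tn: "0 < length (items T)" "0 < length (items U)" using items_not_Nil by auto
  have s: "0 < s" "s < length xs"
    using Tn Branch.prems(3) by (simp_all add: s_def del: length_greater_0_conv)
  \<comment> \<open>The left subtree has a leaf, so slot 0 remains with the main thread and the slot
    of the forked thread determines its specification.\<close>
  then have "0 < slot s" by (auto simp: slot_def)
  then obtain jc bc where jb: "odd bc" "slot s = bc * 2 ^ jc" using odd_times_power2_exists by blast
  \<comment> \<open>Bounding the level keeps the deadline of the new thread below
    \<open>bound\<close>.\<close>
  have "2 ^ jc \<le> bc * 2 ^ jc" using jb(1) by (cases bc) auto
  also have "\<dots> < 2 ^ Suc J" using slot_less[OF len s(2)] jb(2) by simp
  finally have jJ: "jc \<le> J" by (simp add: power_strict_increasing_iff less_Suc_eq_le del: power_Suc)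
  let ?q = "Block jc bc v"
  let ?h1 = "h |` (- insert v A2)" and ?h2 = "h |` insert v A2"
  define R1 where "R1 = R(7 := NodeP l, 10 := Null, 8 := NodeP r', 9 := IntV (int (length (items T))))"
  have s1: "seq 5 15 R h = Some (20, R1, h)" using R v l by (simp add: seq_simps R1_def)
  define M where "M = 60 * (J + 1) + 70"
  define w1 where "w1 = length (items T) * M - 30"
  define w2 where "w2 = length (items U) * M - 30"
  have "1 * M \<le> length (items X) * M" for X :: "val ltree"
    using items_not_Nil[of X] by (intro mult_le_mono1) (simp add: Suc_leI)
  then have n: "30 \<le> length (items X) * M" for X :: "val ltree"
    by (rule order_trans[rotated]) (simp add: M_def)
  have w1: "w1 + 30 = length (items T) * M" unfolding w1_def by (rule le_add_diff_inverse2[OF n])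
  have w2: "w2 + 30 = length (items U) * M" unfolding w2_def by (rule le_add_diff_inverse2[OF n])
  have cw: "w1 + w2 + 30 \<le> w" using c(2) w1 w2 unfolding M_def[symmetric] by (simp add: algebra_simps)
  have hT: "height T + 1 \<le> height (Branch T U)" "height U + 1 \<le> height (Branch T U)" by simp_all
  have cd: "d + 30 * (height T + 1) + 20 \<le> base" "d + 30 * (height U + 1) + 20 \<le> base"
    using c(1) mult_le_mono2[OF hT(1), of 30] mult_le_mono2[OF hT(2), of 30] by linarith+
  have it: "items T @ items U = take (length (items T) + length (items U)) (drop lo xs)"
    using Branch.prems(2) by simp
  have "take (length (items T)) (items T @ items U) = take (length (items T)) (drop lo xs)"
    "drop (length (items T)) (items T @ items U) = take (length (items U)) (drop s xs)"
    unfolding it by (simp_all only: take_take drop_take drop_drop s_def) (simp_all add: add.commute)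
  then have iT: "items T = take (length (items T)) (drop lo xs)" "items U = take (length (items U)) (drop s xs)"
    by simp_all
  show ?case
  proof (rule ok_seq[OF s1, where w' = "w - 10" and d' = "d + 10"],
      rule ok.fork[where ?h1.0 = ?h1 and ?h2.0 = ?h2 and ?J1.0 = Map.empty and ?J2.0 = K and q' = ?q
        and ?w1.0 = "w1 + 6" and ?w2.0 = "w2 + 8" and ?d1.0 = "d + 12" and ?d2.0 = "d + 12"])
    show "?h1 \<subseteq>\<^sub>m h" "?h2 \<subseteq>\<^sub>m h" by (rule restrict_map_le)+
    show "dom ?h1 \<inter> dom ?h2 = {}" by auto
    have "\<exists>R'. seq 4 24 R1 ?h2 = Some (15, R', ?h2) \<and> R' 0 = NodeP r' \<and> R' 3 = IntV (int s) \<and> R' 4 = R 4 \<and>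
      R' 5 = R 5 \<and> R' 1 = NodeP v \<and> R' 2 = R 2 \<and> R' 6 = R 6"
      using R by (simp add: seq_simps R1_def s_def)
    then obtain R' where R': "seq 4 24 R1 ?h2 = Some (15, R', ?h2)" "R' 0 = NodeP r'" "R' 3 = IntV (int s)"
      "R' 4 = R 4" "R' 5 = R 5" "R' 1 = NodeP v" "R' 2 = R 2" "R' 6 = R 6" by blast
    have "ok ?q 15 R' ?h2 K w2 (d + 20)"
    proof (rule Branch.IH(2)[OF _ iT(2) _ R'(2,3)])
      show "stree ?h2 r' A2 U" by (rule stree_cong[OF U]) (simp add: restrict_map_def)
      show "?q = Main \<and> s = 0 \<or> (\<exists>j0 b0 m cs. ?q = Block j0 b0 m \<and> odd b0 \<and> slot s = b0 * 2 ^ j0 \<and>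
          R' 1 = NodeP m \<and> ?h2 m = Some cs \<and> length cs = 6 \<and> m \<notin> A2)"
        using jb R'(6) v(1) dis(2) by simp
      show "next_token K (slot (s + length (items U))) (R' 2) (R' 6)"
        using tok R' by (simp add: s_def add.assoc)
    qed (use R R' Branch.prems(3) cd w2 in \<open>simp_all add: s_def M_def\<close>)
    then show "ok ?q 24 R1 ?h2 K (w2 + 8) (d + 12)" by (rule ok_seq[OF R'(1)]) simp_all
  next
    fix u assume u: "u \<notin> dom K"
    have "\<exists>R'. seq 3 (Suc 20) (R1(2 := ThreadP u)) ?h1 = Some (15, R', ?h1) \<and> R' 0 = NodeP l \<and> R' 3 = R 3 \<and> R' 4 = R 4 \<and>
      R' 5 = R 5 \<and> R' 1 = R 1 \<and> R' 2 = ThreadP u \<and> R' 6 = NodeP v"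
      using R by (simp add: seq_simps R1_def)
    then obtain R' where R': "seq 3 (Suc 20) (R1(2 := ThreadP u)) ?h1 = Some (15, R', ?h1)" "R' 0 = NodeP l" "R' 3 = R 3"
      "R' 4 = R 4" "R' 5 = R 5" "R' 1 = R 1" "R' 2 = ThreadP u" "R' 6 = NodeP v" by blast
    have "ok q 15 R' ?h1 [u \<mapsto> ?q] w1 (d + 18)"
    proof (rule Branch.IH(1)[where lo = lo and v = l and h = ?h1 and A = A1 and R = R', OF _ iT(1) _ R'(2)])
      show "stree ?h1 l A1 T" by (rule stree_cong[OF T]) (use dis in \<open>auto simp: restrict_map_def\<close>)
      show "q = Main \<and> lo = 0 \<or> (\<exists>j0 b0 m cs. q = Block j0 b0 m \<and> odd b0 \<and> slot lo = b0 * 2 ^ j0 \<and>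
          R' 1 = NodeP m \<and> ?h1 m = Some cs \<and> length cs = 6 \<and> m \<notin> A1)"
        using who
      proof (elim disjE exE conjE)
        fix j0 b0 m cs assume w: "q = Block j0 b0 m" "odd b0" "slot lo = b0 * 2 ^ j0"
          "R 1 = NodeP m" "h m = Some cs" "length cs = 6" "m \<notin> A"
        then have "?h1 m = Some cs" "m \<notin> A1" using v(2) by (simp_all add: restrict_map_def)
        then show ?thesis using w R'(6) by simp
      qed simp
      have "slot s \<noteq> 2 * 2 ^ J" using slot_less[OF len s(2)] by simp
      then show "next_token [u \<mapsto> ?q] (slot (lo + length (items T))) (R' 2) (R' 6)"
        using jb R'(7,8) unfolding s_def[symmetric] next_token_def by simp
    qed (use R R' Branch.prems(3) cd w1 in \<open>simp_all add: M_def\<close>)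
    then show "ok q (Suc 20) (R1(2 := ThreadP u)) ?h1 [u \<mapsto> ?q] (w1 + 6) (d + 12)"
      by (rule ok_seq[OF R'(1)]) simp_all
  qed (use cw bnd jJ in \<open>simp_all add: prog_nth length_prog\<close>)
qed

end

lemma (in race_free) seq_append:
  "seq m l R h = Some (l', R', h') \<Longrightarrow> seq (m + n) l R h = seq n l' R' h'"
  by (induction m arbitrary: l R h) (auto split: if_splits option.splits)

text \<open>Turns the logarithmic number of merging levels into a bound by the height.\<close>

lemma length_items_le: "length (items T) \<le> 2 ^ height T"
proof (induction T)
  case (Branch T U)
  have "(2 :: nat) ^ height T \<le> 2 ^ max (height T) (height U)" "(2 :: nat) ^ height U \<le> 2 ^ max (height T) (height U)"
    by (simp_all add: power_increasing)
  then show ?case using Branch by (simp, linarith)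
qed simp

context filtering begin

text \<open>A doubling loop with 4 instructions per round and 5 to leave it. Being sequential, it
  costs \<open>O(J)\<close> in depth, which the height covers.\<close>

lemma split_seq:
  assumes len: "length xs = 2 ^ J + r" "r < 2 ^ J" and i: "i \<le> J"
    and R: "R 3 = IntV (int (length xs))" "R 4 = IntV (2 ^ i)"
  shows "\<exists>n R'. n \<le> 4 * (J - i) + 5 \<and> seq n 8 R h = Some (15, R', h) \<and> R' 0 = R 0 \<and> R' 2 = R 2 \<and>
    R' 3 = IntV (int 0) \<and> R' 4 = IntV (int r) \<and> R' 5 = IntV (int (2 * r))"
  using i R
proof (induction "J - i" arbitrary: i R)
  case 0
  have "int (length xs) < 2 ^ J + 2 ^ J"
  proof -
    have "int (length xs) < int (2 ^ J + 2 ^ J)" using len by linarith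
    then show ?thesis by simp
  qed
  moreover have "int (length xs) - 2 ^ J = int r" using len by simp
  ultimately show ?case using 0 by (intro exI[of _ 5]) (simp add: seq_simps)
next
  case (Suc k)
  have "Suc i \<le> J" using Suc(2) by simp
  then have "(2 :: nat) ^ Suc i \<le> 2 ^ J" by (intro power_increasing) auto
  then have "int (2 ^ Suc i) \<le> int (length xs)" unfolding len of_nat_le_iff by simp
  then have "\<not> int (length xs) < 2 ^ i + 2 ^ i" by simp
  then have "\<exists>R'. seq 4 8 R h = Some (8, R', h) \<and> R' 0 = R 0 \<and> R' 2 = R 2 \<and> R' 3 = R 3 \<and> R' 4 = IntV (2 ^ Suc i)"
    using Suc.prems by (simp add: seq_simps)
  then obtain R1 where R1: "seq 4 8 R h = Some (8, R1, h)" "R1 0 = R 0" "R1 2 = R 2" "R1 3 = R 3" "R1 4 = IntV (2 ^ Suc i)"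
    by blast
  have "k = J - Suc i" using Suc(2) by simp
  from Suc(1)[OF this \<open>Suc i \<le> J\<close>, of R1] R1 Suc.prems obtain n R' where
    "n \<le> 4 * (J - Suc i) + 5" "seq n 8 R1 h = Some (15, R', h)" "R' 0 = R 0" "R' 2 = R 2"
    "R' 3 = IntV (int 0)" "R' 4 = IntV (int r)" "R' 5 = IntV (int (2 * r))" by auto
  then show ?case using seq_append[OF R1(1), of n] Suc(2)
    by (intro exI[of _ "4 + n"] exI[of _ R']) simp
qed

lemma main_ok:
  assumes T: "tree_at H p A T" and xs: "xs = filter C (items T)"
    and ev: "\<forall>x \<in> set (items T). E x \<noteq> {} \<and>
      (\<forall>D \<in> E x. is_evaluation D \<and> dag_work (fst D) \<le> ew \<and> dag_span (fst D) \<le> enat es)"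
    and len: "xs \<noteq> [] \<Longrightarrow> length xs = 2 ^ J + r \<and> r < 2 ^ J"
    and base: "base = 60 * (height T + 1) + es + 8 * J + 30 * height T + 70"
    and bound: "bound = base + 100 * (J + 1) + 20"
    and W: "W = 8 * J + 60 + length (items T) * (ew + 200) + length xs * (60 * (J + 1) + 70)"
  shows "ok Main 0 ((\<lambda>_. Null)(0 := NodeP p)) H Map.empty W 0"
proof -
  \<comment> \<open>The deadline of counting, which starts at depth 4. In \<open>base\<close>,
    \<open>8 * J\<close> is for the doubling loop and 30 per level for the distribution.\<close>
  define f where "f = 60 * (height T + 1) + es + 4"
  define w1 where "w1 = length xs * (60 * (J + 1) + 70)"
  define w2 where "w2 = length (items T) * (ew + 200)"
  have c: "f + 8 * J + 30 * height T + 66 \<le> base" "8 * J + 60 + w1 + w2 \<le> W"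
    and bound: "base + 100 * (J + 1) + 20 \<le> bound"
    by (simp_all add: base W f_def w1_def w2_def bound)
  let ?R0 = "(\<lambda>_. Null)(0 := NodeP p)"
  show ?thesis
  proof (rule ok.new[where w' = "W - 2" and d' = 2])
    fix a assume a: "a \<notin> dom H"
    let ?R = "?R0(1 := NodeP a)" and ?h = "H(a \<mapsto> replicate 1 Null)" and ?q = "Count a xs (height T) f"
    have aA: "a \<notin> A" using a tree_at_dom[OF T] by blast
    show "ok Main (Suc 0) ?R ?h Map.empty (W - 2) 2"
    proof (rule ok.fork[where ?h1.0 = Map.empty and ?h2.0 = ?h and ?J1.0 = Map.empty and ?J2.0 = Map.empty
          and q' = ?q and ?w1.0 = "8 * J + 56 + w1" and ?w2.0 = w2 and ?d1.0 = 4 and ?d2.0 = 4])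
      have "ok (Count a (filter C (items T)) (height T) f) 64 ?R ?h Map.empty w2 4"
      proof (rule count_ok[OF _ _ aA _ _ ev])
        show "tree_at ?h p A T" by (rule tree_at_cong[OF T]) (use aA in auto)
      qed (use bound c in \<open>simp_all add: f_def w2_def\<close>)
      then show "ok ?q 64 ?R ?h Map.empty w2 4" by (simp only: xs[symmetric])
    next
      fix u :: tid
      show "ok Main (Suc (Suc 0)) (?R(2 := ThreadP u)) Map.empty [u \<mapsto> ?q] (8 * J + 56 + w1) 4"
      proof (rule ok.join[where r = 2 and u = u and q' = ?q and w' = "8 * J + 54 + w1" and d' = "f + 2"])
        fix R' h K assume "post ?q R' h K"
        then obtain v A' where v: "h a = Some [v]" "pruned h v A' xs (height T)" by auto
        let ?R1 = "?R(2 := ThreadP u)" and ?K = "[u \<mapsto> ?q](u := None) ++ K"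
        have "ok Main 3 ?R1 h ?K (8 * J + 54 + w1) (f + 2)"
        proof (cases "v = Null")
          case True
          then have "xs = []" using v(2) by (auto simp: pruned_def)
          have "\<exists>R'. seq 3 3 ?R1 h = Some (63, R', h) \<and> R' 0 = Null" using v(1) True by (simp add: seq_simps)
          then obtain R' where s: "seq 3 3 ?R1 h = Some (63, R', h)" "R' 0 = Null" by blast
          have "is_batch h (R' 0) xs" using s(2) \<open>xs = []\<close> by (simp add: is_batch_def)
          then have "post Main R' h ?K" by (simp only: post.simps)
          then show ?thesis
            by (intro ok_seq[OF s(1), where w' = "8 * J + 48 + w1" and d' = "f + 8"] ok.terminate)
              (use c in \<open>simp_all add: prog_nth length_prog\<close>)
        next
          case False
          then obtain p' S where S: "v = NodeP p'" "stree h p' A' S" "items S = xs" "height S \<le> height T"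
            using v(2) by (auto simp: pruned_def)
          have "xs \<noteq> []" using S(3) items_not_Nil by blast
          then have l: "length xs = 2 ^ J + r" "r < 2 ^ J" using len by blast+
          have "\<exists>R'. seq 5 3 ?R1 h = Some (8, R', h) \<and> R' 0 = NodeP p' \<and> R' 2 = Null \<and>
              R' 3 = IntV (int (length xs)) \<and> R' 4 = IntV (2 ^ 0)"
            using v(1) S(1,3) stree_root[OF S(2)] by (auto simp: seq_simps)
          then obtain R2 where R2: "seq 5 3 ?R1 h = Some (8, R2, h)" "R2 0 = NodeP p'" "R2 2 = Null"
            "R2 3 = IntV (int (length xs))" "R2 4 = IntV (2 ^ 0)" by blast
          obtain n R3 where n: "n \<le> 4 * J + 5" and s: "seq n 8 R2 h = Some (15, R3, h)" and R3: "R3 0 = NodeP p'" "R3 2 = Null"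
            "R3 3 = IntV (int 0)" "R3 4 = IntV (int r)" "R3 5 = IntV (int (2 * r))"
            using split_seq[OF l le0 R2(4,5), of h] R2(2,3) by auto
          have "slot (0 + length (items S)) = 2 * 2 ^ J" using l S(3) by (simp add: slot_def)
          then have "next_token ?K (slot (0 + length (items S))) (R3 2) (R3 6)"
            using R3(2) by (simp add: next_token_def)
          then have k: "ok Main 15 R3 h ?K (w1 + 8) (f + 22 + 8 * J)"
            by (intro walk_ok[OF l _ S(2) _ _ R3(1,3,4,5)]) (use S c bound in \<open>simp_all add: w1_def\<close>)
          have "seq (5 + n) 3 ?R1 h = Some (15, R3, h)" using seq_append[OF R2(1), of n] s by simp
          then show ?thesis by (rule ok_seq[OF _ k]) (use n in simp_all)
        qed
        then show "ok Main (Suc (Suc (Suc 0))) ?R1 (Map.empty ++ h) ?K (8 * J + 54 + w1) (f + 2)"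
          by (simp add: numeral_3_eq_3)
      qed (use c in \<open>simp_all add: prog_nth length_prog numeral_2_eq_2[symmetric] f_def\<close>)
    qed (use c bound in \<open>simp_all add: prog_nth length_prog numeral_2_eq_2[symmetric]\<close>)
  qed (use c in \<open>simp_all add: prog_nth length_prog\<close>)
qed

end

section \<open>The asymptotic bounds\<close>

lemma dag_span_ge_weight:
  assumes "v < length (weights G)"
  shows "enat (weights G ! v) \<le> dag_span G"
  unfolding dag_span_def by (rule SUP_upper2[of "[v]"]) (use assms in \<open>simp_all add: dag_path_def\<close>)

text \<open>Forces \<open>w\<close> and \<open>s\<close> to be positive, as a tree has a leaf.
  Additive constants are then absorbed even for height 0 or an empty output.\<close>

lemma evaluation_costs_pos:
  assumes "is_evaluation D"
  shows "1 \<le> dag_work (fst D)" "1 \<le> dag_span (fst D)"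
proof -
  have 0: "0 < length (weights (fst D))" using assms by (auto simp: is_evaluation_def)
  then have 1: "weights (fst D) ! 0 \<in> set (weights (fst D))" by (rule nth_mem)
  then have 2: "1 \<le> weights (fst D) ! 0" using assms by (auto simp: is_evaluation_def)
  then show "1 \<le> dag_work (fst D)" unfolding dag_work_def using member_le_sum_list[OF 1] by linarith
  have "1 \<le> enat (weights (fst D) ! 0)" using 2 by (simp add: one_enat_def)
  then show "1 \<le> dag_span (fst D)" using dag_span_ge_weight[OF 0] order_trans by blast
qed

theorem mainTheorem5:
  "\<exists>P :: program. \<forall>a :: nat. \<exists>c :: nat.
     \<forall>(T :: val ltree) (H :: addr \<rightharpoonup> val list) (p :: addr) (A :: addr set)
      (C :: val \<Rightarrow> bool) (E :: val \<Rightarrow> evaluation set) (n :: nat) (h :: nat) (k :: nat)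
      (w :: nat) (s :: nat) (\<sigma> :: state).
       finite (dom H) \<longrightarrow> tree_at H p A T \<longrightarrow>
       n = length (items T) \<longrightarrow> h = height T \<longrightarrow> k = length (filter C (items T)) \<longrightarrow>
       (\<forall>x \<in> set (items T). E x \<noteq> {} \<and>
          (\<forall>D \<in> E x. is_evaluation D \<and>
             dag_work (fst D) \<le> a * w \<and> dag_span (fst D) \<le> enat (a * s))) \<longrightarrow>
       reachable P C E (initial H (NodeP p)) \<sigma> \<longrightarrow>
         (\<forall>x. returned \<sigma> x \<longrightarrow> is_batch (heap \<sigma>) x (filter C (items T))) \<and>
         (halted P C E \<sigma> \<longrightarrow> (\<exists>x. returned \<sigma> x)) \<and>
         dag_work (exec_dag \<sigma>) \<le> c * (n * w + k * h) \<and>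
         dag_span (exec_dag \<sigma>) \<le> enat (c * (h + s))"
proof (rule exI[of _ prog], intro allI exI impI)
  fix a T H p A C and E :: "val \<Rightarrow> evaluation set" and n h k w s \<sigma>
  assume H: "finite (dom H)" and T: "tree_at H p A T" and n: "n = length (items T)" and h: "h = height T"
    and k: "k = length (filter C (items T))"
    and ev: "\<forall>x \<in> set (items T). E x \<noteq> {} \<and>
          (\<forall>D \<in> E x. is_evaluation D \<and>
             dag_work (fst D) \<le> a * w \<and> dag_span (fst D) \<le> enat (a * s))"
    and r: "reachable prog C E (initial H (NodeP p)) \<sigma>"
  let ?xs = "filter C (items T)"
  obtain x where "x \<in> set (items T)" using items_not_Nil[of T] by fastforce
  then obtain D where D: "is_evaluation D" "dag_work (fst D) \<le> a * w" "dag_span (fst D) \<le> enat (a * s)"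
    using ev by blast
  have "1 \<le> a * w" using evaluation_costs_pos(1)[OF D(1)] D(2) by linarith
  then have w: "1 \<le> w" by (cases w) auto
  have "1 \<le> enat (a * s)" using evaluation_costs_pos(2)[OF D(1)] D(3) order_trans by blast
  then have s: "1 \<le> s" by (cases s) (auto simp: one_enat_def)
  \<comment> \<open>\<open>J\<close> is the binary logarithm of \<open>k\<close>, rounded down, or 0
    if nothing survives. The bound by \<open>h\<close> serves the span, that by \<open>k * h\<close>
    the work.\<close>
  have "\<exists>J r. (?xs \<noteq> [] \<longrightarrow> length ?xs = 2 ^ J + r \<and> r < 2 ^ J) \<and> J \<le> k * h \<and> J \<le> h"
  proof (cases "?xs = []")
    case False
    then have k1: "1 \<le> k" using k by (simp add: Suc_leI)
    then obtain J where J: "2 ^ J \<le> k" "k < 2 ^ (J + 1)" using ex_power_ivl1[of 2 k] by auto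
    have "k \<le> n" unfolding k n by (rule length_filter_le)
    also have "\<dots> \<le> 2 ^ h" unfolding n h by (rule length_items_le)
    finally have "(2 :: nat) ^ J \<le> 2 ^ h" using J(1) by linarith
    then have Jh: "J \<le> h" by simp
    also have "\<dots> \<le> k * h" using k1 by (cases k) auto
    finally show ?thesis using J Jh k by (intro exI[of _ J] exI[of _ "k - 2 ^ J"]) auto
  qed (intro exI[of _ 0], simp)
  then obtain J r where Jr: "?xs \<noteq> [] \<Longrightarrow> length ?xs = 2 ^ J + r \<and> r < 2 ^ J" and J: "J \<le> k * h" "J \<le> h" by blast
  define base where "base = 60 * (height T + 1) + a * s + 8 * J + 30 * height T + 70"
  define bound where "bound = base + 100 * (J + 1) + 20"
  define W where "W = 8 * J + 60 + length (items T) * (a * w + 200) + length ?xs * (60 * (J + 1) + 70)"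
  interpret F: filtering C E ?xs J r base bound "a * w" "a * s" W .
  have m: "F.ok Main 0 ((\<lambda>_. Null)(0 := NodeP p)) H Map.empty W 0"
    by (rule F.main_ok[OF T refl ev Jr base_def bound_def W_def])
  have f: "F.fin Main \<le> bound" by (simp add: bound_def)
  note sound = F.race_free_sound[OF m H f r]
  have nw: "n \<le> n * w" "1 \<le> n * w" "k \<le> n * w"
  proof -
    show "n \<le> n * w" using w by (cases w) auto
    moreover have "k \<le> n" unfolding k n by (rule length_filter_le)
    ultimately show "k \<le> n * w" by linarith
    have "1 \<le> n" unfolding n using items_not_Nil[of T] by (simp add: Suc_leI)
    then show "1 \<le> n * w" using \<open>n \<le> n * w\<close> by linarith
  qed
  have "W = 8 * J + 60 + a * (n * w) + 200 * n + 60 * (k * J) + 130 * k"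
    by (simp add: W_def n k algebra_simps)
  \<comment> \<open>Only the terms with \<open>J\<close> need \<open>k * h\<close>; all others are
    covered by \<open>n * w\<close>, because \<open>k <= n <= n * w\<close>.\<close>
  also have "\<dots> \<le> 8 * (k * h) + 60 * (n * w) + a * (n * w) + 200 * (n * w) + 60 * (k * h) + 130 * (n * w)"
    using J nw mult_le_mono2[OF J(2), of k] by linarith
  also have "\<dots> \<le> (500 + a) * (n * w + k * h)" by (simp add: algebra_simps)
  finally have W: "W \<le> (500 + a) * (n * w + k * h)" .
  have "bound \<le> 500 * h + 500 * s + a * s"
  proof -
    have "60 * (y + 1) + z + 8 * J + 30 * y + 70 + 100 * (J + 1) + 20 \<le> 500 * y + 500 * s + z"
      if "J \<le> y" for y z :: nat
    proof -
      have "250 \<le> 500 * s" using s by simp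
      moreover have "108 * J \<le> 108 * y" using that by simp
      ultimately show ?thesis by simp
    qed
    from this[OF J(2), of "a * s"] show ?thesis by (simp only: bound_def base_def h)
  qed
  also have "\<dots> \<le> (500 + a) * (h + s)" by (simp add: algebra_simps)
  finally have b: "enat bound \<le> enat ((500 + a) * (h + s))" by simp
  show "(\<forall>x. returned \<sigma> x \<longrightarrow> is_batch (heap \<sigma>) x ?xs) \<and>
         (halted prog C E \<sigma> \<longrightarrow> (\<exists>x. returned \<sigma> x)) \<and>
         dag_work (exec_dag \<sigma>) \<le> (500 + a) * (n * w + k * h) \<and>
         dag_span (exec_dag \<sigma>) \<le> enat ((500 + a) * (h + s))"
  proof (intro conjI allI impI)
    fix x assume "returned \<sigma> x"
    from sound(1)[OF this] obtain R g K where R: "R 0 = x" "g \<subseteq>\<^sub>m heap \<sigma>" "F.post Main R g K" by blast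
    have "bbt_at (heap \<sigma>) q B U" if "bbt_at g q B U" for q B U
      by (rule bbt_at_cong[OF that]) (use R(2) bbt_at_dom[OF that] in \<open>metis map_le_def subsetD\<close>)
    then show "is_batch (heap \<sigma>) x ?xs" using R(1,3) unfolding F.post.simps is_batch_def by metis
  next
    show "dag_work (exec_dag \<sigma>) \<le> (500 + a) * (n * w + k * h)" using sound(3) W by linarith
    show "dag_span (exec_dag \<sigma>) \<le> enat ((500 + a) * (h + s))" using sound(4) b by (rule order_trans)
  qed (rule sound(2))
qed

end
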